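(* Let $\Phi(z)=z^r(1+\log^+ z)^\delta$, with $r\geq 1$ and $\delta \geq 0$. Let $0<\gamma<n/r$, $r<p<n/\gamma$ and $1/q=1/p-\gamma/n$. Let $u\in A_1$ and let $v$ be a weight on $\mathbb{R}^n$ such that $v^{q(1/p+1/r')}\in A_\infty$. Then there is a constant $C>0$ such that the inequality \[\left[uv^{q(1/p+1/r')}\left(\left\{x\in \mathbb{R}^n: \frac{M_{\gamma,\Phi}(fv)(x)}{M_{\varphi} v(x)}>t\right\}\right)\right]^{1/q}\leq C\left[ \int_{\mathbb{R}^n}\left(\frac{|f(x)|}{t}\right)^pu^{p/q}(x)\,(v(x))^{1+p/r'}\,dx\right]^{1/p}\] holds for every $t>0$ and every measurable function $f$ on $\mathbb{R}^n$, where $\varphi(z)=z^{q/p+q/r'}(1+\log^+ z)^{n\delta/(n-r\gamma)}$.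
   Context: A weight is a nonnegative measurable function on $\mathbb{R}^n$ that is positive and finite almost everywhere; members of the classes $A_1$, $A_\infty$ below are in addition locally integrable. Cubes have sides parallel to the coordinate axes. For a nonnegative function $w$ and a measurable set $E$, $w(E)=\int_E w$. $\log^+z=\max\{0,\log z\}$ (with $\log^+0=0$). $r'$ is the conjugate exponent of $r$, $1/r+1/r'=1$ (so $1/r'=0$ if $r=1$). $A_1$ is the Muckenhoupt class of weights $w$ for which there is $C>0$ with $\frac1{|Q|}\int_Q w\le C\,w(x)$ for almost every $x\in Q$ and every cube $Q$. A weight $w$ belongs to $A_\infty$ if there is $C>0$ such that $\left(\frac{1}{|Q|}\int_Q w\right)\exp\left(\frac{1}{|Q|}\int_Q \log w^{-1}\right)\leq C$ for every cube $Q$. For a Young function $\Phi$ and a cube $Q$, the Luxemburg average is $\|f\|_{\Phi,Q}=\inf\left\{\lambda>0:\frac1{|Q|}\int_Q\Phi\left(\frac{|f|}{\lambda}\right)\le1\right\}$. The generalized maximal operator is $M_\Phi f(x)=\sup_{Q\ni x}\|f\|_{\Phi,Q}$, and for $0<\gamma<n$ the generalized fractional maximal operator is $M_{\gamma,\Phi}f(x)=\sup_{Q\ni x}|Q|^{\gamma/n}\|f\|_{\Phi,Q}$, the suprema being over all cubes $Q$ containing $x$. *)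

theory Defs
  imports "HOL-Analysis.Analysis"
begin

definition log_plus :: "real \<Rightarrow> real" where
  "log_plus z = max 0 (ln z)"

text \<open>Continuation of a real function to \<open>[0,\<infinity>]\<close> with value \<open>\<infinity>\<close> at \<open>\<infinity>\<close>.
  It is meant for nonnegative functions on \<open>[0,\<infinity>)\<close> tending to \<open>\<infinity>\<close>, such as
  Young functions and powers with positive exponent.\<close>

definition ext_top :: "(real \<Rightarrow> real) \<Rightarrow> ennreal \<Rightarrow> ennreal" where
  "ext_top \<Phi> z = (if z = \<infinity> then \<infinity> else ennreal (\<Phi> (enn2real z)))"

text \<open>Powers of extended nonnegative numbers, used only for exponents \<open>a > 0\<close>;
  thus \<open>0\<close> and \<open>\<infinity>\<close> are fixed.\<close>

definition epow :: "ennreal \<Rightarrow> real \<Rightarrow> ennreal" where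
  "epow z a = ext_top (\<lambda>s. s powr a) z"

text \<open>Reciprocal \<open>1/r'\<close> of the conjugate exponent of \<open>r\<close>; it is \<open>0\<close> for \<open>r = 1\<close>,
  where \<open>r' = \<infinity>\<close>.\<close>

definition recip_conj :: "real \<Rightarrow> real" where
  "recip_conj r = 1 - 1 / r"

text \<open>Cubes are closed and nondegenerate. The suprema defining the maximal operators below
  are the same for open cubes.\<close>

definition cube :: "(real^'n) set \<Rightarrow> bool" where
  "cube Q \<longleftrightarrow> (\<exists>a l. l > 0 \<and> Q = cbox a (\<chi> i. a $ i + l))"

definition wmeasure :: "(real^'n \<Rightarrow> ennreal) \<Rightarrow> (real^'n) set \<Rightarrow> ennreal" where
  "wmeasure w E = (\<integral>\<^sup>+x\<in>E. w x \<partial>lebesgue)"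

definition avg :: "(real^'n) set \<Rightarrow> (real^'n \<Rightarrow> ennreal) \<Rightarrow> ennreal" where
  "avg Q g = (\<integral>\<^sup>+x\<in>Q. g x \<partial>lebesgue) / emeasure lebesgue Q"

text \<open>Weights may take the values \<open>0\<close> and \<open>\<infinity>\<close> on a null set.\<close>

definition weight :: "(real^'n \<Rightarrow> ennreal) \<Rightarrow> bool" where
  "weight w \<longleftrightarrow> w \<in> borel_measurable lebesgue \<and> (AE x in lebesgue. 0 < w x \<and> w x < \<infinity>)"

definition locally_integrable :: "(real^'n \<Rightarrow> ennreal) \<Rightarrow> bool" where
  "locally_integrable w \<longleftrightarrow>
     w \<in> borel_measurable lebesgue \<and> (\<forall>K. compact K \<longrightarrow> (\<integral>\<^sup>+x\<in>K. w x \<partial>lebesgue) < \<infinity>)"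

definition A_1 :: "(real^'n \<Rightarrow> ennreal) set" where
  "A_1 = {w. weight w \<and> locally_integrable w \<and>
     (\<exists>C::real. C > 0 \<and> (\<forall>Q. cube Q \<longrightarrow>
        (AE x in lebesgue. x \<in> Q \<longrightarrow> avg Q w \<le> ennreal C * w x)))}"

text \<open>For a locally integrable weight the integral of \<open>log (1/w)\<close> over a cube exists in
  \<open>(-\<infinity>,\<infinity>]\<close>, and a bound on the product in the definition forces it to be finite. Since
  the Bochner integral of a nonintegrable function is \<open>0\<close>, this finiteness has to be
  required explicitly.\<close>

definition A_infty :: "(real^'n \<Rightarrow> ennreal) set" where
  "A_infty = {w. weight w \<and> locally_integrable w \<and>
     (\<exists>C::real. C > 0 \<and> (\<forall>Q. cube Q \<longrightarrow>
        set_integrable lebesgue Q (\<lambda>x. ln (inverse (enn2real (w x)))) \<and>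
        avg Q w *
          ennreal (exp ((LINT x:Q|lebesgue. ln (inverse (enn2real (w x)))) / measure lebesgue Q))
        \<le> ennreal C))}"

text \<open>The following operators depend only on the absolute value of the function they act on;
  the argument \<open>g\<close> is that absolute value. The infimum of the empty set is \<open>\<infinity>\<close>.\<close>

definition lux_avg :: "(real \<Rightarrow> real) \<Rightarrow> (real^'n \<Rightarrow> ennreal) \<Rightarrow> (real^'n) set \<Rightarrow> ennreal" where
  "lux_avg \<Phi> g Q =
     (INF s \<in> {s::real. s > 0 \<and> avg Q (\<lambda>x. ext_top \<Phi> (g x / ennreal s)) \<le> 1}. ennreal s)"

definition maximal :: "(real \<Rightarrow> real) \<Rightarrow> (real^'n \<Rightarrow> ennreal) \<Rightarrow> real^'n \<Rightarrow> ennreal" where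
  "maximal \<Phi> g x = (SUP Q \<in> {Q. cube Q \<and> x \<in> Q}. lux_avg \<Phi> g Q)"

definition frac_maximal ::
    "real \<Rightarrow> (real \<Rightarrow> real) \<Rightarrow> (real^'n \<Rightarrow> ennreal) \<Rightarrow> real^'n \<Rightarrow> ennreal" where
  "frac_maximal \<gamma> \<Phi> g x =
     (SUP Q \<in> {Q. cube Q \<and> x \<in> Q}.
        ennreal (measure lebesgue Q powr (\<gamma> / real CARD('n))) * lux_avg \<Phi> g Q)"

end

theory Submission
  imports Defs
begin

text \<open>
  Put \<open>w = v\<^sup>s\<close> with \<open>s = q(1/p + 1/r')\<close>, \<open>\<kappa> = q/p > 1\<close> and \<open>g = (|f|/t)\<^sup>p v\<^bsup>1+p/r'\<^esup>\<close>. If \<open>x\<close> lies in the level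
  set, it lies in a cube \<open>Q\<close> with \<open>|Q|\<^bsup>\<gamma>/n\<^esup> \<parallel>fv\<parallel>\<^bsub>\<Phi>,Q\<^esub> > t M\<^sub>\<phi> v(x)\<close>, and \<open>(2 M\<^sub>\<phi> v(x))\<^sup>s\<close> dominates the averages
  \<open>w\<^sub>R\<close> over all cubes \<open>R\<close> containing \<open>x\<close>. Since \<open>r < p\<close> and \<open>s > 1\<close>, the function \<open>\<Phi>\<close> can be replaced by
  a power \<open>z\<^bsup>r1\<^esup>\<close> with \<open>1/r1 = 1/p + \<beta>/s\<close>, \<open>\<beta> = 1/r - 1/p\<close>, and Hoelder's inequality yields
  \<open>2\<^sup>k|Q| \<le> C (\<integral>\<^sub>Q g)\<^sup>\<kappa> (w\<^sub>Q/2\<^sup>k)\<^sup>\<rho>\<close>, where \<open>2\<^sup>k\<close> is comparable to \<open>(2 M\<^sub>\<phi> v(x))\<^sup>s\<close>, \<open>w\<^sub>Q \<le> 2\<^sup>k\<close>, and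
  \<open>\<rho> = q\<beta>/s > 0\<close>. As \<open>w(x) \<le> 2\<^sup>k\<close> almost everywhere, a Vitali selection among the cubes of equal
  \<open>k\<close> and the doubling property of \<open>u\<close> reduce the claim to a bound for \<open>\<Sum> 2\<^sup>k|Q| u\<^sub>Q\<close>.

  Cubes with different \<open>k\<close> may overlap. Fix the dyadic size \<open>2\<^sup>j\<close> of \<open>w\<^sub>Q/2\<^sup>k\<close>. Because \<open>w\<close> is
  comparable to \<open>w\<^sub>Q\<close> or larger on half of \<open>Q\<close>, the sum of \<open>2\<^sup>k|Q|\<close> is, up to a constant, a sum over disjoint
  cubes, to which the superadditivity of \<open>z\<^sup>\<kappa>\<close> applies. The factor \<open>2\<^bsup>j\<rho>\<^esup>\<close> makes the sum over \<open>j \<le> 0\<close>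
  converge. For \<open>u\<close>, only cubes with \<open>u\<^sub>Q\<close> of size \<open>2\<^sup>i\<close> are treated together; on them \<open>u\<close> is at least
  \<open>c2\<^sup>i\<close>, and \<open>\<Sum>\<^sub>i 2\<^sup>i (\<integral>\<^bsub>{u > c2\<^sup>i}\<^esub> g)\<^sup>\<kappa> \<le> C (\<integral> g u\<^bsup>1/\<kappa>\<^esup>)\<^sup>\<kappa>\<close>.
\<close>

section \<open>Cubes and combinatorial tools\<close>

text \<open>Centre and half-side replace the corner and side used by \<open>cube\<close>, so that
  dilation about the centre just multiplies the second argument.\<close>

definition cub :: "real^'n \<Rightarrow> real \<Rightarrow> (real^'n) set" where
  "cub c h = cbox (\<chi> i. c $ i - h) (\<chi> i. c $ i + h)"

lemma mem_cub: "x \<in> cub c h \<longleftrightarrow> (\<forall>i. \<bar>x $ i - c $ i\<bar> \<le> h)"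
proof -
  have "(a - h \<le> b \<and> b \<le> a + h) \<longleftrightarrow> \<bar>b - a\<bar> \<le> h" for a b :: real by linarith
  then show ?thesis unfolding cub_def mem_box_cart vec_lambda_beta by simp
qed

lemma cube_iff_cub: "cube Q \<longleftrightarrow> (\<exists>c h. h > 0 \<and> Q = cub c h)"
proof
  assume "cube Q"
  then obtain a l where l: "l > 0" "Q = cbox a (\<chi> i. a $ i + l)"
    unfolding cube_def by auto
  have "Q = cub (\<chi> i. a $ i + l / 2) (l / 2)"
    unfolding l cub_def by (auto intro!: arg_cong2[where f = cbox] simp: vec_eq_iff)
  with l show "\<exists>c h. h > 0 \<and> Q = cub c h" by (intro exI[of _ "\<chi> i. a $ i + l / 2"] exI[of _ "l / 2"]) auto
next
  assume "\<exists>c h. h > 0 \<and> Q = cub c h"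
  then obtain c h where h: "h > 0" "Q = cub c h" by auto
  have "Q = cbox (\<chi> i. c $ i - h) (\<chi> i. (\<chi> i. c $ i - h) $ i + 2 * h)"
    unfolding h cub_def by (auto intro!: arg_cong2[where f = cbox] simp: vec_eq_iff)
  with h show "cube Q" unfolding cube_def
    by (intro exI[of _ "\<chi> i. c $ i - h"] exI[of _ "2 * h"]) auto
qed

lemma cube_cub [simp]: "h > 0 \<Longrightarrow> cube (cub c h)"
  using cube_iff_cub by blast

lemma lmeasurable_cub [simp, intro]: "cub c h \<in> lmeasurable"
  unfolding cub_def by simp

lemma sets_cub [simp, measurable, intro]: "cub c h \<in> sets lebesgue"
  using lmeasurable_cub fmeasurableD by blast

lemma compact_cub [simp]: "compact (cub c h)"
  unfolding cub_def by (rule compact_cbox)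

lemma measure_cub:
  fixes c :: "real^'n"
  assumes "h \<ge> 0"
  shows "measure lebesgue (cub c h) = (2 * h) ^ CARD('n)"
proof -
  have "cub c h \<noteq> {}" using assms mem_cub[of c c h] by auto
  then have "measure lborel (cub c h) = (\<Prod>i\<in>UNIV. (\<chi> i. c $ i + h) $ i - (\<chi> i. c $ i - h) $ i)"
    unfolding cub_def by (subst content_cbox_cart) (auto)
  also have "\<dots> = (2 * h) ^ CARD('n)" by simp
  finally show ?thesis unfolding cub_def by simp
qed

lemma measure_cub_pos [simp]: "h > 0 \<Longrightarrow> measure lebesgue (cub c h) > 0"
  by (simp add: measure_cub)

lemma emeasure_cub: "emeasure lebesgue (cub c h) = ennreal (measure lebesgue (cub c h))"
  by (rule emeasure_eq_measure2) (simp add: fmeasurableD2)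

lemma measure_cub_scale:
  fixes c :: "real^'n"
  assumes "h \<ge> 0" "a \<ge> 0"
  shows "measure lebesgue (cub c (a * h)) = a ^ CARD('n) * measure lebesgue (cub c h)"
  using assms by (simp add: measure_cub power_mult_distrib)

lemma cub_mono: "h \<le> h' \<Longrightarrow> cub c h \<subseteq> cub c h'"
  unfolding mem_cub subset_iff by (meson order_trans)

text \<open>Going through a common point changes each coordinate distance by at most
  \<open>h + h' \<le> 2 * h'\<close>. The first inclusion is the usual Vitali one; the second serves
  families whose doubled cubes do the covering.\<close>

lemma cub_meet_subset:
  assumes "cub c h \<inter> cub c' h' \<noteq> {}" "h \<le> h'"
  shows "cub c h \<subseteq> cub c' (3 * h')" and "cub c (2 * h) \<subseteq> cub c' (4 * h')"
proof -
  obtain z where z: "z \<in> cub c h" "z \<in> cub c' h'" using assms by auto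
  have *: "\<bar>x $ i - c' $ i\<bar> \<le> t + 2 * h'" if "\<bar>x $ i - c $ i\<bar> \<le> t" for x i t
    using z[unfolded mem_cub, rule_format, of i] that assms(2) by linarith
  show "cub c h \<subseteq> cub c' (3 * h')"
  proof
    fix x assume "x \<in> cub c h"
    then have "\<bar>x $ i - c' $ i\<bar> \<le> h + 2 * h'" for i using *[of x i h] by (simp add: mem_cub)
    moreover have "h + 2 * h' \<le> 3 * h'" using assms(2) by simp
    ultimately show "x \<in> cub c' (3 * h')" unfolding mem_cub by (meson order_trans)
  qed
  show "cub c (2 * h) \<subseteq> cub c' (4 * h')"
  proof
    fix x assume "x \<in> cub c (2 * h)"
    then have "\<bar>x $ i - c' $ i\<bar> \<le> 2 * h + 2 * h'" for i using *[of x i "2 * h"] by (simp add: mem_cub)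
    moreover have "2 * h + 2 * h' \<le> 4 * h'" using assms(2) by simp
    ultimately show "x \<in> cub c' (4 * h')" unfolding mem_cub by (meson order_trans)
  qed
qed

text \<open>Greedy choice: keep an index of largest \<open>h\<close>, discard everything meeting it,
  and repeat. The relation \<open>meet\<close> is abstract because it stands both for intersection
  alone and for intersection at equal height.\<close>

lemma finite_Vitali:
  fixes h :: "'a \<Rightarrow> real"
  assumes "finite F" and sym: "\<And>i j. meet i j \<Longrightarrow> meet j i" and refl: "\<And>i. i \<in> F \<Longrightarrow> meet i i"
  shows "\<exists>J\<subseteq>F. pairwise (\<lambda>i j. \<not> meet i j) J \<and> (\<forall>i\<in>F. \<exists>j\<in>J. meet i j \<and> h i \<le> h j)"
  using assms(1) refl
proof (induction F rule: finite_psubset_induct)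
  case (psubset F)
  show ?case
  proof (cases "F = {}")
    case True
    then show ?thesis by auto
  next
    case False
    then have "Max (h ` F) \<in> h ` F" using psubset.hyps by simp
    then obtain m where m: "m \<in> F" "h m = Max (h ` F)" by auto
    have max: "h i \<le> h m" if "i \<in> F" for i using m psubset.hyps that by simp
    \<comment> \<open>As \<open>m\<close> meets itself, it is discarded too, and the induction
      hypothesis applies to a proper subset.\<close>
    define F' where "F' = {i \<in> F. \<not> meet i m}"
    have sub: "F' \<subset> F" using m psubset.prems F'_def by auto
    have refl: "\<And>i. i \<in> F' \<Longrightarrow> meet i i" using psubset.prems F'_def by auto
    obtain J where J: "J \<subseteq> F'" "pairwise (\<lambda>i j. \<not> meet i j) J"
        "\<forall>i\<in>F'. \<exists>j\<in>J. meet i j \<and> h i \<le> h j"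
      using psubset.IH[OF sub refl] by auto
    have "pairwise (\<lambda>i j. \<not> meet i j) (insert m J)"
    proof -
      have "\<not> meet j m \<and> \<not> meet m j" if "j \<in> J" for j
        using that J(1) sym[of m j] F'_def by auto
      then show ?thesis using J(2) by (simp add: pairwise_insert)
    qed
    moreover have "\<exists>j\<in>insert m J. meet i j \<and> h i \<le> h j" if "i \<in> F" for i
    proof (cases "meet i m")
      case True
      then show ?thesis using max[OF that] by auto
    next
      case False
      then show ?thesis using J(3) that F'_def by auto
    qed
    moreover have "insert m J \<subseteq> F" using J m F'_def by auto
    ultimately show ?thesis by blast
  qed
qed

text \<open>The admissible terms descend from the exponent \<open>\<lfloor>log 2 y\<rfloor>\<close>
  with ratio \<open>2 powr (- \<theta>)\<close>. Indexing by the distance from that exponent embeds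
  them in a full geometric series, so the bound does not depend on \<open>K\<close>.\<close>

lemma geometric_sum_below:
  fixes K :: "int set"
  assumes K: "finite K" and \<theta>: "\<theta> > 0" and y: "y \<ge> 0"
  shows "(\<Sum>k\<in>{k\<in>K. 2 powr real_of_int k \<le> y}. (2 powr real_of_int k) powr \<theta>)
           \<le> y powr \<theta> / (1 - 2 powr (- \<theta>))"
proof (cases "y = 0")
  case True
  then have "{k\<in>K. 2 powr real_of_int k \<le> y} = {}" by (auto simp: not_le)
  then show ?thesis using True by (simp only: sum.empty powr_0 div_0)
next
  case False
  with y have y: "y > 0" by simp
  define m where "m = \<lfloor>log 2 y\<rfloor>"
  define a where "a = (2::real) powr (- \<theta>)"
  have a: "0 < a" "a < 1" using \<theta> unfolding a_def by (auto simp: powr_less_one)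
  let ?K = "{k\<in>K. 2 powr real_of_int k \<le> y}"
  have km: "k \<le> m" if "k \<in> ?K" for k
    using that y unfolding m_def le_floor_iff by (simp add: le_log_iff)
  have eq: "(2 powr real_of_int k) powr \<theta> = 2 powr (\<theta> * m) * a ^ nat (m - k)" if "k \<in> ?K" for k
  proof -
    have "a ^ nat (m - k) = 2 powr (- \<theta> * real (nat (m - k)))"
      unfolding a_def by (simp add: powr_realpow[symmetric] powr_powr)
    also have "real (nat (m - k)) = real_of_int m - real_of_int k" using km[OF that] by simp
    finally show ?thesis by (simp add: powr_powr powr_add[symmetric] algebra_simps)
  qed
  have inj: "inj_on (\<lambda>k. nat (m - k)) ?K" 
  proof (rule inj_onI)
    fix j k assume "j \<in> ?K" "k \<in> ?K" "nat (m - j) = nat (m - k)"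
    then show "j = k" using km[of j] km[of k] by simp
  qed
  have "(\<Sum>k\<in>?K. (2 powr real_of_int k) powr \<theta>) = 2 powr (\<theta> * m) * (\<Sum>k\<in>?K. a ^ nat (m - k))"
    unfolding sum_distrib_left by (rule sum.cong) (use eq in auto)
  also have "(\<Sum>k\<in>?K. a ^ nat (m - k)) = (\<Sum>j\<in>(\<lambda>k. nat (m - k)) ` ?K. a ^ j)"
    using sum.reindex[OF inj, of "\<lambda>j. a ^ j"] by simp
  also have "\<dots> \<le> (\<Sum>j. a ^ j)"
    using a K by (intro sum_le_suminf summable_geometric) auto
  also have "\<dots> = 1 / (1 - a)" using a by (intro suminf_geometric) auto
  finally have "(\<Sum>k\<in>?K. (2 powr real_of_int k) powr \<theta>) \<le> 2 powr (\<theta> * m) * (1 / (1 - a))"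
    by simp
  also have "2 powr (\<theta> * m) \<le> y powr \<theta>"
  proof -
    have "2 powr real_of_int m \<le> y"
      using y unfolding m_def by (simp add: powr_le_iff)
    then show ?thesis using \<theta> powr_mono2[of \<theta> "2 powr real_of_int m" y]
      by (simp add: powr_powr mult.commute)
  qed
  finally show ?thesis using a by (simp add: a_def divide_right_mono)
qed

text \<open>Turning the condition on \<open>k\<close> into an indicator allows the bound to be used
  pointwise under an integral. For \<open>y = top\<close> the right-hand side is infinite.\<close>

lemma ennreal_geometric_sum_below:
  fixes K :: "int set" and y :: ennreal
  assumes K: "finite K" and \<theta>: "\<theta> > 0"
  shows "(\<Sum>k\<in>K. ennreal ((2 powr real_of_int k) powr \<theta>) * indicator {k. ennreal (2 powr real_of_int k) \<le> y} k)
           \<le> ennreal (1 / (1 - 2 powr (- \<theta>))) * epow y \<theta>"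
proof (cases y)
  case top
  have "(2::real) powr (- \<theta>) < 1" using \<theta> by (simp add: powr_less_one)
  then show ?thesis using top \<theta> by (simp add: epow_def ext_top_def ennreal_mult_top)
next
  case (real z)
  have "(\<Sum>k\<in>K. ennreal ((2 powr real_of_int k) powr \<theta>) * indicator {k. ennreal (2 powr real_of_int k) \<le> y} k)
     = (\<Sum>k\<in>{k\<in>K. 2 powr real_of_int k \<le> z}. ennreal ((2 powr real_of_int k) powr \<theta>))"
    using K real by (intro sum.mono_neutral_cong_right) (auto simp: indicator_def)
  also have "\<dots> = ennreal (\<Sum>k\<in>{k\<in>K. 2 powr real_of_int k \<le> z}. (2 powr real_of_int k) powr \<theta>)"
    by (simp add: sum_ennreal)
  also have "\<dots> \<le> ennreal (z powr \<theta> / (1 - 2 powr (- \<theta>)))"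
    using geometric_sum_below[OF K \<theta> real(1)] by (rule ennreal_leI)
  also have "\<dots> = ennreal (1 / (1 - 2 powr (- \<theta>))) * epow y \<theta>"
  proof -
    have "(2::real) powr (- \<theta>) < 1" using \<theta> by (simp add: powr_less_one)
    then show ?thesis using real by (simp add: epow_def ext_top_def ennreal_mult[symmetric])
  qed
  finally show ?thesis .
qed

section \<open>Muckenhoupt weights\<close>

lemma enn2real_ennreal_le: "0 < a \<Longrightarrow> a \<le> enn2real z \<Longrightarrow> ennreal a \<le> z"
  by (cases z) auto

lemma nn_set_integral_eq_avg:
  assumes "h > 0"
  shows "(\<integral>\<^sup>+x\<in>cub c h. w x \<partial>lebesgue) = avg (cub c h) w * emeasure lebesgue (cub c h)"
  unfolding avg_def using assms measure_cub_pos[OF assms, of c]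
  by (simp add: emeasure_cub ennreal_divide_times ennreal_divide_self del: measure_cub_pos)

lemma avg_finite:
  assumes "locally_integrable w" "h > 0"
  shows "avg (cub c h) w < \<infinity>"
  using assms measure_cub_pos[OF assms(2), of c]
  unfolding locally_integrable_def avg_def emeasure_cub
  by (auto simp: ennreal_divide_eq_top_iff less_top[symmetric] simp del: measure_cub_pos)

lemma avg_pos:
  assumes "weight w" "h > 0"
  shows "avg (cub c h) w > 0"
proof (rule ccontr)
  assume "\<not> avg (cub c h) w > 0"
  then have "(\<integral>\<^sup>+x. w x * indicator (cub c h) x \<partial>lebesgue) = 0"
    unfolding nn_set_integral_eq_avg[OF assms(2)] by simp
  then have "AE x in lebesgue. w x * indicator (cub c h) x = 0"
    using assms(1) unfolding weight_def by (subst (asm) nn_integral_0_iff_AE) auto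
  moreover have "AE x in lebesgue. w x > 0" using assms(1) unfolding weight_def by auto
  ultimately have "AE x in lebesgue. x \<notin> cub c h" by eventually_elim (auto simp: indicator_def split: if_splits)
  then have "emeasure lebesgue (cub c h) = 0"
    by (subst (asm) AE_iff_measurable[where N = "cub c h"]) auto
  then show False using measure_cub_pos[OF assms(2), of c] by (simp add: emeasure_cub del: measure_cub_pos)
qed

text \<open>With \<open>y / A\<close> added, the logarithm of \<open>A / y\<close> cannot become
  negative, since \<open>ln x \<le> x - 1\<close>. The added term has average \<open>1\<close> on a
  cube where \<open>A\<close> is the average of \<open>y\<close>, so its cost is bounded.\<close>

lemma ln_plus_ratio_bound:
  fixes A y :: real
  assumes "A > 0" "y > 0"
  shows "ln A + ln (inverse y) + y / A \<ge> max 0 (ln (A / y))"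
proof -
  have eq: "ln A + ln (inverse y) = ln (A / y)" using assms by (simp add: ln_div ln_inverse)
  have "ln (y / A) \<le> y / A - 1" using assms by (intro ln_le_minus_one) auto
  moreover have "ln (y / A) = - ln (A / y)" using assms by (simp add: ln_div)
  ultimately show ?thesis unfolding eq using assms by simp
qed

text \<open>The \<open>A_infty\<close> condition bounds the average of the nonnegative function
  \<open>ln A + ln (1 / w) + w / A\<close>, where \<open>A\<close> is the average of
  \<open>w\<close>. This function is large where \<open>w\<close> is much smaller than
  \<open>A\<close>, so Chebyshev's inequality applies.\<close>

lemma A_infty_small_values:
  fixes w :: "real^'n \<Rightarrow> ennreal"
  assumes w: "w \<in> A_infty" and \<delta>: "\<delta> > 0"
  shows "\<exists>\<gamma>>0. \<forall>c h. h > 0 \<longrightarrow>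
    measure lebesgue {x\<in>cub c h. enn2real (w x) < \<gamma> * enn2real (avg (cub c h) w)}
      \<le> \<delta> * measure lebesgue (cub c h)"
proof -
  from w obtain C :: real where C: "C > 0" and ww: "weight w" and loc: "locally_integrable w"
    and A: "\<And>Q. cube Q \<Longrightarrow> set_integrable lebesgue Q (\<lambda>x. ln (inverse (enn2real (w x))))"
      "\<And>Q. cube Q \<Longrightarrow> avg Q w *
          ennreal (exp ((LINT x:Q|lebesgue. ln (inverse (enn2real (w x)))) / measure lebesgue Q))
        \<le> ennreal C"
    unfolding A_infty_def by auto
  have wm [measurable]: "w \<in> borel_measurable lebesgue" using ww unfolding weight_def by auto
  \<comment> \<open>\<open>N\<close> bounds the average \<open>ln C + 1\<close> of that function and
    is kept positive by the absolute value; \<open>\<gamma>\<close> is chosen with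
    \<open>ln (1 / \<gamma>) = N / \<delta>\<close>.\<close>
  define N where "N = \<bar>ln C\<bar> + 1"
  define \<gamma> where "\<gamma> = exp (- (N / \<delta>))"
  have N: "N > 0" unfolding N_def by simp
  have "measure lebesgue {x\<in>cub c h. enn2real (w x) < \<gamma> * enn2real (avg (cub c h) w)}
      \<le> \<delta> * measure lebesgue (cub c h)" if h: "h > 0" for c h
  proof -
    define Q where "Q = cub c h"
    define m where "m = measure lebesgue Q"
    define A where "A = enn2real (avg Q w)"
    define y where "y x = enn2real (w x)" for x
    define I where "I = (LINT x:Q|lebesgue. ln (inverse (y x)))"
    have m: "m > 0" using h unfolding m_def Q_def by simp
    have Qs [measurable]: "Q \<in> sets lebesgue" unfolding Q_def by simp
    have Qf: "Q \<in> lmeasurable" unfolding Q_def by simp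
    have eA: "avg Q w = ennreal A" using avg_finite[OF loc h, of c] unfolding A_def Q_def by simp
    have A0: "A > 0" using avg_pos[OF ww h, of c] eA unfolding Q_def by (simp add: ennreal_less_zero_iff)
    have "ennreal (A * exp (I / m)) \<le> ennreal C"
      using A(2)[of Q] h A0 unfolding Q_def[symmetric] eA I_def m_def y_def
      by (simp add: ennreal_mult Q_def)
    then have "A * exp (I / m) \<le> C" using C by simp
    then have "ln (A * exp (I / m)) \<le> ln C" using A0 C by simp
    then have "ln A + I / m \<le> ln C" using A0 by (simp add: ln_mult)
    then have IN: "ln A * m + I + m \<le> N * m"
    proof -
      have "ln A + I / m + 1 \<le> N" using \<open>ln A + I / m \<le> ln C\<close> unfolding N_def by linarith
      then have "(ln A + I / m + 1) * m \<le> N * m" using m by (intro mult_right_mono) auto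
      then show ?thesis using m by (simp add: distrib_right)
    qed
    have AEw: "AE x in lebesgue. w x = ennreal (y x) \<and> y x > 0"
    proof -
      have "AE x in lebesgue. 0 < w x \<and> w x < \<infinity>" using ww unfolding weight_def by auto
      then show ?thesis by eventually_elim (simp add: y_def enn2real_positive_iff less_top)
    qed
    have ny: "(\<integral>\<^sup>+x. ennreal (indicator Q x * y x) \<partial>lebesgue) = ennreal (A * m)"
    proof -
      have "(\<integral>\<^sup>+x. ennreal (indicator Q x * y x) \<partial>lebesgue) = (\<integral>\<^sup>+x\<in>Q. w x \<partial>lebesgue)"
        by (rule nn_integral_cong_AE) (use AEw in \<open>eventually_elim, auto simp: indicator_def\<close>)
      also have "\<dots> = ennreal (A * m)"
        unfolding Q_def nn_set_integral_eq_avg[OF h] using eA A0 m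
        by (simp add: Q_def m_def emeasure_cub ennreal_mult)
      finally show ?thesis .
    qed
    have ym [measurable]: "y \<in> borel_measurable lebesgue" unfolding y_def by simp
    have yint: "integrable lebesgue (\<lambda>x. indicator Q x * y x)"
      using ny by (intro integrableI_nonneg) (auto simp: y_def)
    have yI: "(LINT x|lebesgue. indicator Q x * y x) = A * m"
      using ny A0 m by (intro integral_eq_nn_integral[THEN trans]) (auto simp: y_def)
    have lint: "integrable lebesgue (\<lambda>x. indicator Q x * ln (inverse (y x)))"
      using A(1)[of Q] h unfolding set_integrable_def y_def Q_def by simp
    have lI: "(LINT x|lebesgue. indicator Q x * ln (inverse (y x))) = I"
      unfolding I_def set_lebesgue_integral_def by simp
    have iint: "integrable lebesgue (indicator Q :: _ \<Rightarrow> real)" using Qf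
      by (simp add: fmeasurable_def)
    have iI: "(LINT x|lebesgue. indicator Q x) = m" unfolding m_def by simp
    define \<psi> where "\<psi> x = ln A * indicator Q x + indicator Q x * ln (inverse (y x)) + (indicator Q x * y x) / A" for x
    have pint: "integrable lebesgue \<psi>" unfolding \<psi>_def
      using yint lint iint by simp
    have pI: "(LINT x|lebesgue. \<psi> x) = ln A * m + I + m"
      unfolding \<psi>_def using yint lint iint yI lI iI A0
      by (simp add: Bochner_Integration.integral_add)
    define S where "S = {x\<in>Q. y x < \<gamma> * A}"
    have Sm [measurable]: "S \<in> sets lebesgue" 
    proof -
      have "S = Q \<inter> {x\<in>space lebesgue. y x < \<gamma> * A}" unfolding S_def by auto
      also have "\<dots> \<in> sets lebesgue" by measurable
      finally show ?thesis .
    qed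
    have Sf: "S \<in> lmeasurable"
      by (rule fmeasurableI2[OF Qf]) (auto simp: S_def Sm[unfolded S_def])
    \<comment> \<open>Chebyshev's inequality: \<open>\<psi>\<close> is nonnegative almost everywhere
      and at least \<open>N / \<delta>\<close> almost everywhere on \<open>S\<close>.\<close>
    have "(LINT x|lebesgue. N / \<delta> * indicator S x) \<le> (LINT x|lebesgue. \<psi> x)"
    proof (rule integral_mono_AE)
      show "integrable lebesgue (\<lambda>x. N / \<delta> * indicator S x)"
        using Sf by (simp add: fmeasurable_def)
      show "AE x in lebesgue. N / \<delta> * indicator S x \<le> \<psi> x"
        using AEw
      proof eventually_elim
        case (elim x)
        have b: "ln A + ln (inverse (y x)) + y x / A \<ge> max 0 (ln (A / y x))"
          using ln_plus_ratio_bound[OF A0] elim by auto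
        show ?case
        proof (cases "x \<in> S")
          case True
          then have "y x < \<gamma> * A" "x \<in> Q" unfolding S_def by auto
          then have "1 / \<gamma> \<le> A / y x" using elim A0 unfolding \<gamma>_def by (simp add: field_simps)
          then have "ln (1 / \<gamma>) \<le> ln (A / y x)" using elim A0 unfolding \<gamma>_def by (subst ln_le_cancel_iff) auto
          moreover have "ln (1 / \<gamma>) = N / \<delta>" unfolding \<gamma>_def by (simp add: ln_div)
          ultimately show ?thesis using b True \<open>x \<in> Q\<close> unfolding \<psi>_def by simp
        next
          case False
          then show ?thesis using b unfolding \<psi>_def by (auto simp: indicator_def)
        qed
      qed
    qed (rule pint)
    then have "N / \<delta> * measure lebesgue S \<le> N * m" unfolding pI using IN Sf by (simp add: fmeasurable_def)
    then have "measure lebesgue S \<le> \<delta> * m" using N \<delta> by (simp add: field_simps)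
    then show ?thesis unfolding S_def m_def A_def y_def Q_def .
  qed
  moreover have "\<gamma> > 0" unfolding \<gamma>_def by simp
  ultimately show ?thesis by blast
qed

text \<open>On the tripled cube the set of small values is made so small that it fills at most half
  of the inner cube. On the remaining half \<open>w\<close> dominates a multiple of its average over
  the tripled cube, which yields both doubling and the level estimate.\<close>

lemma A_infty_doubling_and_level:
  fixes w :: "real^'n \<Rightarrow> ennreal"
  assumes w: "w \<in> A_infty"
  shows "\<exists>\<gamma>>0. \<forall>c h. h > 0 \<longrightarrow>
    (\<integral>\<^sup>+x\<in>cub c (3 * h). w x \<partial>lebesgue) \<le> ennreal (1 / \<gamma>) * (\<integral>\<^sup>+x\<in>cub c h. w x \<partial>lebesgue) \<and>
    emeasure lebesgue (cub c h)
      \<le> 2 * emeasure lebesgue {x\<in>cub c h. ennreal \<gamma> * avg (cub c h) w \<le> w x}"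
proof -
  have ww: "weight w" and loc: "locally_integrable w" using w unfolding A_infty_def by auto
  have wm [measurable]: "w \<in> borel_measurable lebesgue" using ww unfolding weight_def by auto
  define N :: real where "N = 3 ^ CARD('n)"
  have N: "N \<ge> 1" unfolding N_def by simp
  obtain g where g: "g > 0" and gs: "\<And>c :: real^'n. \<And>h. h > 0 \<Longrightarrow>
    measure lebesgue {x\<in>cub c h. enn2real (w x) < g * enn2real (avg (cub c h) w)}
      \<le> 1 / (2 * N) * measure lebesgue (cub c h)"
    using A_infty_small_values[OF w, of "1 / (2 * N)"] N by auto
  \<comment> \<open>The factor \<open>2\<close> pays for the lost half of the cube, and
    \<open>N\<close> is the volume ratio of the two cubes. This one constant serves both
    claims.\<close>
  define \<gamma> where "\<gamma> = g / (2 * N)"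
  have \<gamma>: "\<gamma> > 0" using g N unfolding \<gamma>_def by simp
  have "(\<integral>\<^sup>+x\<in>cub c (3 * h). w x \<partial>lebesgue) \<le> ennreal (1 / \<gamma>) * (\<integral>\<^sup>+x\<in>cub c h. w x \<partial>lebesgue) \<and>
    emeasure lebesgue (cub c h)
      \<le> 2 * emeasure lebesgue {x\<in>cub c h. ennreal \<gamma> * avg (cub c h) w \<le> w x}"
    if h: "h > 0" for c h
  proof -
    have h3: "3 * h > 0" using h by simp
    define Q where "Q = cub c h"
    define m where "m = measure lebesgue Q"
    define A where "A = enn2real (avg (cub c (3 * h)) w)"
    define a where "a = enn2real (avg Q w)"
    have m: "m > 0" using h unfolding m_def Q_def by simp
    have m3: "measure lebesgue (cub c (3 * h)) = N * m"
      unfolding m_def Q_def N_def using measure_cub_scale[of h 3 c] h by simp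
    have Qs [measurable]: "Q \<in> sets lebesgue" unfolding Q_def by simp
    have Qf: "Q \<in> lmeasurable" unfolding Q_def by simp
    have eA: "avg (cub c (3 * h)) w = ennreal A" using avg_finite[OF loc h3, of c] unfolding A_def by simp
    have ea: "avg Q w = ennreal a" using avg_finite[OF loc h, of c] unfolding a_def Q_def by simp
    have A0: "A > 0" using avg_pos[OF ww h3, of c] eA by (simp add: ennreal_less_zero_iff)
    have a0: "a > 0" using avg_pos[OF ww h, of c] ea unfolding Q_def by (simp add: ennreal_less_zero_iff)
    have W: "(\<integral>\<^sup>+x\<in>Q. w x \<partial>lebesgue) = ennreal (a * m)"
      unfolding Q_def nn_set_integral_eq_avg[OF h] using ea a0 m
      by (simp add: Q_def m_def emeasure_cub ennreal_mult)
    have W3: "(\<integral>\<^sup>+x\<in>cub c (3 * h). w x \<partial>lebesgue) = ennreal (A * (N * m))"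
      unfolding nn_set_integral_eq_avg[OF h3] using eA A0 m N
      by (simp add: emeasure_cub m3 ennreal_mult)
    have "a * m \<le> A * (N * m)"
    proof -
      have "ennreal (a * m) \<le> ennreal (A * (N * m))"
        unfolding W[symmetric] W3[symmetric] Q_def
        by (intro nn_integral_mono) (use cub_mono[of h "3 * h" c] h in \<open>auto simp: indicator_def\<close>)
      then show ?thesis using A0 m N by simp
    qed
    then have aA: "a \<le> A * N" using m by (simp add: mult.assoc[symmetric])
    define S where "S = {x\<in>Q. g * A \<le> enn2real (w x)}"
    define B where "B = {x\<in>cub c (3 * h). enn2real (w x) < g * A}"
    have Sm [measurable]: "S \<in> sets lebesgue" 
    proof -
      have "S = Q \<inter> {x\<in>space lebesgue. g * A \<le> enn2real (w x)}" unfolding S_def by auto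
      also have "\<dots> \<in> sets lebesgue" by measurable
      finally show ?thesis .
    qed
    have Bm: "B \<in> sets lebesgue" 
    proof -
      have "B = cub c (3 * h) \<inter> {x\<in>space lebesgue. enn2real (w x) < g * A}" unfolding B_def by auto
      also have "\<dots> \<in> sets lebesgue" by measurable
      finally show ?thesis .
    qed
    have Sf: "S \<in> lmeasurable"
      by (rule fmeasurableI2[OF Qf _ Sm]) (auto simp: S_def)
    have Bf: "B \<in> lmeasurable"
      by (rule fmeasurableI2[OF lmeasurable_cub _ Bm]) (auto simp: B_def)
    have "measure lebesgue B \<le> m / 2"
      using gs[OF h3, of c] N unfolding B_def A_def m3 by simp
    moreover have "m \<le> measure lebesgue (S \<union> B)"
      unfolding m_def by (rule measure_mono_fmeasurable)
        (use Sf Bf cub_mono[of h "3 * h" c] h in \<open>auto simp: S_def B_def Q_def\<close>)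
    moreover have "measure lebesgue (S \<union> B) \<le> measure lebesgue S + measure lebesgue B"
      using Sm Bm by (rule measure_Un_le)
    ultimately have Shalf: "m \<le> 2 * measure lebesgue S" by linarith
    have eS: "emeasure lebesgue S = ennreal (measure lebesgue S)"
      using Sf by (intro emeasure_eq_measure2) (simp add: fmeasurableD2)
    have Slow: "ennreal (g * A) \<le> w x" if "x \<in> S" for x
      using that g A0 enn2real_ennreal_le[of "g * A" "w x"] unfolding S_def by simp
    have "ennreal (g * A * measure lebesgue S) = (\<integral>\<^sup>+x. ennreal (g * A) * indicator S x \<partial>lebesgue)"
      using g A0 by (simp add: eS ennreal_mult nn_integral_cmult_indicator)
    also have "\<dots> \<le> (\<integral>\<^sup>+x\<in>Q. w x \<partial>lebesgue)"
      by (intro nn_integral_mono) (use Slow in \<open>auto simp: indicator_def S_def\<close>)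
    finally have "g * A * measure lebesgue S \<le> a * m" unfolding W using a0 m by simp
    moreover have "g * A * m \<le> g * A * (2 * measure lebesgue S)"
      using Shalf g A0 by (intro mult_left_mono) auto
    ultimately have "g * A * m \<le> 2 * (a * m)" by linarith
    then have "A * (N * m) \<le> 1 / \<gamma> * (a * m)"
      using g N unfolding \<gamma>_def by (simp add: field_simps)
    then have 1: "(\<integral>\<^sup>+x\<in>cub c (3 * h). w x \<partial>lebesgue) \<le> ennreal (1 / \<gamma>) * (\<integral>\<^sup>+x\<in>cub c h. w x \<partial>lebesgue)"
      unfolding W3 Q_def[symmetric] W using \<gamma> a0 m by (simp add: ennreal_mult[symmetric] ennreal_leI)
    have "\<gamma> * a \<le> g * A"
    proof -
      have "\<gamma> * a \<le> \<gamma> * (A * N)" using aA \<gamma> by simp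
      also have "\<dots> \<le> g * A" using g N A0 unfolding \<gamma>_def by (simp add: field_simps)
      finally show ?thesis .
    qed
    then have "S \<subseteq> {x\<in>Q. ennreal \<gamma> * avg Q w \<le> w x}"
      using Slow \<gamma> a0 unfolding ea S_def by (force simp: ennreal_mult[symmetric] intro: order_trans[OF ennreal_leI])
    moreover have "{x\<in>Q. ennreal \<gamma> * avg Q w \<le> w x} \<in> sets lebesgue"
    proof -
      have "{x\<in>Q. ennreal \<gamma> * avg Q w \<le> w x} = Q \<inter> {x\<in>space lebesgue. ennreal \<gamma> * avg Q w \<le> w x}" by auto
      also have "\<dots> \<in> sets lebesgue" by measurable
      finally show ?thesis .
    qed
    ultimately have "emeasure lebesgue S \<le> emeasure lebesgue {x\<in>Q. ennreal \<gamma> * avg Q w \<le> w x}"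
      by (rule emeasure_mono)
    moreover have "emeasure lebesgue Q \<le> 2 * emeasure lebesgue S"
    proof -
      have "emeasure lebesgue Q = ennreal m" unfolding m_def Q_def by (rule emeasure_cub)
      also have "\<dots> \<le> ennreal (2 * measure lebesgue S)" using Shalf by (rule ennreal_leI)
      also have "\<dots> = 2 * emeasure lebesgue S" unfolding eS by (simp add: ennreal_mult)
      finally show ?thesis .
    qed
    ultimately have "emeasure lebesgue Q \<le> 2 * emeasure lebesgue {x\<in>Q. ennreal \<gamma> * avg Q w \<le> w x}"
      by (meson mult_left_mono order_trans zero_le)
    with 1 show ?thesis unfolding Q_def by blast
  qed
  with \<gamma> show ?thesis by blast
qed

section \<open>Families of cubes with heights\<close>

text \<open>A labelled cube \<open>(k, c, h)\<close> is a cube with centre \<open>c\<close> and side \<open>2h\<close> carrying the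
  height \<open>2\<^sup>k\<close>.\<close>

type_synonym 'n lcube = "int \<times> (real^'n) \<times> real"

definition height :: "('n::finite) lcube \<Rightarrow> real" where
  "height d = 2 powr real_of_int (fst d)"

definition rad :: "('n::finite) lcube \<Rightarrow> real" where
  "rad d = snd (snd d)"

definition dil :: "real \<Rightarrow> ('n::finite) lcube \<Rightarrow> (real^'n) set" where
  "dil a d = cub (fst (snd d)) (a * rad d)"

abbreviation "body \<equiv> dil 1"
abbreviation "vol d \<equiv> measure lebesgue (body d)"

definition layered :: "('n::finite) lcube set \<Rightarrow> bool" where
  "layered F \<longleftrightarrow> pairwise (\<lambda>d e. fst d = fst e \<longrightarrow> body d \<inter> body e = {}) F"

lemma height_pos [simp]: "height d > 0" unfolding height_def by simp

lemma height_nonneg [simp]: "height d \<ge> 0" using height_pos[of d] by linarith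

lemma body_eq: "body d = cub (fst (snd d)) (rad d)" unfolding dil_def by simp

lemma dil_sets [simp, measurable, intro]: "dil a d \<in> sets lebesgue" unfolding dil_def by simp

lemma emeasure_body: "emeasure lebesgue (body d) = ennreal (vol d)"
  unfolding body_eq by (rule emeasure_cub)

lemma dil_subset:
  assumes "body d \<inter> body e \<noteq> {}" "rad d \<le> rad e"
  shows "body d \<subseteq> dil 3 e" and "dil 2 d \<subseteq> dil 4 e"
  using cub_meet_subset[of "fst (snd d)" "rad d" "fst (snd e)" "rad e"] assms
  unfolding dil_def by simp_all

lemma body_nonempty: "rad d > 0 \<Longrightarrow> body d \<noteq> {}"
  unfolding body_eq using mem_cub[of "fst (snd d)" "fst (snd d)" "rad d"] by force

lemma nn_integral_UN_le_sum:
  assumes "finite F" and g: "g \<in> borel_measurable lebesgue" and A: "\<And>d. d \<in> F \<Longrightarrow> A d \<in> sets lebesgue"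
    and B: "B \<subseteq> (\<Union>d\<in>F. A d)"
  shows "(\<integral>\<^sup>+x\<in>B. g x \<partial>lebesgue) \<le> (\<Sum>d\<in>F. \<integral>\<^sup>+x\<in>A d. g x \<partial>lebesgue)"
proof -
  have "(\<integral>\<^sup>+x\<in>B. g x \<partial>lebesgue) \<le> (\<integral>\<^sup>+x. (\<Sum>d\<in>F. g x * indicator (A d) x) \<partial>lebesgue)"
  proof (rule nn_integral_mono)
    fix x
    show "g x * indicator B x \<le> (\<Sum>d\<in>F. g x * indicator (A d) x)"
    proof (cases "x \<in> B")
      case True
      then obtain d where d: "d \<in> F" "x \<in> A d" using B by auto
      have "g x * indicator (A d) x \<le> (\<Sum>d\<in>F. g x * indicator (A d) x)"
        using d(1) assms(1) by (intro member_le_sum) auto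
      then show ?thesis using True d by simp
    qed simp
  qed
  also have "\<dots> = (\<Sum>d\<in>F. \<integral>\<^sup>+x\<in>A d. g x \<partial>lebesgue)"
    using g A by (intro nn_integral_sum) auto
  finally show ?thesis .
qed

text \<open>At a given point at most one cube of each height contributes, so \<open>fst\<close> is
  injective on the cubes containing \<open>x\<close> and the sum runs over heights instead of
  cubes.\<close>

lemma layered_sum_indicator_le:
  fixes F :: "('n::finite) lcube set" and f :: "int \<Rightarrow> ennreal"
  assumes "finite F" "layered F"
  shows "(\<Sum>d\<in>F. f (fst d) * indicator (body d) x)
    \<le> (\<Sum>k\<in>fst ` F. f k) * indicator (\<Union>d\<in>F. body d) x"
proof (cases "x \<in> (\<Union>d\<in>F. body d)")
  case True
  let ?F = "{d\<in>F. x \<in> body d}"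
  have inj: "inj_on fst ?F"
  proof (rule inj_onI)
    fix d e assume "d \<in> ?F" "e \<in> ?F" "fst d = fst e"
    then show "d = e" using assms(2) unfolding layered_def pairwise_def by blast
  qed
  have "(\<Sum>d\<in>F. f (fst d) * indicator (body d) x) = (\<Sum>d\<in>?F. f (fst d))"
    using assms(1) by (intro sum.mono_neutral_cong_right) (auto simp: indicator_def)
  also have "\<dots> = (\<Sum>k\<in>fst ` ?F. f k)" by (rule sum.reindex[OF inj, unfolded comp_def, symmetric])
  also have "\<dots> \<le> (\<Sum>k\<in>fst ` F. f k)" using assms(1) by (intro sum_mono2) auto
  finally show ?thesis using True by simp
next
  case False
  then show ?thesis by (auto intro!: sum.neutral simp: indicator_def)
qed

lemma Vitali_bodies:
  fixes F :: "('n::finite) lcube set"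
  assumes "finite F" and "\<And>d. d \<in> F \<Longrightarrow> rad d > 0"
  shows "\<exists>J\<subseteq>F. pairwise (\<lambda>d e. body d \<inter> body e = {}) J \<and> (\<Union>d\<in>F. body d) \<subseteq> (\<Union>d\<in>J. dil 3 d)"
proof -
  have "\<exists>J\<subseteq>F. pairwise (\<lambda>d e. \<not> body d \<inter> body e \<noteq> {}) J \<and>
      (\<forall>d\<in>F. \<exists>e\<in>J. body d \<inter> body e \<noteq> {} \<and> rad d \<le> rad e)"
  proof (rule finite_Vitali[OF assms(1)])
    show "body e \<inter> body d \<noteq> {}" if "body d \<inter> body e \<noteq> {}" for d e :: "'n lcube" using that by blast
    show "body d \<inter> body d \<noteq> {}" if "d \<in> F" for d using body_nonempty assms(2)[OF that] by simp
  qed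
  then obtain J where J: "J \<subseteq> F" "pairwise (\<lambda>d e. \<not> body d \<inter> body e \<noteq> {}) J"
      "\<forall>d\<in>F. \<exists>e\<in>J. body d \<inter> body e \<noteq> {} \<and> rad d \<le> rad e"
    by auto
  have "(\<Union>d\<in>F. body d) \<subseteq> (\<Union>d\<in>J. dil 3 d)"
    using J(3) dil_subset(1) by blast
  with J show ?thesis by auto
qed

text \<open>On each cube of the family at least half of the points satisfy \<open>w \<ge> \<gamma>\<tau>2\<^sup>k/2\<close>, so that
  \<open>\<tau>\<Sum> 2\<^sup>k|Q|\<close> is bounded by the integral of a geometric sum dominated by \<open>w\<close> on the union of
  the cubes, whatever the overlaps between different heights are.\<close>

lemma layered_disjoint_selection:
  fixes w :: "real^'n \<Rightarrow> ennreal"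
  assumes w: "w \<in> A_infty"
  shows "\<exists>C>0. \<forall>F \<tau>. finite F \<longrightarrow> \<tau> > 0 \<longrightarrow> layered F \<longrightarrow>
    (\<forall>d\<in>F. rad d > 0 \<and> ennreal (\<tau> * height d / 2) \<le> avg (body d) w
            \<and> avg (body d) w \<le> ennreal (\<tau> * height d)) \<longrightarrow>
    (\<exists>J\<subseteq>F. pairwise (\<lambda>d e. body d \<inter> body e = {}) J \<and>
       (\<Sum>d\<in>F. height d * vol d) \<le> C * (\<Sum>d\<in>J. height d * vol d))"
proof -
  have wm [measurable]: "w \<in> borel_measurable lebesgue" using w unfolding A_infty_def weight_def by auto
  obtain \<gamma> where \<gamma>: "\<gamma> > 0"
    and dbl: "\<And>c h. h > 0 \<Longrightarrow> (\<integral>\<^sup>+x\<in>cub c (3 * h). w x \<partial>lebesgue)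
        \<le> ennreal (1 / \<gamma>) * (\<integral>\<^sup>+x\<in>cub c h. w x \<partial>lebesgue)"
    and lev: "\<And>c h. h > 0 \<Longrightarrow> emeasure lebesgue (cub c h)
      \<le> 2 * emeasure lebesgue {x\<in>cub c h. ennreal \<gamma> * avg (cub c h) w \<le> w x}"
    using A_infty_doubling_and_level[OF w] by auto
  have "\<exists>J\<subseteq>F. pairwise (\<lambda>d e. body d \<inter> body e = {}) J \<and>
       (\<Sum>d\<in>F. height d * vol d) \<le> 8 / \<gamma>\<^sup>2 * (\<Sum>d\<in>J. height d * vol d)"
    if fin: "finite F" and \<tau>: "\<tau> > 0" and lay: "layered F"
      and F: "\<And>d. d \<in> F \<Longrightarrow> rad d > 0" "\<And>d. d \<in> F \<Longrightarrow> ennreal (\<tau> * height d / 2) \<le> avg (body d) w"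
        "\<And>d. d \<in> F \<Longrightarrow> avg (body d) w \<le> ennreal (\<tau> * height d)"
    for F :: "'n lcube set" and \<tau>
  proof -
    define U where "U = (\<Union>d\<in>F. body d)"
    have U [measurable]: "U \<in> sets lebesgue" unfolding U_def using fin by auto
    \<comment> \<open>With this \<open>b\<close>, the inequality
      \<open>\<gamma> * \<tau> * height d / 2 \<le> w x\<close> reads
      \<open>height d \<le> b * w x\<close>.\<close>
    define b where "b = 2 / (\<gamma> * \<tau>)"
    have b: "b > 0" using \<gamma> \<tau> unfolding b_def by simp
    \<comment> \<open>The trivial exponent \<open>powr 1\<close> puts the term into the form of
      \<open>ennreal_geometric_sum_below\<close>.\<close>
    define g where "g k x = ennreal ((2 powr real_of_int k) powr 1) *
      indicator {k. ennreal (2 powr real_of_int k) \<le> ennreal b * w x} k" for k x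
    have gm [measurable]: "g k \<in> borel_measurable lebesgue" for k
    proof -
      have "g k = (\<lambda>x. ennreal ((2 powr real_of_int k) powr 1) *
          indicator {x\<in>space lebesgue. ennreal (2 powr real_of_int k) \<le> ennreal b * w x} x)"
        unfolding g_def by (auto simp: indicator_def)
      also have "\<dots> \<in> borel_measurable lebesgue" by measurable
      finally show ?thesis .
    qed
    \<comment> \<open>The set \<open>S\<close> carries at least half of the volume of the cube,
      hence the factor \<open>2\<close>.\<close>
    have piece: "ennreal (height d * vol d) \<le> 2 * (\<integral>\<^sup>+x. g (fst d) x * indicator (body d) x \<partial>lebesgue)"
      if d: "d \<in> F" for d
    proof -
      define S where "S = {x\<in>body d. ennreal \<gamma> * avg (body d) w \<le> w x}"
      have Sm: "S \<in> sets lebesgue"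
      proof -
        have "S = body d \<inter> {x\<in>space lebesgue. ennreal \<gamma> * avg (body d) w \<le> w x}" unfolding S_def by auto
        also have "\<dots> \<in> sets lebesgue" by measurable
        finally show ?thesis .
      qed
      have "ennreal (height d) \<le> ennreal b * w x" if "x \<in> S" for x
      proof -
        have "ennreal (\<gamma> * (\<tau> * height d / 2)) \<le> ennreal \<gamma> * avg (body d) w"
          using mult_left_mono[OF F(2)[OF d], of "ennreal \<gamma>"] \<gamma> \<tau> by (simp add: ennreal_mult'[symmetric])
        also have "\<dots> \<le> w x" using that unfolding S_def by simp
        finally have "ennreal b * ennreal (\<gamma> * (\<tau> * height d / 2)) \<le> ennreal b * w x"
          by (rule mult_left_mono) simp
        moreover have "ennreal b * ennreal (\<gamma> * (\<tau> * height d / 2)) = ennreal (b * (\<gamma> * (\<tau> * height d / 2)))"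
          using b by (simp only: ennreal_mult'[OF less_imp_le])
        moreover have "b * (\<gamma> * (\<tau> * height d / 2)) = height d" using \<gamma> \<tau> unfolding b_def by simp
        ultimately show ?thesis by metis
      qed
      then have "ennreal (height d) * indicator S x \<le> g (fst d) x * indicator (body d) x" for x
        unfolding g_def height_def S_def by (auto simp: indicator_def)
      then have "(\<integral>\<^sup>+x. ennreal (height d) * indicator S x \<partial>lebesgue)
          \<le> (\<integral>\<^sup>+x. g (fst d) x * indicator (body d) x \<partial>lebesgue)"
        by (intro nn_integral_mono)
      then have 1: "ennreal (height d) * emeasure lebesgue S \<le> (\<integral>\<^sup>+x. g (fst d) x * indicator (body d) x \<partial>lebesgue)"
        using Sm by (simp add: nn_integral_cmult_indicator)
      have "ennreal (height d * vol d) = ennreal (height d) * emeasure lebesgue (body d)"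
        unfolding emeasure_body by (simp add: ennreal_mult)
      also have "\<dots> \<le> ennreal (height d) * (2 * emeasure lebesgue S)"
        using lev[OF F(1)[OF d], of "fst (snd d)"] unfolding S_def body_eq by (intro mult_left_mono) auto
      also have "\<dots> = 2 * (ennreal (height d) * emeasure lebesgue S)" by (simp add: ac_simps)
      also have "\<dots> \<le> 2 * (\<integral>\<^sup>+x. g (fst d) x * indicator (body d) x \<partial>lebesgue)"
        using 1 by (intro mult_left_mono) auto
      finally show ?thesis .
    qed
    have geo: "(\<Sum>k\<in>fst ` F. g k x) \<le> ennreal (2 * b) * w x" for x
    proof -
      have "(\<Sum>k\<in>fst ` F. g k x) \<le> ennreal (1 / (1 - 2 powr (- 1))) * epow (ennreal b * w x) 1"
        unfolding g_def by (rule ennreal_geometric_sum_below) (use fin in auto)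
      also have "epow (ennreal b * w x) 1 = ennreal b * w x"
        unfolding epow_def ext_top_def by (cases "ennreal b * w x") auto
      also have "1 / (1 - 2 powr (- 1)) = (2::real)" by (simp add: powr_minus)
      finally show ?thesis using b by (simp add: ennreal_mult mult.assoc)
    qed
    have "ennreal (\<Sum>d\<in>F. height d * vol d) = (\<Sum>d\<in>F. ennreal (height d * vol d))"
      by (simp add: sum_ennreal)
    also have "\<dots> \<le> (\<Sum>d\<in>F. 2 * (\<integral>\<^sup>+x. g (fst d) x * indicator (body d) x \<partial>lebesgue))"
      by (rule sum_mono[OF piece])
    also have "\<dots> = 2 * (\<integral>\<^sup>+x. (\<Sum>d\<in>F. g (fst d) x * indicator (body d) x) \<partial>lebesgue)"
      unfolding sum_distrib_left[symmetric] by (subst nn_integral_sum) auto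
    also have "\<dots> \<le> 2 * (\<integral>\<^sup>+x. ennreal (2 * b) * (w x * indicator U x) \<partial>lebesgue)"
    proof (intro mult_left_mono nn_integral_mono)
      fix x
      have "(\<Sum>d\<in>F. g (fst d) x * indicator (body d) x) \<le> (\<Sum>k\<in>fst ` F. g k x) * indicator U x"
        unfolding U_def by (rule layered_sum_indicator_le[OF fin lay])
      also have "\<dots> \<le> ennreal (2 * b) * w x * indicator U x"
        using geo by (intro mult_right_mono) auto
      finally show "(\<Sum>d\<in>F. g (fst d) x * indicator (body d) x) \<le> ennreal (2 * b) * (w x * indicator U x)"
        by (simp add: mult.assoc)
    qed simp
    also have "\<dots> = ennreal (4 * b) * (\<integral>\<^sup>+x\<in>U. w x \<partial>lebesgue)"
    proof -
      have "ennreal (4 * b) = 2 * ennreal (2 * b)" using b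
        by (metis ennreal_mult' ennreal_numeral mult_numeral_left num_double numeral_times_numeral semiring_norm(13) zero_le_numeral mult.assoc less_imp_le)
      then show ?thesis by (simp add: nn_integral_cmult mult.assoc)
    qed
    finally have 1: "ennreal (\<Sum>d\<in>F. height d * vol d) \<le> ennreal (4 * b) * (\<integral>\<^sup>+x\<in>U. w x \<partial>lebesgue)" .
    \<comment> \<open>Covering among the cubes of all heights at once: doubling removes the
      dilation, and the upper bound on the averages turns integrals of \<open>w\<close> back into
      heights.\<close>
    obtain J where J: "J \<subseteq> F" "pairwise (\<lambda>d e. body d \<inter> body e = {}) J" "U \<subseteq> (\<Union>d\<in>J. dil 3 d)"
      using Vitali_bodies[OF fin F(1)] unfolding U_def by auto
    have Jfin: "finite J" using J fin finite_subset by auto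
    have "(\<integral>\<^sup>+x\<in>U. w x \<partial>lebesgue) \<le> (\<Sum>d\<in>J. \<integral>\<^sup>+x\<in>dil 3 d. w x \<partial>lebesgue)"
      by (rule nn_integral_UN_le_sum[OF Jfin wm _ J(3)]) auto
    also have "\<dots> \<le> (\<Sum>d\<in>J. ennreal (1 / \<gamma> * (\<tau> * (height d * vol d))))"
    proof (rule sum_mono)
      fix d assume "d \<in> J"
      then have d: "d \<in> F" using J by auto
      have "(\<integral>\<^sup>+x\<in>dil 3 d. w x \<partial>lebesgue) \<le> ennreal (1 / \<gamma>) * (\<integral>\<^sup>+x\<in>body d. w x \<partial>lebesgue)"
        using dbl[OF F(1)[OF d], of "fst (snd d)"] unfolding dil_def by simp
      also have "(\<integral>\<^sup>+x\<in>body d. w x \<partial>lebesgue) = avg (body d) w * ennreal (vol d)"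
        using nn_set_integral_eq_avg[OF F(1)[OF d]] by (simp add: body_eq emeasure_cub)
      also have "\<dots> \<le> ennreal (\<tau> * height d) * ennreal (vol d)"
        using F(3)[OF d] by (intro mult_right_mono) auto
      also have "ennreal (1 / \<gamma>) * (ennreal (\<tau> * height d) * ennreal (vol d)) = ennreal (1 / \<gamma> * (\<tau> * (height d * vol d)))"
        using \<gamma> \<tau> by (simp add: ennreal_mult''[symmetric] mult_ac)
      finally show "(\<integral>\<^sup>+x\<in>dil 3 d. w x \<partial>lebesgue) \<le> ennreal (1 / \<gamma> * (\<tau> * (height d * vol d)))"
        by (simp add: mult_left_mono)
    qed
    also have "\<dots> = ennreal (\<tau> / \<gamma> * (\<Sum>d\<in>J. height d * vol d))"
      using \<gamma> \<tau> by (subst sum_ennreal) (auto simp: sum_distrib_left)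
    finally have 2: "(\<integral>\<^sup>+x\<in>U. w x \<partial>lebesgue) \<le> ennreal (\<tau> / \<gamma> * (\<Sum>d\<in>J. height d * vol d))" .
    \<comment> \<open>The factor \<open>\<tau>\<close> cancels against the one in \<open>b\<close>,
      so the constant is uniform in \<open>\<tau>\<close>.\<close>
    have "ennreal (\<Sum>d\<in>F. height d * vol d) \<le> ennreal (4 * b) * ennreal (\<tau> / \<gamma> * (\<Sum>d\<in>J. height d * vol d))"
      using 1 mult_left_mono[OF 2, of "ennreal (4 * b)"] by (meson order_trans zero_le)
    also have "\<dots> = ennreal (8 / \<gamma>\<^sup>2 * (\<Sum>d\<in>J. height d * vol d))"
      using \<gamma> \<tau> unfolding b_def
      by (subst ennreal_mult'[symmetric]) (auto simp: power2_eq_square field_simps)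
    finally have "(\<Sum>d\<in>F. height d * vol d) \<le> 8 / \<gamma>\<^sup>2 * (\<Sum>d\<in>J. height d * vol d)"
      by (subst (asm) ennreal_le_iff) (auto intro!: divide_nonneg_nonneg mult_nonneg_nonneg sum_nonneg)
    with J show ?thesis by blast
  qed
  moreover have "8 / \<gamma>\<^sup>2 > 0" using \<gamma> by simp
  ultimately show ?thesis by (intro exI[of _ "8 / \<gamma>\<^sup>2"]) blast
qed

text \<open>On \<open>cub c h\<close> the function \<open>u\<close> is bounded below almost
  everywhere by a multiple of its average over the fourfold cube; integrating this bound gives
  doubling. A single enlarged constant covers both claims.\<close>

lemma A_1_doubling:
  fixes u :: "real^'n \<Rightarrow> ennreal"
  assumes u: "u \<in> A_1"
  shows "\<exists>C>0. \<forall>c h. h > 0 \<longrightarrow>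
    (AE x in lebesgue. x \<in> cub c h \<longrightarrow> avg (cub c h) u \<le> ennreal C * u x) \<and>
    (\<integral>\<^sup>+x\<in>cub c (4 * h). u x \<partial>lebesgue) \<le> ennreal C * (\<integral>\<^sup>+x\<in>cub c h. u x \<partial>lebesgue)"
proof -
  have um [measurable]: "u \<in> borel_measurable lebesgue" using u unfolding A_1_def weight_def by auto
  from u obtain C :: real where C: "C > 0"
    and A: "\<And>Q. cube Q \<Longrightarrow> AE x in lebesgue. x \<in> Q \<longrightarrow> avg Q u \<le> ennreal C * u x"
    unfolding A_1_def by auto
  define N :: real where "N = 4 ^ CARD('n)"
  have N: "N \<ge> 1" unfolding N_def by simp
  have "(AE x in lebesgue. x \<in> cub c h \<longrightarrow> avg (cub c h) u \<le> ennreal (N * C) * u x) \<and>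
    (\<integral>\<^sup>+x\<in>cub c (4 * h). u x \<partial>lebesgue) \<le> ennreal (N * C) * (\<integral>\<^sup>+x\<in>cub c h. u x \<partial>lebesgue)"
    if h: "h > 0" for c h
  proof
    have 0: "ennreal C * u x \<le> ennreal (N * C) * u x" for x
      using N C by (intro mult_right_mono ennreal_leI) auto
    then show "AE x in lebesgue. x \<in> cub c h \<longrightarrow> avg (cub c h) u \<le> ennreal (N * C) * u x"
      using A[OF cube_cub[OF h, of c]] by eventually_elim (auto intro: order_trans[OF _ 0])
    have h4: "4 * h > 0" using h by simp
    let ?m = "emeasure lebesgue (cub c h)"
    have m4: "emeasure lebesgue (cub c (4 * h)) = ennreal N * ?m"
      unfolding emeasure_cub N_def using measure_cub_scale[of h 4 c] h by (simp add: ennreal_mult)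
    have "avg (cub c (4 * h)) u * ?m = (\<integral>\<^sup>+x. avg (cub c (4 * h)) u * indicator (cub c h) x \<partial>lebesgue)"
      by (simp add: nn_integral_cmult_indicator)
    also have "\<dots> \<le> (\<integral>\<^sup>+x. ennreal C * (u x * indicator (cub c h) x) \<partial>lebesgue)"
    proof (rule nn_integral_mono_AE)
      show "AE x in lebesgue. avg (cub c (4 * h)) u * indicator (cub c h) x \<le> ennreal C * (u x * indicator (cub c h) x)"
        using A[OF cube_cub[OF h4, of c]]
      proof eventually_elim
        case (elim x)
        then show ?case using cub_mono[of h "4 * h" c] h by (auto simp: indicator_def)
      qed
    qed
    also have "\<dots> = ennreal C * (\<integral>\<^sup>+x\<in>cub c h. u x \<partial>lebesgue)" by (simp add: nn_integral_cmult)
    finally have 1: "avg (cub c (4 * h)) u * ?m \<le> ennreal C * (\<integral>\<^sup>+x\<in>cub c h. u x \<partial>lebesgue)" .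
    have "(\<integral>\<^sup>+x\<in>cub c (4 * h). u x \<partial>lebesgue) = ennreal N * (avg (cub c (4 * h)) u * ?m)"
      unfolding nn_set_integral_eq_avg[OF h4] m4 by (simp add: mult_ac)
    also have "\<dots> \<le> ennreal N * (ennreal C * (\<integral>\<^sup>+x\<in>cub c h. u x \<partial>lebesgue))"
      by (rule mult_left_mono[OF 1]) simp
    also have "\<dots> = ennreal (N * C) * (\<integral>\<^sup>+x\<in>cub c h. u x \<partial>lebesgue)"
      using N C by (simp add: ennreal_mult mult.assoc)
    finally show "(\<integral>\<^sup>+x\<in>cub c (4 * h). u x \<partial>lebesgue) \<le> ennreal (N * C) * (\<integral>\<^sup>+x\<in>cub c h. u x \<partial>lebesgue)" .
  qed
  moreover have "N * C > 0" using N C by simp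
  ultimately show ?thesis by blast
qed

text \<open>Each term is \<open>x j\<close> times \<open>x j powr (\<kappa> - 1)\<close>, and
  replacing \<open>x j\<close> by the total in the second factor only increases it.\<close>

lemma sum_powr_le_powr_sum:
  fixes x :: "'a \<Rightarrow> real"
  assumes "finite J" "\<kappa> \<ge> 1" "\<And>j. j \<in> J \<Longrightarrow> x j \<ge> 0"
  shows "(\<Sum>j\<in>J. x j powr \<kappa>) \<le> (\<Sum>j\<in>J. x j) powr \<kappa>"
proof -
  define S where "S = (\<Sum>j\<in>J. x j)"
  have S: "S \<ge> 0" unfolding S_def using assms by (intro sum_nonneg) auto
  have "x j powr \<kappa> \<le> x j * S powr (\<kappa> - 1)" if "j \<in> J" for j
  proof -
    have "x j powr \<kappa> = x j * x j powr (\<kappa> - 1)"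
      using assms(3)[OF that] by (cases "x j = 0") (auto simp: powr_mult_base)
    also have "\<dots> \<le> x j * S powr (\<kappa> - 1)"
      using assms that member_le_sum[of j J x] unfolding S_def by (intro mult_left_mono powr_mono2) auto
    finally show ?thesis .
  qed
  then have "(\<Sum>j\<in>J. x j powr \<kappa>) \<le> S * S powr (\<kappa> - 1)"
    unfolding S_def sum_distrib_right by (rule sum_mono)
  also have "\<dots> = S powr \<kappa>" using S by (cases "S = 0") (auto simp: powr_mult_base)
  finally show ?thesis unfolding S_def .
qed

section \<open>Extended powers and sums over superlevel sets\<close>

lemma epow_mono:
  assumes "a \<ge> 0" "y \<le> z"
  shows "epow y a \<le> epow z a"
proof (cases z)
  case (real r)
  with assms(2) obtain s where "y = ennreal s" "s \<ge> 0" "s \<le> r" by (cases y) (auto simp: top_unique)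
  then show ?thesis using real assms(1) by (auto simp: epow_def ext_top_def intro!: ennreal_leI powr_mono2)
qed (simp add: epow_def ext_top_def)

lemma epow_ennreal: "z \<ge> 0 \<Longrightarrow> epow (ennreal z) a = ennreal (z powr a)"
  by (simp add: epow_def ext_top_def)

lemma epow_top [simp]: "epow top a = top" by (simp add: epow_def ext_top_def)

lemma epow_measurable [measurable (raw)]:
  assumes [measurable]: "f \<in> borel_measurable M"
  shows "(\<lambda>x. epow (f x) a) \<in> borel_measurable M"
proof -
  have "(\<lambda>x. epow (f x) a) = (\<lambda>x. if f x = top then top else ennreal (enn2real (f x) powr a))"
    unfolding epow_def ext_top_def by auto
  also have "\<dots> \<in> borel_measurable M"
    by measurable
  finally show ?thesis .
qed

text \<open>A discrete form of Minkowski's inequality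
  \<open>\<parallel>\<integral> g 1\<^bsub>{y > s}\<^esub>\<parallel>\<^bsub>L\<^sup>\<kappa>(ds)\<^esub> \<le> \<integral> g y\<^bsup>1/\<kappa>\<^esup>\<close>.\<close>

lemma superlevel_powr_sum:
  fixes g y :: "'a \<Rightarrow> ennreal" and I :: "int set"
  assumes g [measurable]: "g \<in> borel_measurable M" and y [measurable]: "y \<in> borel_measurable M"
    and \<kappa>: "\<kappa> > 1" and H: "H \<ge> 0" "(\<integral>\<^sup>+x. g x * epow (y x) (1 / \<kappa>) \<partial>M) \<le> ennreal H"
    and I: "finite I"
  defines "G \<equiv> \<lambda>i::int. \<integral>\<^sup>+x. g x * indicator {x. ennreal (2 powr i) \<le> y x} x \<partial>M"
  shows "\<And>i. G i < \<infinity>"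
    and "(\<Sum>i\<in>I. 2 powr i * enn2real (G i) powr \<kappa>) \<le> 1 / (1 - 2 powr (- (1 / \<kappa>))) * H powr \<kappa>"
proof -
  define \<theta> where "\<theta> = 1 / \<kappa>"
  have \<theta>: "\<theta> > 0" using \<kappa> unfolding \<theta>_def by simp
  define K where "K = 1 / (1 - 2 powr (- \<theta>) :: real)"
  have K: "K > 0" using \<theta> unfolding K_def by (simp add: powr_less_one)
  have meas [measurable]: "(\<lambda>x. indicator {x. ennreal (2 powr real_of_int i) \<le> y x} x :: ennreal) \<in> borel_measurable M" for i :: int
    unfolding indicator_def by simp
  have pt: "ennreal ((2 powr real_of_int i) powr \<theta>) * indicator {x. ennreal (2 powr i) \<le> y x} x \<le> epow (y x) \<theta>" for x and i :: int
    using epow_mono[of \<theta> "ennreal (2 powr i)" "y x"] \<theta> by (auto simp: indicator_def epow_ennreal)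
  have a_int: "ennreal ((2 powr real_of_int i) powr \<theta>) * G i
      = (\<integral>\<^sup>+x. g x * (ennreal ((2 powr real_of_int i) powr \<theta>) * indicator {x. ennreal (2 powr i) \<le> y x} x) \<partial>M)" for i
    unfolding G_def by (subst nn_integral_cmult[symmetric]) (auto simp: mult_ac)
  have "ennreal ((2 powr real_of_int i) powr \<theta>) * G i \<le> ennreal H" for i
  proof -
    have "ennreal ((2 powr real_of_int i) powr \<theta>) * G i \<le> (\<integral>\<^sup>+x. g x * epow (y x) (1 / \<kappa>) \<partial>M)"
      unfolding a_int by (intro nn_integral_mono mult_left_mono pt[unfolded \<theta>_def, folded \<theta>_def]) (use pt \<theta>_def in auto)
    then show ?thesis using H(2) by simp
  qed
  note aH = this
  have fin: "G i < \<infinity>" for i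
  proof (rule ccontr)
    assume "\<not> G i < \<infinity>"
    then have "G i = top" by (simp add: less_top[symmetric])
    then show False using aH[of i] by (simp add: ennreal_mult_top top_unique)
  qed
  show "G i < \<infinity>" for i by (rule fin)
  define \<gamma> where "\<gamma> i = enn2real (G i)" for i
  have G: "G i = ennreal (\<gamma> i)" for i using fin[of i] unfolding \<gamma>_def by simp
  have \<gamma>0: "\<gamma> i \<ge> 0" for i unfolding \<gamma>_def by simp
  \<comment> \<open>Since \<open>\<theta> = 1 / \<kappa>\<close>, the summand
    \<open>2 powr i * \<gamma> i powr \<kappa>\<close> equals \<open>a i powr \<kappa>\<close>. As
    no \<open>a i\<close> exceeds \<open>H\<close>, it suffices to bound the sum of the
    \<open>a i\<close> themselves.\<close>
  define a where "a i = (2 powr real_of_int i) powr \<theta> * \<gamma> i" for i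
  have a0: "a i \<ge> 0" for i unfolding a_def using \<gamma>0 by simp
  have aG: "ennreal (a i) = ennreal ((2 powr real_of_int i) powr \<theta>) * G i" for i
    unfolding a_def G using \<gamma>0 by (simp add: ennreal_mult)
  have a_le: "a i \<le> H" for i using aH[of i] H(1) unfolding aG[symmetric] by simp
  have "ennreal (\<Sum>i\<in>I. a i) = (\<Sum>i\<in>I. ennreal (a i))" using a0 by (simp add: sum_ennreal)
  also have "\<dots> = (\<integral>\<^sup>+x. (\<Sum>i\<in>I. g x * (ennreal ((2 powr real_of_int i) powr \<theta>) * indicator {x. ennreal (2 powr i) \<le> y x} x)) \<partial>M)"
    unfolding aG a_int by (subst nn_integral_sum) auto
  also have "\<dots> \<le> (\<integral>\<^sup>+x. ennreal K * (g x * epow (y x) (1 / \<kappa>)) \<partial>M)"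
  proof (rule nn_integral_mono)
    fix x
    have "(\<Sum>i\<in>I. ennreal ((2 powr real_of_int i) powr \<theta>) * indicator {i. ennreal (2 powr real_of_int i) \<le> y x} i)
        \<le> ennreal K * epow (y x) \<theta>"
      unfolding K_def by (rule ennreal_geometric_sum_below[OF I \<theta>])
    then have "g x * (\<Sum>i\<in>I. ennreal ((2 powr real_of_int i) powr \<theta>) * indicator {x. ennreal (2 powr i) \<le> y x} x)
        \<le> g x * (ennreal K * epow (y x) \<theta>)"
      by (intro mult_left_mono) (simp_all add: indicator_def)
    then show "(\<Sum>i\<in>I. g x * (ennreal ((2 powr real_of_int i) powr \<theta>) * indicator {x. ennreal (2 powr i) \<le> y x} x))
        \<le> ennreal K * (g x * epow (y x) (1 / \<kappa>))"
      unfolding \<theta>_def by (simp add: sum_distrib_left mult_ac)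
  qed
  also have "\<dots> = ennreal K * (\<integral>\<^sup>+x. g x * epow (y x) (1 / \<kappa>) \<partial>M)"
    by (rule nn_integral_cmult) measurable
  also have "\<dots> \<le> ennreal K * ennreal H" by (rule mult_left_mono[OF H(2)]) simp
  also have "\<dots> = ennreal (K * H)" using K H by (simp add: ennreal_mult)
  finally have sa: "(\<Sum>i\<in>I. a i) \<le> K * H" using K H by simp
  have "2 powr i * \<gamma> i powr \<kappa> \<le> a i * H powr (\<kappa> - 1)" for i :: int
  proof -
    have "2 powr i * \<gamma> i powr \<kappa> = a i powr \<kappa>"
      unfolding a_def using \<gamma>0 \<kappa> by (simp add: powr_mult powr_powr \<theta>_def)
    also have "\<dots> = a i * a i powr (\<kappa> - 1)" using a0[of i] by (cases "a i = 0") (auto simp: powr_mult_base)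
    also have "\<dots> \<le> a i * H powr (\<kappa> - 1)"
      using a0 a_le \<kappa> by (intro mult_left_mono powr_mono2) auto
    finally show ?thesis .
  qed
  then have "(\<Sum>i\<in>I. 2 powr i * \<gamma> i powr \<kappa>) \<le> (\<Sum>i\<in>I. a i) * H powr (\<kappa> - 1)"
    unfolding sum_distrib_right by (rule sum_mono)
  also have "\<dots> \<le> K * H * H powr (\<kappa> - 1)" using sa by (intro mult_right_mono) auto
  also have "\<dots> = K * H powr \<kappa>" using H(1) by (cases "H = 0") (auto simp: powr_mult_base mult.assoc)
  finally show "(\<Sum>i\<in>I. 2 powr i * enn2real (G i) powr \<kappa>) \<le> 1 / (1 - 2 powr (- (1 / \<kappa>))) * H powr \<kappa>"
    unfolding \<gamma>_def K_def \<theta>_def .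
qed

section \<open>Dyadic grouping of cubes and the bounds for whole families\<close>

lemma dyadic_bracket:
  fixes z :: real
  assumes "z > 0"
  shows "2 powr real_of_int \<lceil>log 2 z\<rceil> / 2 \<le> z" "z \<le> 2 powr real_of_int \<lceil>log 2 z\<rceil>"
proof -
  have "z = 2 powr log 2 z" using assms by simp
  also have "\<dots> \<le> 2 powr real_of_int \<lceil>log 2 z\<rceil>" by (intro powr_mono) auto
  finally show "z \<le> 2 powr real_of_int \<lceil>log 2 z\<rceil>" .
  have "2 powr real_of_int \<lceil>log 2 z\<rceil> / 2 = 2 powr (real_of_int \<lceil>log 2 z\<rceil> - 1)"
    by (simp add: powr_diff)
  also have "\<dots> \<le> 2 powr log 2 z" by (intro powr_mono) linarith+
  also have "\<dots> = z" using assms by simp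
  finally show "2 powr real_of_int \<lceil>log 2 z\<rceil> / 2 \<le> z" .
qed

text \<open>Disjointness makes the sum of the indicators at most \<open>1\<close>. Inclusion in
  \<open>A\<close> is asked for almost everywhere only, because the \<open>A_1\<close> bound that
  will provide it has an exceptional null set on each cube.\<close>

lemma disjoint_bodies_integral_le:
  fixes J :: "('n::finite) lcube set"
  assumes J: "finite J" "pairwise (\<lambda>d e. body d \<inter> body e = {}) J"
    and g: "g \<in> borel_measurable lebesgue"
    and A: "\<And>d. d \<in> J \<Longrightarrow> AE x in lebesgue. x \<in> body d \<longrightarrow> x \<in> A"
  shows "(\<Sum>d\<in>J. \<integral>\<^sup>+x\<in>body d. g x \<partial>lebesgue) \<le> (\<integral>\<^sup>+x\<in>A. g x \<partial>lebesgue)"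
proof -
  have "(\<Sum>d\<in>J. \<integral>\<^sup>+x\<in>body d. g x \<partial>lebesgue) = (\<integral>\<^sup>+x. (\<Sum>d\<in>J. g x * indicator (body d) x) \<partial>lebesgue)"
    using g by (subst nn_integral_sum) auto
  also have "\<dots> \<le> (\<integral>\<^sup>+x\<in>A. g x \<partial>lebesgue)"
  proof (rule nn_integral_mono_AE)
    have "AE x in lebesgue. \<forall>d\<in>J. x \<in> body d \<longrightarrow> x \<in> A"
      using J(1) A by (intro AE_finite_allI)
    then show "AE x in lebesgue. (\<Sum>d\<in>J. g x * indicator (body d) x) \<le> g x * indicator A x"
    proof eventually_elim
      case (elim x)
      show ?case
      proof (cases "\<exists>d\<in>J. x \<in> body d")
        case True
        then obtain e where e: "e \<in> J" "x \<in> body e" by blast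
        have "x \<notin> body d" if "d \<in> J - {e}" for d
          using J(2) e that unfolding pairwise_def by blast
        then have "(\<Sum>d\<in>J. g x * indicator (body d) x) = g x * indicator (body e) x"
          using J(1) e(1) by (subst sum.remove[of _ e]) (auto intro!: sum.neutral)
        moreover have "x \<in> A" using e elim by blast
        ultimately show ?thesis using e by simp
      next
        case False
        then have "(\<Sum>d\<in>J. g x * indicator (body d) x) = 0" by (intro sum.neutral) auto
        then show ?thesis by simp
      qed
    qed
  qed
  finally show ?thesis .
qed

text \<open>The cubes are grouped according to the size of the average of \<open>u\<close> and to the ratio of
  the average of \<open>w\<close> to the height. On each group the sum can be restricted to disjoint
  cubes, where the superadditivity of \<open>z\<^sup>\<kappa>\<close> applies.\<close>

lemma layered_sum_bound:
  fixes u w :: "real^'n \<Rightarrow> ennreal"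
  assumes u: "u \<in> A_1" and w: "w \<in> A_infty" and \<kappa>: "\<kappa> > 1" and \<rho>: "\<rho> > 0" and T: "T > 0"
  shows "\<exists>C>0. \<forall>F g H. finite F \<longrightarrow> layered F \<longrightarrow> g \<in> borel_measurable lebesgue \<longrightarrow> H \<ge> 0 \<longrightarrow>
    (\<integral>\<^sup>+x. g x * epow (u x) (1 / \<kappa>) \<partial>lebesgue) \<le> ennreal H \<longrightarrow>
    (\<forall>d\<in>F. rad d > 0 \<and> avg (body d) w \<le> ennreal (height d) \<and>
        T * (height d * vol d) \<le> enn2real (\<integral>\<^sup>+x\<in>body d. g x \<partial>lebesgue) powr \<kappa>
           * (enn2real (avg (body d) w) / height d) powr \<rho>) \<longrightarrow>
    (\<Sum>d\<in>F. height d * vol d * enn2real (avg (body d) u)) \<le> C * H powr \<kappa>"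
proof -
  have um [measurable]: "u \<in> borel_measurable lebesgue" and uw: "weight u" and ul: "locally_integrable u"
    using u unfolding A_1_def weight_def by auto
  have ww: "weight w" and wl: "locally_integrable w" using w unfolding A_infty_def by auto
  obtain A where A: "A > 0"
    and uA: "\<And>c h. h > 0 \<Longrightarrow> AE x in lebesgue. x \<in> cub c h \<longrightarrow> avg (cub c h) u \<le> ennreal A * u x"
    using A_1_doubling[OF u] by auto
  obtain C0 where C0: "C0 > 0" and sel: "\<And>F \<tau>. finite F \<Longrightarrow> \<tau> > 0 \<Longrightarrow> layered F \<Longrightarrow>
    (\<forall>d\<in>F. rad d > 0 \<and> ennreal (\<tau> * height d / 2) \<le> avg (body d) w
            \<and> avg (body d) w \<le> ennreal (\<tau> * height d)) \<Longrightarrow>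
    (\<exists>J\<subseteq>F. pairwise (\<lambda>d e. body d \<inter> body e = {}) J \<and>
       (\<Sum>d\<in>F. height d * vol d) \<le> C0 * (\<Sum>d\<in>J. height d * vol d))"
    using layered_disjoint_selection[OF w] by auto
  define K1 where "K1 = 1 / (1 - 2 powr (- (1 / \<kappa>)) :: real)"
  define K2 where "K2 = 1 / (1 - 2 powr (- \<rho>) :: real)"
  have K1: "K1 > 0" using \<kappa> unfolding K1_def by (simp add: powr_less_one)
  have K2: "K2 > 0" using \<rho> unfolding K2_def by (simp add: powr_less_one)
  \<comment> \<open>\<open>C0\<close> comes from the selection, \<open>T\<close> from the assumed
    lower bound, \<open>K2\<close> and \<open>K1\<close> from summing over the size classes of
    \<open>w\<close> and \<open>u\<close>, and \<open>2 * A\<close> from comparing dyadic averages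
    of \<open>u\<close> with pointwise values.\<close>
  define C where "C = C0 / T * K2 * K1 * (2 * A)"
  have C: "C > 0" unfolding C_def using C0 T K1 K2 A by simp
  have "(\<Sum>d\<in>F. height d * vol d * enn2real (avg (body d) u)) \<le> C * H powr \<kappa>"
    if fin: "finite F" and lay: "layered F" and g [measurable]: "g \<in> borel_measurable lebesgue" and H: "H \<ge> 0"
      and gH: "(\<integral>\<^sup>+x. g x * epow (u x) (1 / \<kappa>) \<partial>lebesgue) \<le> ennreal H"
      and F: "\<And>d. d \<in> F \<Longrightarrow> rad d > 0" "\<And>d. d \<in> F \<Longrightarrow> avg (body d) w \<le> ennreal (height d)"
        "\<And>d. d \<in> F \<Longrightarrow> T * (height d * vol d) \<le> enn2real (\<integral>\<^sup>+x\<in>body d. g x \<partial>lebesgue) powr \<kappa>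
           * (enn2real (avg (body d) w) / height d) powr \<rho>"
    for F :: "'n lcube set" and g :: "real^'n \<Rightarrow> ennreal" and H
  proof -
    define U where "U d = enn2real (avg (body d) u)" for d :: "'n lcube"
    define W where "W d = enn2real (avg (body d) w)" for d :: "'n lcube"
    have eU: "avg (body d) u = ennreal (U d)" and U0: "U d > 0" if "d \<in> F" for d
      using avg_finite[OF ul F(1)[OF that], of "fst (snd d)"] avg_pos[OF uw F(1)[OF that], of "fst (snd d)"]
      unfolding U_def body_eq by (auto simp: enn2real_positive_iff)
    have eW: "avg (body d) w = ennreal (W d)" and W0: "W d > 0" if "d \<in> F" for d
      using avg_finite[OF wl F(1)[OF that], of "fst (snd d)"] avg_pos[OF ww F(1)[OF that], of "fst (snd d)"]
      unfolding W_def body_eq by (auto simp: enn2real_positive_iff)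
    \<comment> \<open>Size classes, rounded up: \<open>iu\<close> for the average of
      \<open>u\<close>, \<open>iw\<close> for the ratio of the average of \<open>w\<close> to the
      height.\<close>
    define iu where "iu d = \<lceil>log 2 (U d)\<rceil>" for d
    define iw where "iw d = \<lceil>log 2 (W d / height d)\<rceil>" for d
    have iu: "2 powr iu d / 2 \<le> U d" "U d \<le> 2 powr iu d" if "d \<in> F" for d
      using dyadic_bracket[OF U0[OF that]] unfolding iu_def by auto
    have iw: "2 powr iw d / 2 \<le> W d / height d" "W d / height d \<le> 2 powr iw d" if "d \<in> F" for d
      using dyadic_bracket[of "W d / height d"] W0[OF that] unfolding iw_def by auto
    \<comment> \<open>Averages of \<open>w\<close> do not exceed the height, so only nonpositive
      exponents \<open>j\<close> occur and the factors \<open>(2 powr j) powr \<rho>\<close> have a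
      bounded sum.\<close>
    have iw1: "iw d \<le> 0" if "d \<in> F" for d
    proof -
      have "W d \<le> height d" using F(2)[OF that] unfolding eW[OF that] by simp
      then have "log 2 (W d / height d) \<le> 0" using W0[OF that] by (simp add: zero_le_log_cancel_iff log_le_zero_cancel_iff)
      then show ?thesis unfolding iw_def by (simp add: ceiling_le_zero)
    qed
    \<comment> \<open>If the average of \<open>u\<close> over a cube is at least
      \<open>2 powr i / 2\<close>, then \<open>y\<close> is at least \<open>2 powr i\<close> almost
      everywhere on it. This places a size class inside one superlevel set.\<close>
    define y where "y x = ennreal (2 * A) * u x" for x
    have y [measurable]: "y \<in> borel_measurable lebesgue" unfolding y_def by measurable
    define HH where "HH = (2 * A) powr (1 / \<kappa>) * H"
    have HH: "HH \<ge> 0" unfolding HH_def using H by simp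
    have ey: "epow (y x) (1 / \<kappa>) = ennreal ((2 * A) powr (1 / \<kappa>)) * epow (u x) (1 / \<kappa>)" for x
      using A unfolding y_def
      by (cases "u x") (auto simp: epow_ennreal ennreal_mult[symmetric] powr_mult ennreal_mult_top)
    have yH: "(\<integral>\<^sup>+x. g x * epow (y x) (1 / \<kappa>) \<partial>lebesgue) \<le> ennreal HH"
    proof -
      have "(\<integral>\<^sup>+x. g x * epow (y x) (1 / \<kappa>) \<partial>lebesgue)
         = (\<integral>\<^sup>+x. ennreal ((2 * A) powr (1 / \<kappa>)) * (g x * epow (u x) (1 / \<kappa>)) \<partial>lebesgue)"
        unfolding ey by (simp add: mult_ac)
      also have "\<dots> = ennreal ((2 * A) powr (1 / \<kappa>)) * (\<integral>\<^sup>+x. g x * epow (u x) (1 / \<kappa>) \<partial>lebesgue)"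
        by (rule nn_integral_cmult) measurable
      also have "\<dots> \<le> ennreal ((2 * A) powr (1 / \<kappa>)) * ennreal H" by (rule mult_left_mono[OF gH]) simp
      finally show ?thesis unfolding HH_def using H by (simp add: ennreal_mult)
    qed
    define G where "G i = (\<integral>\<^sup>+x. g x * indicator {x. ennreal (2 powr real_of_int i) \<le> y x} x \<partial>lebesgue)" for i :: int
    have Gfin: "G i < \<infinity>" for i
      unfolding G_def by (rule superlevel_powr_sum(1)[OF g y \<kappa> HH yH, of "{}"]) simp
    have Gsum: "(\<Sum>i\<in>iu ` F. 2 powr i * enn2real (G i) powr \<kappa>) \<le> K1 * HH powr \<kappa>"
      unfolding G_def K1_def by (rule superlevel_powr_sum(2)[OF g y \<kappa> HH yH]) (use fin in simp)
    have wsum: "(\<Sum>j\<in>iw ` F. (2 powr real_of_int j) powr \<rho>) \<le> K2"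
    proof -
      have "{j \<in> iw ` F. 2 powr real_of_int j \<le> (1::real)} = iw ` F"
      proof -
        have "2 powr real_of_int (iw d) \<le> (1::real)" if "d \<in> F" for d
          using powr_mono[of "real_of_int (iw d)" 0 2] iw1[OF that] by simp
        then show ?thesis by auto
      qed
      then show ?thesis
        using geometric_sum_below[of "iw ` F" \<rho> 1] fin \<rho> unfolding K2_def by simp
    qed
    have group: "(\<Sum>d\<in>{d\<in>F. (iu d, iw d) = (i, j)}. height d * vol d * U d)
        \<le> C0 / T * ((2 powr i * enn2real (G i) powr \<kappa>) * (2 powr real_of_int j) powr \<rho>)" for i j :: int
    proof -
      define E where "E = {d\<in>F. (iu d, iw d) = (i, j)}"
      have EF: "d \<in> F" if "d \<in> E" for d using that unfolding E_def by auto
      have Efin: "finite E" unfolding E_def using fin by simp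
      have Elay: "layered E" using lay unfolding layered_def E_def by (auto simp: pairwise_def)
      have "\<forall>d\<in>E. rad d > 0 \<and> ennreal (2 powr j * height d / 2) \<le> avg (body d) w
            \<and> avg (body d) w \<le> ennreal (2 powr j * height d)"
      proof
        fix d assume d: "d \<in> E"
        then have "iw d = j" unfolding E_def by simp
        then have "2 powr j / 2 \<le> W d / height d" "W d / height d \<le> 2 powr j" using iw[OF EF[OF d]] by auto
        then have "2 powr j * height d / 2 \<le> W d" "W d \<le> 2 powr j * height d"
          using height_pos[of d] by (auto simp: field_simps)
        then show "rad d > 0 \<and> ennreal (2 powr j * height d / 2) \<le> avg (body d) w
            \<and> avg (body d) w \<le> ennreal (2 powr j * height d)"
          using F(1)[OF EF[OF d]] unfolding eW[OF EF[OF d]] by (auto intro: ennreal_leI)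
      qed
      then obtain J where J: "J \<subseteq> E" "pairwise (\<lambda>d e. body d \<inter> body e = {}) J"
          "(\<Sum>d\<in>E. height d * vol d) \<le> C0 * (\<Sum>d\<in>J. height d * vol d)"
        using sel[OF Efin _ Elay, of "2 powr j"] by auto
      have Jfin: "finite J" using J(1) Efin finite_subset by auto
      have JF: "d \<in> F" if "d \<in> J" for d using EF[OF subsetD[OF J(1) that]] .
      define X where "X d = enn2real (\<integral>\<^sup>+x\<in>body d. g x \<partial>lebesgue)" for d
      have S1: "(\<Sum>d\<in>J. \<integral>\<^sup>+x\<in>body d. g x \<partial>lebesgue) \<le> G i"
        unfolding G_def
      proof (rule disjoint_bodies_integral_le[OF Jfin J(2) g])
        fix d assume d: "d \<in> J"
        then have "iu d = i" using J(1) unfolding E_def by auto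
        then have "2 powr i \<le> 2 * U d" using iu[OF JF[OF d]] by auto
        then have le: "ennreal (2 powr i) \<le> 2 * avg (body d) u"
          unfolding eU[OF JF[OF d]] using U0[OF JF[OF d]] 
          by (metis ennreal_leI ennreal_mult' ennreal_numeral zero_le_numeral)
        show "AE x in lebesgue. x \<in> body d \<longrightarrow> x \<in> {x. ennreal (2 powr real_of_int i) \<le> y x}"
          using uA[OF F(1)[OF JF[OF d]], of "fst (snd d)"]
        proof eventually_elim
          case (elim x)
          show ?case
          proof
            assume "x \<in> body d"
            then have "avg (body d) u \<le> ennreal A * u x" using elim unfolding body_eq by simp
            then have "2 * avg (body d) u \<le> 2 * (ennreal A * u x)" by (rule mult_left_mono) simp
            also have "\<dots> = y x" unfolding y_def using A by (simp add: ennreal_mult mult.assoc)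
            finally show "x \<in> {x. ennreal (2 powr real_of_int i) \<le> y x}" using le by auto
          qed
        qed
      qed
      \<comment> \<open>Finiteness must be known before \<open>enn2real\<close> can be removed, as
        it sends \<open>top\<close> to \<open>0\<close>.\<close>
      have Xfin: "(\<integral>\<^sup>+x\<in>body d. g x \<partial>lebesgue) = ennreal (X d)" if "d \<in> J" for d
      proof -
        have "(\<integral>\<^sup>+x\<in>body d. g x \<partial>lebesgue) \<le> (\<Sum>d\<in>J. \<integral>\<^sup>+x\<in>body d. g x \<partial>lebesgue)"
          using that Jfin by (intro member_le_sum) auto
        then have "(\<integral>\<^sup>+x\<in>body d. g x \<partial>lebesgue) < \<infinity>" using S1 Gfin[of i] by (meson le_less_trans)
        then show ?thesis unfolding X_def by simp
      qed
      have X0: "X d \<ge> 0" for d unfolding X_def by simp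
      have XS: "(\<Sum>d\<in>J. X d) \<le> enn2real (G i)"
      proof -
        have "ennreal (\<Sum>d\<in>J. X d) = (\<Sum>d\<in>J. ennreal (X d))" using X0 by (simp add: sum_ennreal)
        also have "\<dots> = (\<Sum>d\<in>J. \<integral>\<^sup>+x\<in>body d. g x \<partial>lebesgue)" using Xfin by (intro sum.cong) auto
        also have "\<dots> \<le> G i" by (rule S1)
        also have "\<dots> = ennreal (enn2real (G i))" using Gfin[of i] by simp
        finally show ?thesis by simp
      qed
      have "(\<Sum>d\<in>J. height d * vol d) \<le> (\<Sum>d\<in>J. 1 / T * (X d powr \<kappa> * (2 powr real_of_int j) powr \<rho>))"
      proof (rule sum_mono)
        fix d assume d: "d \<in> J"
        then have "iw d = j" using J(1) unfolding E_def by auto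
        then have "W d / height d \<le> 2 powr j" using iw[OF JF[OF d]] by auto
        then have "(W d / height d) powr \<rho> \<le> (2 powr j) powr \<rho>"
          using W0[OF JF[OF d]] \<rho> by (intro powr_mono2) auto
        then have "T * (height d * vol d) \<le> X d powr \<kappa> * (2 powr real_of_int j) powr \<rho>"
          using F(3)[OF JF[OF d]] unfolding X_def[symmetric] W_def[symmetric]
          by (meson mult_left_mono order_trans powr_ge_zero)
        then show "height d * vol d \<le> 1 / T * (X d powr \<kappa> * (2 powr real_of_int j) powr \<rho>)"
          using T by (simp add: field_simps)
      qed
      also have "\<dots> = 1 / T * (2 powr real_of_int j) powr \<rho> * (\<Sum>d\<in>J. X d powr \<kappa>)"
        unfolding sum_distrib_left by (intro sum.cong) auto
      also have "\<dots> \<le> 1 / T * (2 powr real_of_int j) powr \<rho> * enn2real (G i) powr \<kappa>"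
      proof (rule mult_left_mono)
        have "(\<Sum>d\<in>J. X d powr \<kappa>) \<le> (\<Sum>d\<in>J. X d) powr \<kappa>"
          using \<kappa> X0 Jfin by (intro sum_powr_le_powr_sum) auto
        also have "\<dots> \<le> enn2real (G i) powr \<kappa>" using XS X0 \<kappa> by (intro powr_mono2 sum_nonneg) auto
        finally show "(\<Sum>d\<in>J. X d powr \<kappa>) \<le> enn2real (G i) powr \<kappa>" .
      qed (use T in simp)
      finally have S2: "(\<Sum>d\<in>J. height d * vol d) \<le> 1 / T * (2 powr real_of_int j) powr \<rho> * enn2real (G i) powr \<kappa>" .
      have "(\<Sum>d\<in>E. height d * vol d * U d) \<le> (\<Sum>d\<in>E. height d * vol d * 2 powr i)"
      proof (rule sum_mono)
        fix d assume d: "d \<in> E"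
        then have "iu d = i" unfolding E_def by auto
        then have "U d \<le> 2 powr i" using iu[OF EF[OF d]] by auto
        then show "height d * vol d * U d \<le> height d * vol d * 2 powr i" by (intro mult_left_mono) auto
      qed
      also have "\<dots> = 2 powr i * (\<Sum>d\<in>E. height d * vol d)" by (simp add: sum_distrib_left mult_ac)
      also have "\<dots> \<le> 2 powr i * (C0 * (1 / T * (2 powr real_of_int j) powr \<rho> * enn2real (G i) powr \<kappa>))"
      proof (rule mult_left_mono)
        show "(\<Sum>d\<in>E. height d * vol d) \<le> C0 * (1 / T * (2 powr real_of_int j) powr \<rho> * enn2real (G i) powr \<kappa>)"
          using J(3) mult_left_mono[OF S2, of C0] C0 by linarith
      qed simp
      finally show ?thesis unfolding E_def by (simp add: mult_ac)
    qed
    let ?key = "\<lambda>d. (iu d, iw d)"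
    let ?t = "\<lambda>i j. C0 / T * ((2 powr real_of_int i * enn2real (G i) powr \<kappa>) * (2 powr real_of_int j) powr \<rho>)"
    have t0: "?t i j \<ge> 0" for i j :: int using C0 T by simp
    have "(\<Sum>d\<in>F. height d * vol d * U d) = (\<Sum>p\<in>?key ` F. \<Sum>d\<in>{d\<in>F. ?key d = p}. height d * vol d * U d)"
      by (rule sum.image_gen[OF fin])
    also have "\<dots> \<le> (\<Sum>p\<in>?key ` F. case p of (i, j) \<Rightarrow> ?t i j)"
      using group by (intro sum_mono) (auto split: prod.splits)
    \<comment> \<open>Enlarging the set of occurring pairs to a product makes the double sum
      factor.\<close>
    also have "\<dots> \<le> (\<Sum>p\<in>iu ` F \<times> iw ` F. case p of (i, j) \<Rightarrow> ?t i j)"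
      using fin t0 by (intro sum_mono2) auto
    also have "\<dots> = (\<Sum>i\<in>iu ` F. \<Sum>j\<in>iw ` F. ?t i j)" by (simp add: sum.cartesian_product)
    also have "\<dots> = C0 / T * ((\<Sum>i\<in>iu ` F. 2 powr i * enn2real (G i) powr \<kappa>) * (\<Sum>j\<in>iw ` F. (2 powr real_of_int j) powr \<rho>))"
      by (simp only: sum_product) (simp only: sum_distrib_left)
    also have "\<dots> \<le> C0 / T * ((K1 * HH powr \<kappa>) * K2)"
      using C0 T K1 Gsum wsum by (intro mult_left_mono mult_mono) (auto intro!: sum_nonneg)
    also have "\<dots> = C * H powr \<kappa>"
      unfolding C_def HH_def using A H \<kappa> by (simp add: powr_mult powr_powr mult_ac)
    finally show ?thesis unfolding U_def .
  qed
  with C show ?thesis by (intro exI[of _ C]) blast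
qed

text \<open>A Vitali selection among cubes of equal height leaves a layered family whose fourfold
  dilations cover. On the truncated sets \<open>w\<close> is at most the height, so only the
  \<open>u\<close>-measure of a dilated cube remains, which doubling of \<open>u\<close>
  controls.\<close>

lemma finite_family_bound:
  fixes u w :: "real^'n \<Rightarrow> ennreal"
  assumes u: "u \<in> A_1" and w: "w \<in> A_infty" and \<kappa>: "\<kappa> > 1" and \<rho>: "\<rho> > 0" and T: "T > 0"
  shows "\<exists>C>0. \<forall>F g H. finite F \<longrightarrow> g \<in> borel_measurable lebesgue \<longrightarrow> H \<ge> 0 \<longrightarrow>
    (\<integral>\<^sup>+x. g x * epow (u x) (1 / \<kappa>) \<partial>lebesgue) \<le> ennreal H \<longrightarrow>
    (\<forall>d\<in>F. rad d > 0 \<and> avg (body d) w \<le> ennreal (height d) \<and>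
        T * (height d * vol d) \<le> enn2real (\<integral>\<^sup>+x\<in>body d. g x \<partial>lebesgue) powr \<kappa>
           * (enn2real (avg (body d) w) / height d) powr \<rho>) \<longrightarrow>
    (\<integral>\<^sup>+x\<in>(\<Union>d\<in>F. dil 2 d \<inter> {x. w x \<le> ennreal (height d)}). u x * w x \<partial>lebesgue)
      \<le> ennreal (C * H powr \<kappa>)"
proof -
  have um [measurable]: "u \<in> borel_measurable lebesgue" and uw: "weight u" and ul: "locally_integrable u"
    using u unfolding A_1_def weight_def by auto
  have wm [measurable]: "w \<in> borel_measurable lebesgue" using w unfolding A_infty_def weight_def by auto
  obtain A where A: "A > 0" and dbl: "\<And>c h. h > 0 \<Longrightarrow>
     (\<integral>\<^sup>+x\<in>cub c (4 * h). u x \<partial>lebesgue) \<le> ennreal A * (\<integral>\<^sup>+x\<in>cub c h. u x \<partial>lebesgue)"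
    using A_1_doubling[OF u] by auto
  obtain C0 where C0: "C0 > 0" and bound: "\<And>F g H. finite F \<Longrightarrow> layered F \<Longrightarrow> g \<in> borel_measurable lebesgue \<Longrightarrow> H \<ge> 0 \<Longrightarrow>
    (\<integral>\<^sup>+x. g x * epow (u x) (1 / \<kappa>) \<partial>lebesgue) \<le> ennreal H \<Longrightarrow>
    (\<forall>d\<in>F. rad d > 0 \<and> avg (body d) w \<le> ennreal (height d) \<and>
        T * (height d * vol d) \<le> enn2real (\<integral>\<^sup>+x\<in>body d. g x \<partial>lebesgue) powr \<kappa>
           * (enn2real (avg (body d) w) / height d) powr \<rho>) \<Longrightarrow>
    (\<Sum>d\<in>F. height d * vol d * enn2real (avg (body d) u)) \<le> C0 * H powr \<kappa>"
    using layered_sum_bound[OF u w \<kappa> \<rho> T] by blast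
  have "(\<integral>\<^sup>+x\<in>(\<Union>d\<in>F. dil 2 d \<inter> {x. w x \<le> ennreal (height d)}). u x * w x \<partial>lebesgue)
      \<le> ennreal (A * C0 * H powr \<kappa>)"
    if fin: "finite F" and g: "g \<in> borel_measurable lebesgue" and H: "H \<ge> 0"
      and gH: "(\<integral>\<^sup>+x. g x * epow (u x) (1 / \<kappa>) \<partial>lebesgue) \<le> ennreal H"
      and F: "\<forall>d\<in>F. rad d > 0 \<and> avg (body d) w \<le> ennreal (height d) \<and>
        T * (height d * vol d) \<le> enn2real (\<integral>\<^sup>+x\<in>body d. g x \<partial>lebesgue) powr \<kappa>
           * (enn2real (avg (body d) w) / height d) powr \<rho>"
    for F :: "'n lcube set" and g :: "real^'n \<Rightarrow> ennreal" and H
  proof -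
    \<comment> \<open>Equal height is part of the relation, so that the selected cubes are layered
      and truncating \<open>w\<close> at the height of \<open>d\<close> is the same as truncating it
      at the height of \<open>e\<close>.\<close>
    let ?meet = "\<lambda>d e :: 'n lcube. fst d = fst e \<and> body d \<inter> body e \<noteq> {}"
    have "\<exists>J\<subseteq>F. pairwise (\<lambda>d e. \<not> ?meet d e) J \<and> (\<forall>d\<in>F. \<exists>e\<in>J. ?meet d e \<and> rad d \<le> rad e)"
    proof (rule finite_Vitali[OF fin])
      show "?meet e d" if "?meet d e" for d e using that by (simp add: Int_commute)
      show "?meet d d" if "d \<in> F" for d using F that body_nonempty[of d] by simp
    qed
    then obtain J where J: "J \<subseteq> F" "pairwise (\<lambda>d e. \<not> ?meet d e) J"
        "\<And>d. d \<in> F \<Longrightarrow> \<exists>e\<in>J. ?meet d e \<and> rad d \<le> rad e"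
      by blast
    have Jfin: "finite J" using J(1) fin finite_subset by auto
    have Jlay: "layered J" using J(2) unfolding layered_def by (rule pairwise_mono) auto
    define B where "B e = dil 4 e \<inter> {x\<in>space lebesgue. w x \<le> ennreal (height e)}" for e :: "'n lcube"
    have cover: "(\<Union>d\<in>F. dil 2 d \<inter> {x. w x \<le> ennreal (height d)}) \<subseteq> (\<Union>e\<in>J. B e)"
    proof
      fix x assume "x \<in> (\<Union>d\<in>F. dil 2 d \<inter> {x. w x \<le> ennreal (height d)})"
      then obtain d where d: "d \<in> F" "x \<in> dil 2 d" "w x \<le> ennreal (height d)" by blast
      obtain e where e: "e \<in> J" "fst d = fst e" "body d \<inter> body e \<noteq> {}" "rad d \<le> rad e"
        using J(3)[OF d(1)] by blast
      have "x \<in> B e" using dil_subset(2)[OF e(3,4)] d e(2) unfolding B_def height_def by auto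
      then show "x \<in> (\<Union>e\<in>J. B e)" using e(1) by blast
    qed
    have "(\<integral>\<^sup>+x\<in>(\<Union>d\<in>F. dil 2 d \<inter> {x. w x \<le> ennreal (height d)}). u x * w x \<partial>lebesgue)
        \<le> (\<Sum>e\<in>J. \<integral>\<^sup>+x\<in>B e. u x * w x \<partial>lebesgue)"
      by (rule nn_integral_UN_le_sum[OF Jfin _ _ cover]) (auto simp: B_def)
    also have "\<dots> \<le> (\<Sum>e\<in>J. ennreal (A * (height e * vol e * enn2real (avg (body e) u))))"
    proof (rule sum_mono)
      fix e assume "e \<in> J"
      then have h: "rad e > 0" using F J(1) by blast
      have "(\<integral>\<^sup>+x\<in>B e. u x * w x \<partial>lebesgue)
          \<le> (\<integral>\<^sup>+x. ennreal (height e) * (u x * indicator (dil 4 e) x) \<partial>lebesgue)"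
      proof (rule nn_integral_mono)
        fix x
        show "u x * w x * indicator (B e) x \<le> ennreal (height e) * (u x * indicator (dil 4 e) x)"
          unfolding B_def by (auto simp: indicator_def mult.commute[of _ "u x"] mult.left_commute intro!: mult_left_mono)
      qed
      also have "\<dots> = ennreal (height e) * (\<integral>\<^sup>+x\<in>dil 4 e. u x \<partial>lebesgue)"
        by (rule nn_integral_cmult) auto
      also have "\<dots> \<le> ennreal (height e) * (ennreal A * (\<integral>\<^sup>+x\<in>body e. u x \<partial>lebesgue))"
        using dbl[OF h, of "fst (snd e)"] unfolding dil_def by (intro mult_left_mono) auto
      also have "(\<integral>\<^sup>+x\<in>body e. u x \<partial>lebesgue) = avg (body e) u * ennreal (vol e)"
        using nn_set_integral_eq_avg[OF h] by (simp add: body_eq emeasure_cub)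
      also have "avg (body e) u = ennreal (enn2real (avg (body e) u))"
        using avg_finite[OF ul h] by (simp add: body_eq)
      also have "ennreal (height e) * (ennreal A * (ennreal (enn2real (avg (body e) u)) * ennreal (vol e)))
          = ennreal (A * (height e * vol e * enn2real (avg (body e) u)))"
        using A by (simp add: ennreal_mult''[symmetric] mult_ac)
      finally show "(\<integral>\<^sup>+x\<in>B e. u x * w x \<partial>lebesgue)
          \<le> ennreal (A * (height e * vol e * enn2real (avg (body e) u)))" .
    qed
    also have "\<dots> = ennreal (A * (\<Sum>e\<in>J. height e * vol e * enn2real (avg (body e) u)))"
      using A by (subst sum_ennreal) (auto simp: sum_distrib_left)
    also have "\<dots> \<le> ennreal (A * (C0 * H powr \<kappa>))"
    proof (intro ennreal_leI mult_left_mono)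
      show "(\<Sum>e\<in>J. height e * vol e * enn2real (avg (body e) u)) \<le> C0 * H powr \<kappa>"
        using F J(1) by (intro bound[OF Jfin Jlay g H gH]) blast
    qed (use A in simp)
    finally show ?thesis by (simp add: mult.assoc)
  qed
  moreover have "A * C0 > 0" using A C0 by simp
  ultimately show ?thesis by (intro exI[of _ "A * C0"]) blast
qed

text \<open>The constant for finite families does not depend on their size, so monotone convergence
  along an enumeration passes to countable ones.\<close>

lemma countable_family_bound:
  fixes u w :: "real^'n \<Rightarrow> ennreal"
  assumes u: "u \<in> A_1" and w: "w \<in> A_infty" and \<kappa>: "\<kappa> > 1" and \<rho>: "\<rho> > 0" and T: "T > 0"
  shows "\<exists>C>0. \<forall>F g H. countable F \<longrightarrow> g \<in> borel_measurable lebesgue \<longrightarrow> H \<ge> 0 \<longrightarrow>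
    (\<integral>\<^sup>+x. g x * epow (u x) (1 / \<kappa>) \<partial>lebesgue) \<le> ennreal H \<longrightarrow>
    (\<forall>d\<in>F. rad d > 0 \<and> avg (body d) w \<le> ennreal (height d) \<and>
        T * (height d * vol d) \<le> enn2real (\<integral>\<^sup>+x\<in>body d. g x \<partial>lebesgue) powr \<kappa>
           * (enn2real (avg (body d) w) / height d) powr \<rho>) \<longrightarrow>
    (\<integral>\<^sup>+x\<in>(\<Union>d\<in>F. dil 2 d \<inter> {x. w x \<le> ennreal (height d)}). u x * w x \<partial>lebesgue)
      \<le> ennreal (C * H powr \<kappa>)"
proof -
  have um [measurable]: "u \<in> borel_measurable lebesgue" using u unfolding A_1_def weight_def by auto
  have wm [measurable]: "w \<in> borel_measurable lebesgue" using w unfolding A_infty_def weight_def by auto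
  obtain C where C: "C > 0" and bound: "\<And>F g H. finite F \<Longrightarrow> g \<in> borel_measurable lebesgue \<Longrightarrow> H \<ge> 0 \<Longrightarrow>
    (\<integral>\<^sup>+x. g x * epow (u x) (1 / \<kappa>) \<partial>lebesgue) \<le> ennreal H \<Longrightarrow>
    (\<forall>d\<in>F. rad d > 0 \<and> avg (body d) w \<le> ennreal (height d) \<and>
        T * (height d * vol d) \<le> enn2real (\<integral>\<^sup>+x\<in>body d. g x \<partial>lebesgue) powr \<kappa>
           * (enn2real (avg (body d) w) / height d) powr \<rho>) \<Longrightarrow>
    (\<integral>\<^sup>+x\<in>(\<Union>d\<in>F. dil 2 d \<inter> {x. w x \<le> ennreal (height d)}). u x * w x \<partial>lebesgue)
      \<le> ennreal (C * H powr \<kappa>)"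
    using finite_family_bound[OF u w \<kappa> \<rho> T] by blast
  have "(\<integral>\<^sup>+x\<in>(\<Union>d\<in>F. dil 2 d \<inter> {x. w x \<le> ennreal (height d)}). u x * w x \<partial>lebesgue)
      \<le> ennreal (C * H powr \<kappa>)"
    if cnt: "countable F" and g: "g \<in> borel_measurable lebesgue" and H: "H \<ge> 0"
      and gH: "(\<integral>\<^sup>+x. g x * epow (u x) (1 / \<kappa>) \<partial>lebesgue) \<le> ennreal H"
      and F: "\<forall>d\<in>F. rad d > 0 \<and> avg (body d) w \<le> ennreal (height d) \<and>
        T * (height d * vol d) \<le> enn2real (\<integral>\<^sup>+x\<in>body d. g x \<partial>lebesgue) powr \<kappa>
           * (enn2real (avg (body d) w) / height d) powr \<rho>"
    for F :: "'n lcube set" and g :: "real^'n \<Rightarrow> ennreal" and H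
  proof (cases "F = {}")
    case True
    then show ?thesis by simp
  next
    case False
    define B where "B e = dil 2 e \<inter> {x. w x \<le> ennreal (height e)}" for e :: "'n lcube"
    have Bm [measurable]: "B e \<in> sets lebesgue" for e
    proof -
      have "B e = dil 2 e \<inter> {x\<in>space lebesgue. w x \<le> ennreal (height e)}" unfolding B_def by simp
      also have "\<dots> \<in> sets lebesgue" by measurable
      finally show ?thesis .
    qed
    define S where "S m = (\<Union>d\<in>from_nat_into F ` {..m}. B d)" for m :: nat
    have Sm [measurable]: "S m \<in> sets lebesgue" for m unfolding S_def by auto
    have "incseq S" unfolding S_def incseq_def by (intro allI impI UN_mono image_mono) auto
    have SU: "(\<Union>m. S m) = (\<Union>d\<in>F. B d)"
    proof -
      have "F = from_nat_into F ` UNIV" using False cnt by (simp add: range_from_nat_into)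
      then have "(\<Union>d\<in>F. B d) = (\<Union>m. B (from_nat_into F m))" by (metis image_image)
      also have "\<dots> = (\<Union>m. S m)" unfolding S_def by auto
      finally show ?thesis by simp
    qed
    have "(\<integral>\<^sup>+x\<in>(\<Union>d\<in>F. B d). u x * w x \<partial>lebesgue)
        = (\<integral>\<^sup>+x. (SUP m. u x * w x * indicator (S m) x) \<partial>lebesgue)"
    proof (rule nn_integral_cong)
      fix x
      show "u x * w x * indicator (\<Union>d\<in>F. B d) x = (SUP m. u x * w x * indicator (S m) x)"
      proof (cases "x \<in> (\<Union>m. S m)")
        case True
        then obtain m where m: "x \<in> S m" by blast
        show ?thesis
          unfolding SU[symmetric]
        proof (rule antisym)
          show "u x * w x * indicator (\<Union>m. S m) x \<le> (SUP m. u x * w x * indicator (S m) x)"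
            by (rule SUP_upper2[of m]) (use m in \<open>auto simp: indicator_def\<close>)
        qed (auto intro!: SUP_least simp: indicator_def)
      next
        case False
        then show ?thesis unfolding SU[symmetric] by (simp add: indicator_def)
      qed
    qed
    also have "\<dots> = (SUP m. \<integral>\<^sup>+x\<in>S m. u x * w x \<partial>lebesgue)"
    proof (rule nn_integral_monotone_convergence_SUP)
      show "incseq (\<lambda>m x. u x * w x * indicator (S m) x)"
        using \<open>incseq S\<close> unfolding incseq_def le_fun_def
        by (auto simp: indicator_def)
    qed measurable
    also have "\<dots> \<le> ennreal (C * H powr \<kappa>)"
    proof (rule SUP_least)
      fix m
      have "from_nat_into F ` {..m} \<subseteq> F" using False from_nat_into[of F] by auto
      then show "(\<integral>\<^sup>+x\<in>S m. u x * w x \<partial>lebesgue) \<le> ennreal (C * H powr \<kappa>)"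
        unfolding S_def B_def using F by (intro bound[OF _ g H gH]) auto
    qed
    finally show ?thesis unfolding B_def .
  qed
  with C show ?thesis by (intro exI[of _ C]) blast
qed

section \<open>Points where all averages are small\<close>

text \<open>The weak half of the Lebesgue differentiation theorem. For \<open>\<sigma> < \<mu>\<close>, covering a set of
  points where all averages are at most \<open>\<sigma>\<close> while \<open>w \<ge> \<mu>\<close> by nonoverlapping cubes inside an
  open set shrinks its outer measure by the factor \<open>\<sigma>/\<mu>\<close>.\<close>

lemma negligible_small_averages:
  fixes w :: "real^'n \<Rightarrow> ennreal"
  assumes w [measurable]: "w \<in> borel_measurable lebesgue" and l: "0 < \<sigma>" "\<sigma> < \<mu>" and N: "N > 0"
  shows "negligible {x \<in> cub 0 N. (\<forall>c h. h > 0 \<longrightarrow> x \<in> cub c h \<longrightarrow> avg (cub c h) w \<le> ennreal \<sigma>) \<and> ennreal \<mu> \<le> w x}"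
    (is "negligible ?Z")
proof -
  define Z where "Z = ?Z"
  define W where "W = {x. ennreal \<mu> \<le> w x}"
  define \<theta> where "\<theta> = \<sigma> / \<mu>"
  have \<theta>: "0 < \<theta>" "\<theta> < 1" using l unfolding \<theta>_def by auto
  have Wm [measurable]: "W \<in> sets lebesgue"
  proof -
    have "W = {x\<in>space lebesgue. ennreal \<mu> \<le> w x}" unfolding W_def by simp
    also have "\<dots> \<in> sets lebesgue" by measurable
    finally show ?thesis .
  qed
  define a b :: "real^'n" where "a = (\<chi> i. - N)" and "b = (\<chi> i. N)"
  have cub0: "cub (0 :: real^'n) N = cbox a b" unfolding cub_def a_def b_def by simp
  \<comment> \<open>The set \<open>Z\<close> is not known to be measurable; the argument works with
    measurable supersets \<open>T\<close> and replaces them by smaller ones.\<close>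
  have shrink: "\<exists>T'. Z \<subseteq> T' \<and> T' \<in> lmeasurable \<and> measure lebesgue T' \<le> \<theta> * (measure lebesgue T + e)"
    if T: "T \<in> lmeasurable" "Z \<subseteq> T" and e: "e > 0" for T e
  proof -
    obtain O' where O': "open O'" "T \<subseteq> O'" "O' \<in> lmeasurable" "measure lebesgue O' < measure lebesgue T + e"
    proof -
      obtain O' where O': "open O'" "T \<subseteq> O'" "O' - T \<in> lmeasurable" "emeasure lebesgue (O' - T) < ennreal e"
        using sets_lebesgue_outer_open[of T e] T(1) e by auto
      have eq: "O' = T \<union> (O' - T)" using O'(2) by auto
      have "O' \<in> lmeasurable" using T(1) O'(3) by (subst eq) (rule fmeasurable.Un)
      moreover have "measure lebesgue (O' - T) < e"
        using O'(4) e unfolding emeasure_eq_measure2[OF O'(3)] by (simp add: ennreal_less_iff)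
      moreover have "measure lebesgue O' \<le> measure lebesgue T + measure lebesgue (O' - T)"
        using T(1) O'(3) by (subst eq) (intro measure_Un_le, auto)
      ultimately show thesis using O'(1,2) by (intro that[of O']) auto
    qed
    \<comment> \<open>This gauge confines every covering box tagged at a point of \<open>Z\<close>
      to the open set \<open>O'\<close>.\<close>
    define G where "G x = (if x \<in> O' then O' else UNIV)" for x
    have "gauge G" unfolding gauge_def G_def using O'(1) by auto
    moreover have "Z \<subseteq> cbox a b" unfolding Z_def cub0 by auto
    moreover have "0 \<in> box a b" unfolding a_def b_def mem_box_cart using N by simp
    then have "box a b \<noteq> {}" by blast
    ultimately obtain \<D> where D: "countable \<D>" "\<Union>\<D> \<subseteq> cbox a b"
        "\<And>K. K \<in> \<D> \<Longrightarrow> interior K \<noteq> {} \<and> (\<exists>c d. K = cbox c d)"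
        "pairwise (\<lambda>A B. interior A \<inter> interior B = {}) \<D>"
        "\<And>K. K \<in> \<D> \<Longrightarrow> \<exists>x \<in> Z \<inter> K. K \<subseteq> G x"
        "\<And>u v. cbox u v \<in> \<D> \<Longrightarrow> \<exists>n. \<forall>i \<in> Basis. v \<bullet> i - u \<bullet> i = (b \<bullet> i - a \<bullet> i) / 2^n"
        "Z \<subseteq> \<Union>\<D>"
      using covering_lemma[of Z a b G] by metis
    \<comment> \<open>The covering halves \<open>cbox a b\<close> repeatedly in all coordinates, and
      \<open>cbox a b\<close> is a cube. Hence its boxes are cubes, as the hypothesis on averages
      requires.\<close>
    have Kcube: "\<exists>c h. h > 0 \<and> K = cub c h" if K: "K \<in> \<D>" for K
    proof -
      obtain c d where cd: "K = cbox c d" using D(3)[OF K] by auto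
      obtain n where n: "\<forall>i \<in> Basis. d \<bullet> i - c \<bullet> i = (b \<bullet> i - a \<bullet> i) / 2^n" using D(6) K cd by blast
      have "d $ i - c $ i = 2 * N / 2 ^ n" for i
        using n[rule_format, of "axis i 1"] unfolding a_def b_def
        by (simp add: inner_axis axis_in_Basis_iff)
      then have "d $ i = c $ i + 2 * N / 2 ^ n" for i by (metis add_diff_cancel_left' diff_add_cancel add.commute)
      then have "d = (\<chi> i. c $ i + 2 * N / 2 ^ n)" by (simp add: vec_eq_iff)
      then have "cube K" unfolding cube_def cd using N by (intro exI[of _ c] exI[of _ "2 * N / 2 ^ n"]) auto
      then show ?thesis by (simp add: cube_iff_cub)
    qed
    have KO: "K \<subseteq> O'" if K: "K \<in> \<D>" for K
    proof -
      obtain x where "x \<in> Z \<inter> K" "K \<subseteq> G x" using D(5)[OF K] by auto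
      then show ?thesis using O'(2) T(2) unfolding G_def by (auto split: if_splits)
    qed
    have Km [measurable, simp]: "interior K \<in> sets lebesgue" for K :: "(real^'n) set"
    proof -
      have "interior K \<in> sets lborel" by simp
      then show ?thesis by (rule sets_completionI_sets)
    qed
    \<comment> \<open>Every box contains a point of \<open>Z\<close>, so the average over it is at
      most \<open>\<sigma>\<close>, and Chebyshev's inequality gives the ratio
      \<open>\<sigma> / \<mu>\<close>.\<close>
    have Kint: "emeasure lebesgue (interior K \<inter> W) \<le> ennreal \<theta> * emeasure lebesgue (interior K)" if K: "K \<in> \<D>" for K
    proof -
      obtain c h where ch: "h > 0" "K = cub c h" using Kcube[OF K] by auto
      obtain x where "x \<in> Z" "x \<in> K" using D(5)[OF K] by auto
      then have avg: "avg K w \<le> ennreal \<sigma>" unfolding Z_def ch using ch(1) by blast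
      have eK: "emeasure lebesgue (interior K) = emeasure lebesgue K"
        unfolding ch cub_def interior_cbox by (simp add: emeasure_lborel_box_eq emeasure_lborel_cbox_eq)
      have "ennreal \<mu> * emeasure lebesgue (interior K \<inter> W) = (\<integral>\<^sup>+x. ennreal \<mu> * indicator (interior K \<inter> W) x \<partial>lebesgue)"
        by (simp add: nn_integral_cmult_indicator)
      also have "\<dots> \<le> (\<integral>\<^sup>+x\<in>K. w x \<partial>lebesgue)"
        by (rule nn_integral_mono) (use interior_subset[of K] in \<open>auto simp: indicator_def W_def\<close>)
      also have "\<dots> = avg K w * emeasure lebesgue K" unfolding ch(2) by (rule nn_set_integral_eq_avg[OF ch(1)])
      also have "\<dots> \<le> ennreal \<sigma> * emeasure lebesgue K" by (rule mult_right_mono[OF avg]) simp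
      finally have "ennreal (1 / \<mu>) * (ennreal \<mu> * emeasure lebesgue (interior K \<inter> W))
          \<le> ennreal (1 / \<mu>) * (ennreal \<sigma> * emeasure lebesgue (interior K))"
        unfolding eK by (rule mult_left_mono) simp
      moreover have "ennreal (1 / \<mu>) * ennreal \<mu> = 1" using l by (simp add: ennreal_mult'[symmetric])
      moreover have "ennreal (1 / \<mu>) * ennreal \<sigma> = ennreal \<theta>" using l unfolding \<theta>_def by (simp add: ennreal_mult'[symmetric])
      ultimately show ?thesis by (simp add: mult.assoc[symmetric])
    qed
    have disj: "disjoint_family_on interior \<D>"
      using D(4) unfolding disjoint_family_on_def pairwise_def by blast
    \<comment> \<open>The boxes overlap only in their boundaries: the measures of the disjoint
      interiors add up, while the boundaries form a negligible set.\<close>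
    define T1 where "T1 = (\<Union>K\<in>\<D>. interior K \<inter> W)"
    define T2 where "T2 = (\<Union>K\<in>\<D>. frontier K)"
    have T2: "negligible T2"
      unfolding T2_def
    proof (rule negligible_countable_Union)
      show "countable (frontier ` \<D>)" using D(1) by simp
      show "negligible X" if X: "X \<in> frontier ` \<D>" for X
      proof -
        obtain K where K: "K \<in> \<D>" "X = frontier K" using X by blast
        obtain c d where "K = cbox c d" using D(3)[OF K(1)] by auto
        then show ?thesis unfolding K(2) by (simp add: negligible_frontier_interval frontier_cbox)
      qed
    qed
    have T1m: "T1 \<in> sets lebesgue" unfolding T1_def using D(1) by (intro sets.countable_UN') auto
    have "emeasure lebesgue T1 = (\<integral>\<^sup>+K. emeasure lebesgue (interior K \<inter> W) \<partial>count_space \<D>)"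
      unfolding T1_def
    proof (rule emeasure_UN_countable)
      show "disjoint_family_on (\<lambda>K. interior K \<inter> W) \<D>"
        using disj unfolding disjoint_family_on_def by blast
    qed (use D(1) in auto)
    also have "\<dots> \<le> (\<integral>\<^sup>+K. ennreal \<theta> * emeasure lebesgue (interior K) \<partial>count_space \<D>)"
      by (rule nn_integral_mono) (use Kint in auto)
    also have "\<dots> = ennreal \<theta> * (\<integral>\<^sup>+K. emeasure lebesgue (interior K) \<partial>count_space \<D>)"
      by (rule nn_integral_cmult) auto
    also have "(\<integral>\<^sup>+K. emeasure lebesgue (interior K) \<partial>count_space \<D>) = emeasure lebesgue (\<Union>K\<in>\<D>. interior K)"
      by (rule emeasure_UN_countable[symmetric]) (use D(1) disj in auto)
    also have "\<dots> \<le> emeasure lebesgue O'"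
      using O'(3) KO interior_subset by (intro emeasure_mono) blast+
    also have "emeasure lebesgue O' = ennreal (measure lebesgue O')"
      using O'(3) by (intro emeasure_eq_measure2) (simp add: fmeasurableD2)
    also have "ennreal \<theta> * ennreal (measure lebesgue O') = ennreal (\<theta> * measure lebesgue O')"
      using \<theta> by (simp add: ennreal_mult)
    finally have le: "emeasure lebesgue T1 \<le> ennreal (\<theta> * measure lebesgue O')" 
      by (simp add: mult_left_mono)
    then have T1f: "T1 \<in> lmeasurable" using T1m by (intro fmeasurableI) (auto simp: less_top[symmetric] top_unique)
    then have "ennreal (measure lebesgue T1) \<le> ennreal (\<theta> * measure lebesgue O')"
      using le by (simp add: emeasure_eq_measure2[OF T1f])
    then have mle: "measure lebesgue T1 \<le> \<theta> * measure lebesgue O'" using \<theta> by simp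
    have T2f: "T2 \<in> lmeasurable" "measure lebesgue T2 = 0"
      using T2 negligible_iff_measure by auto
    have "Z \<subseteq> T1 \<union> T2"
    proof
      fix x assume x: "x \<in> Z"
      then obtain K where K: "K \<in> \<D>" "x \<in> K" using D(7) by auto
      have "x \<in> W" using x unfolding Z_def W_def by auto
      moreover have "x \<in> interior K \<or> x \<in> frontier K" using K(2) closure_subset unfolding frontier_def by blast
      ultimately show "x \<in> T1 \<union> T2" unfolding T1_def T2_def using K(1) by auto
    qed
    moreover have "measure lebesgue (T1 \<union> T2) \<le> \<theta> * (measure lebesgue T + e)"
    proof -
      have "measure lebesgue (T1 \<union> T2) \<le> measure lebesgue T1 + measure lebesgue T2"
        using T1f T2f by (intro measure_Un_le) auto
      also have "\<dots> \<le> \<theta> * measure lebesgue O'" using mle T2f by simp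
      also have "\<dots> \<le> \<theta> * (measure lebesgue T + e)" using O'(4) \<theta> by (intro mult_left_mono) auto
      finally show ?thesis .
    qed
    moreover have "T1 \<union> T2 \<in> lmeasurable" using T1f T2f by auto
    ultimately show ?thesis by blast
  qed
  have Z0: "Z \<subseteq> cub 0 N" unfolding Z_def by auto
  define m0 where "m0 = measure lebesgue (cub (0 :: real^'n) N)"
  \<comment> \<open>An allowance of \<open>e / 2\<close> for the previous set and
    \<open>e / 2\<close> for the open cover adds up to \<open>e\<close>, which the factor
    \<open>\<theta> < 1\<close> only reduces.\<close>
  have iter: "\<exists>T. Z \<subseteq> T \<and> T \<in> lmeasurable \<and> measure lebesgue T \<le> \<theta> ^ k * m0 + e" if "e > 0" for k e
    using that
  proof (induction k arbitrary: e)
    case 0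
    then show ?case using Z0 unfolding m0_def by (intro exI[of _ "cub 0 N"]) auto
  next
    case (Suc k)
    obtain T where T: "Z \<subseteq> T" "T \<in> lmeasurable" "measure lebesgue T \<le> \<theta> ^ k * m0 + e / 2"
      using Suc.IH[of "e / 2"] Suc.prems by auto
    obtain T' where T': "Z \<subseteq> T'" "T' \<in> lmeasurable" "measure lebesgue T' \<le> \<theta> * (measure lebesgue T + e / 2)"
      using shrink[OF T(2,1), of "e / 2"] Suc.prems by auto
    have "\<theta> * (measure lebesgue T + e / 2) \<le> \<theta> * (\<theta> ^ k * m0 + e)"
      using T(3) \<theta> by (intro mult_left_mono) auto
    also have "\<dots> \<le> \<theta> ^ Suc k * m0 + e"
      using mult_right_mono[of \<theta> 1 e] \<theta> Suc.prems by (simp add: distrib_left)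
    finally show ?case using T' by (intro exI[of _ T']) auto
  qed
  have "negligible Z"
    unfolding negligible_outer_le
  proof (intro allI impI)
    fix e :: real assume e: "e > 0"
    have "(\<lambda>k. \<theta> ^ k * m0) \<longlonglongrightarrow> 0 * m0"
      using \<theta> by (intro tendsto_mult LIMSEQ_realpow_zero) auto
    then have "\<forall>\<^sub>F k in sequentially. \<theta> ^ k * m0 < e / 2"
      using e by (intro order_tendstoD) auto
    then obtain k where k: "\<theta> ^ k * m0 < e / 2" by (meson eventually_sequentially le_refl)
    obtain T where "Z \<subseteq> T" "T \<in> lmeasurable" "measure lebesgue T \<le> \<theta> ^ k * m0 + e / 2"
      using iter[of "e / 2" k] e by auto
    with k show "\<exists>T. Z \<subseteq> T \<and> T \<in> lmeasurable \<and> measure lebesgue T \<le> e"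
      by (intro exI[of _ T]) auto
  qed
  then show ?thesis unfolding Z_def .
qed

text \<open>The exceptional set is a countable union of negligible sets, indexed by a bounded cube
  containing the point and by an excess \<open>1 / real (Suc m)\<close> of \<open>w\<close> over
  \<open>\<sigma>\<close>.\<close>

lemma AE_le_of_averages_le:
  fixes w :: "real^'n \<Rightarrow> ennreal"
  assumes w: "w \<in> borel_measurable lebesgue" and l: "0 < \<sigma>"
  shows "AE x in lebesgue. (\<forall>c h. h > 0 \<longrightarrow> x \<in> cub c h \<longrightarrow> avg (cub c h) w \<le> ennreal \<sigma>) \<longrightarrow> w x \<le> ennreal \<sigma>"
proof -
  let ?P = "\<lambda>x. \<forall>c h. h > 0 \<longrightarrow> x \<in> cub c h \<longrightarrow> avg (cub c h) w \<le> ennreal \<sigma>"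
  define Z where "Z N m = {x \<in> cub 0 (real (Suc N)). ?P x \<and> ennreal (\<sigma> + 1 / real (Suc m)) \<le> w x}" for N m
  have "negligible (Z N m)" for N m
    unfolding Z_def using l by (intro negligible_small_averages[OF w]) auto
  then have "AE x in lebesgue. x \<notin> Z N m" for N m
    by (simp add: negligible_iff_null_sets AE_not_in)
  then have "AE x in lebesgue. \<forall>N m. x \<notin> Z N m"
    by (simp add: AE_all_countable)
  then show ?thesis
  proof eventually_elim
    case (elim x)
    show ?case
    proof (rule impI, rule ccontr)
      assume P: "?P x" and "\<not> w x \<le> ennreal \<sigma>"
      then have gt: "ennreal \<sigma> < w x" by simp
      obtain N where N: "norm x \<le> real N" using real_arch_simple by blast
      have "x \<in> cub 0 (real (Suc N))"
        unfolding mem_cub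
      proof
        fix i
        show "\<bar>x $ i - 0 $ i\<bar> \<le> real (Suc N)" using component_le_norm_cart[of x i] N by simp
      qed
      moreover have "\<exists>m. ennreal (\<sigma> + 1 / real (Suc m)) \<le> w x"
      proof (cases "w x")
        case (real y)
        then have "y - \<sigma> > 0" using gt l by (simp add: ennreal_less_iff)
        then obtain m where "1 / real (Suc m) < y - \<sigma>" using nat_approx_posE by blast
        then show ?thesis using real l by (intro exI[of _ m]) (auto simp del: ennreal_plus intro!: ennreal_leI)
      qed simp
      ultimately show False using elim P unfolding Z_def by blast
    qed
  qed
qed

section \<open>Luxemburg averages and Hoelder\<close>

text \<open>A logarithm is dominated by any positive power, which handles \<open>z \<ge> 1\<close>;
  below \<open>1\<close> the logarithmic factor is \<open>1\<close>. The additive constant is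
  smaller than \<open>1\<close> so that it can be absorbed when a modular exceeds
  \<open>1\<close>.\<close>

lemma log_bump_le_powr:
  assumes r: "r \<ge> 1" and \<delta>: "\<delta> \<ge> 0" and r1: "r1 > r"
  shows "\<exists>C>0. \<forall>z\<ge>0. z powr r * (1 + log_plus z) powr \<delta> \<le> 1 / 2 + C * z powr r1"
proof -
  \<comment> \<open>The power \<open>z powr a\<close> dominating the logarithm must satisfy
    \<open>a * \<delta> \<le> r1 - r\<close>; the \<open>+ 1\<close> covers
    \<open>\<delta> = 0\<close>.\<close>
  define a where "a = (r1 - r) / (\<delta> + 1)"
  have a: "a > 0" "a * \<delta> \<le> r1 - r"
    using r1 \<delta> unfolding a_def by (auto simp: field_simps)
  define K where "K = (1 + 1 / a) powr \<delta>"
  have "1 + 1 / a > 0" using a by (simp add: add_pos_pos)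
  then have K: "K > 0" unfolding K_def by (subst powr_gt_zero) simp
  \<comment> \<open>Chosen such that \<open>z powr r > 1 / 2\<close> implies
    \<open>1 \<le> L * z powr r1\<close>.\<close>
  define L where "L = (2::real) powr (r1 / r)"
  have L: "L > 0" unfolding L_def by simp
  have "z powr r * (1 + log_plus z) powr \<delta> \<le> 1 / 2 + (K + L) * z powr r1" if z: "z \<ge> 0" for z
  proof (cases "z \<ge> 1")
    case True
    have "ln z \<le> z powr a / a" using True a by (intro ln_powr_bound) auto
    moreover have "1 \<le> z powr a" using True a by (simp add: ge_one_powr_ge_zero)
    ultimately have "1 + ln z \<le> (1 + 1 / a) * z powr a" by (simp add: distrib_right)
    moreover have lp: "log_plus z = ln z" using True unfolding log_plus_def by simp
    ultimately have "(1 + log_plus z) powr \<delta> \<le> ((1 + 1 / a) * z powr a) powr \<delta>"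
      using True \<delta> by (intro powr_mono2) auto
    also have "\<dots> = K * z powr (a * \<delta>)" unfolding K_def using a by (simp add: powr_mult powr_powr)
    also have "\<dots> \<le> K * z powr (r1 - r)" using K True a by (intro mult_left_mono powr_mono) auto
    finally have "z powr r * (1 + log_plus z) powr \<delta> \<le> z powr r * (K * z powr (r1 - r))"
      by (rule mult_left_mono) simp
    also have "\<dots> = K * z powr r1" by (simp add: powr_add[symmetric] mult.left_commute)
    also have "\<dots> \<le> 1 / 2 + (K + L) * z powr r1" using L by (simp add: distrib_right)
    finally show ?thesis .
  next
    case False
    \<comment> \<open>At \<open>z = 0\<close> this rests on the convention
      \<open>ln 0 = 0\<close>.\<close>
    then have "ln z \<le> 0" using z by (cases "z = 0") auto
    then have "log_plus z = 0" unfolding log_plus_def by simp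
    moreover have "z powr r \<le> 1 / 2 + (K + L) * z powr r1"
    proof (cases "z powr r \<le> 1 / 2")
      case True
      have "0 \<le> (K + L) * z powr r1" using K L by simp
      with True show ?thesis by linarith
    next
      case False': False
      have "(1 / 2) powr (r1 / r) \<le> (z powr r) powr (r1 / r)"
        using False' r r1 by (intro powr_mono2) auto
      then have "1 \<le> L * (z powr r) powr (r1 / r)"
        unfolding L_def by (simp add: powr_divide field_simps)
      then have "1 \<le> L * z powr r1" using r by (simp add: powr_powr)
      moreover have "z powr r \<le> 1" using False z r by (simp add: powr_le1)
      moreover have "0 \<le> K * z powr r1" using K by simp
      ultimately show ?thesis by (simp add: distrib_right)
    qed
    ultimately show ?thesis by simp
  qed
  moreover have "K + L > 0" using K L by simp
  ultimately show ?thesis by blast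
qed

lemma epow_0 [simp]: "epow 0 a = 0" by (simp add: epow_def ext_top_def)

text \<open>Young's inequality is applied after dividing the two functions by their integrals. If
  \<open>X = 0\<close>, where this division is impossible, the product vanishes almost
  everywhere.\<close>

lemma nn_integral_Holder:
  assumes a [measurable]: "a \<in> borel_measurable M" and b [measurable]: "b \<in> borel_measurable M"
    and \<alpha>: "0 < \<alpha>" "\<alpha> < 1" and X: "(\<integral>\<^sup>+x. a x \<partial>M) = ennreal X" "X \<ge> 0" and Y: "(\<integral>\<^sup>+x. b x \<partial>M) = ennreal Y" "Y > 0"
  shows "(\<integral>\<^sup>+x. epow (a x) \<alpha> * epow (b x) (1 - \<alpha>) \<partial>M) \<le> ennreal (X powr \<alpha> * Y powr (1 - \<alpha>))"
proof (cases "X = 0")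
  case True
  then have "AE x in M. a x = 0" using X(1) by (simp add: nn_integral_0_iff_AE)
  then have "(\<integral>\<^sup>+x. epow (a x) \<alpha> * epow (b x) (1 - \<alpha>) \<partial>M) = (\<integral>\<^sup>+x. 0 \<partial>M)"
    by (intro nn_integral_cong_AE) (auto elim!: eventually_mono)
  then show ?thesis by simp
next
  case False
  with X have X0: "X > 0" by simp
  define Z where "Z = X powr \<alpha> * Y powr (1 - \<alpha>)"
  have Z: "Z > 0" unfolding Z_def using X0 Y by simp
  \<comment> \<open>These are the coefficients of Young's inequality multiplied by \<open>Z\<close>;
    they satisfy \<open>c * X + d * Y = Z\<close>.\<close>
  define c d where "c = Z * \<alpha> / X" and "d = Z * (1 - \<alpha>) / Y"
  have c: "c > 0" and d: "d > 0" unfolding c_def d_def using Z \<alpha> X0 Y by auto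
  have "epow (a x) \<alpha> * epow (b x) (1 - \<alpha>) \<le> ennreal c * a x + ennreal d * b x" for x
  proof (cases "a x = top \<or> b x = top")
    case True
    then have "ennreal c * a x + ennreal d * b x = top" using c d by (auto simp: ennreal_mult_top)
    then show ?thesis by (metis top_greatest)
  next
    case False
    then obtain a' b' where ab: "a x = ennreal a'" "a' \<ge> 0" "b x = ennreal b'" "b' \<ge> 0"
      by (metis ennreal_cases)
    have "a' powr \<alpha> * b' powr (1 - \<alpha>) \<le> c * a' + d * b'"
    proof (cases "a' = 0 \<or> b' = 0")
      case True
      then show ?thesis using ab c d by auto
    next
      case False
      have "(a' / X) powr \<alpha> * (b' / Y) powr (1 - \<alpha>) \<le> \<alpha> * (a' / X) + (1 - \<alpha>) * (b' / Y)"
        using False ab \<alpha> X0 Y by (intro Youngs_inequality_0) auto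
      then have "Z * ((a' / X) powr \<alpha> * (b' / Y) powr (1 - \<alpha>)) \<le> Z * (\<alpha> * (a' / X) + (1 - \<alpha>) * (b' / Y))"
        using Z by (intro mult_left_mono) auto
      moreover have "Z * ((a' / X) powr \<alpha> * (b' / Y) powr (1 - \<alpha>)) = a' powr \<alpha> * b' powr (1 - \<alpha>)"
        unfolding Z_def using X0 Y ab by (simp add: powr_divide)
      moreover have "Z * (\<alpha> * (a' / X) + (1 - \<alpha>) * (b' / Y)) = c * a' + d * b'"
        unfolding c_def d_def by (simp add: distrib_left)
      ultimately show ?thesis by simp
    qed
    then show ?thesis using ab c d
      by (simp add: epow_ennreal ennreal_mult[symmetric] ennreal_plus[symmetric] del: ennreal_plus)
  qed
  then have "(\<integral>\<^sup>+x. epow (a x) \<alpha> * epow (b x) (1 - \<alpha>) \<partial>M) \<le> (\<integral>\<^sup>+x. ennreal c * a x + ennreal d * b x \<partial>M)"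
    by (intro nn_integral_mono)
  also have "\<dots> = ennreal c * ennreal X + ennreal d * ennreal Y"
    by (simp add: nn_integral_add nn_integral_cmult X Y)
  also have "\<dots> = ennreal (c * X + d * Y)"
    using c d X0 Y by (simp add: ennreal_mult[symmetric] ennreal_plus[symmetric] del: ennreal_plus)
  also have "c * X + d * Y = Z" unfolding c_def d_def using X0 Y by (simp add: field_simps)
  finally show ?thesis unfolding Z_def .
qed

text \<open>The Hoelder estimate is raised to the power \<open>q / r1\<close>. In the application
  \<open>c = \<gamma> / n\<close>, and the relation between \<open>p\<close> and \<open>q\<close>
  leaves exactly one factor \<open>m\<close>, the volume, once
  \<open>m powr (q / r1 - q / p)\<close> is cancelled.\<close>

lemma level_arith:
  fixes m b X W D c r1 p q :: real
  assumes pos: "m > 0" "b > 0" "X \<ge> 0" "W > 0" "D > 0" "r1 > 0" "p > 0" "q > 0"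
    and q: "1 / q = 1 / p - c"
    and le: "m * (b * m powr (- c)) powr r1 \<le> D * (X powr (r1 / p) * (W * m) powr (1 - r1 / p))"
  shows "b powr q * m \<le> D powr (q / r1) * (X powr (q / p) * W powr (q / r1 - q / p))"
proof -
  have "(m * (b * m powr (- c)) powr r1) powr (q / r1)
      \<le> (D * (X powr (r1 / p) * (W * m) powr (1 - r1 / p))) powr (q / r1)"
    using le pos by (intro powr_mono2) auto
  moreover have "(m * (b * m powr (- c)) powr r1) powr (q / r1) = b powr q * m powr (q / r1 - c * q)"
  proof -
    have "(m * (b * m powr (- c)) powr r1) powr (q / r1) = m powr (q / r1) * (b * m powr (- c)) powr q"
      using pos by (simp add: powr_mult powr_powr)
    also have "(b * m powr (- c)) powr q = b powr q * m powr (- c * q)"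
      using pos by (simp only: powr_mult powr_powr)
    also have "m powr (q / r1) * (b powr q * m powr (- c * q)) = b powr q * (m powr (q / r1) * m powr (- c * q))"
      by simp
    also have "m powr (q / r1) * m powr (- c * q) = m powr (q / r1 - c * q)"
      unfolding powr_add[symmetric] by simp
    finally show ?thesis .
  qed
  moreover have "(1 - r1 / p) * (q / r1) = q / r1 - q / p" using pos by (simp add: field_simps)
  then have "(D * (X powr (r1 / p) * (W * m) powr (1 - r1 / p))) powr (q / r1)
      = D powr (q / r1) * (X powr (q / p) * W powr (q / r1 - q / p)) * m powr (q / r1 - q / p)"
    using pos by (simp add: powr_mult powr_powr mult_ac)
  ultimately have 1: "b powr q * m powr (q / r1 - c * q)
      \<le> D powr (q / r1) * (X powr (q / p) * W powr (q / r1 - q / p)) * m powr (q / r1 - q / p)"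
    by simp
  have "q / p - c * q = 1" using q pos by (simp add: field_simps)
  then have eq: "q / r1 - c * q = (q / r1 - q / p) + 1" by simp
  have "m powr (q / r1 - c * q) = m powr (q / r1 - q / p) * m"
    unfolding eq powr_add using pos by simp
  with 1 have "m powr (q / r1 - q / p) * (b powr q * m)
      \<le> m powr (q / r1 - q / p) * (D powr (q / r1) * (X powr (q / p) * W powr (q / r1 - q / p)))"
    by (simp add: mult_ac)
  then show ?thesis using pos by simp
qed

section \<open>Algebra of extended powers and estimates for Luxemburg averages\<close>

lemma epow_mult_ennreal:
  assumes "y \<ge> 0"
  shows "epow (ennreal y * z) a = ennreal (y powr a) * epow z a"
proof (cases z)
  case (real x)
  then show ?thesis using assms
    by (simp add: epow_ennreal ennreal_mult[symmetric] powr_mult)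
next
  case top
  then show ?thesis using assms by (cases "y = 0") (auto simp: ennreal_mult_top)
qed

lemma epow_epow: "0 < z \<Longrightarrow> z < \<infinity> \<Longrightarrow> epow (epow z a) b = epow z (a * b)"
  by (cases z) (auto simp: epow_ennreal powr_powr)

lemma epow_add: "0 < z \<Longrightarrow> z < \<infinity> \<Longrightarrow> epow z a * epow z b = epow z (a + b)"
  by (cases z) (auto simp: epow_ennreal powr_add ennreal_mult)

lemma ennreal_divide_eq_mult: "s > 0 \<Longrightarrow> z / ennreal s = ennreal (1 / s) * z"
  by (simp add: divide_ennreal_def inverse_ennreal mult.commute inverse_eq_divide)

text \<open>Testing the modular instead of the norm makes an inequality between Luxemburg averages
  unnecessary: a modular exceeding \<open>1\<close> forces the average of the power \<open>r1\<close> to be large.\<close>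

lemma modular_gt_imp_powr_bound:
  fixes f :: "real^'n \<Rightarrow> real" and v :: "real^'n \<Rightarrow> ennreal"
  assumes C1: "C1 > 0" and \<Phi>: "\<And>z. z \<ge> 0 \<Longrightarrow> \<Phi> z \<le> 1 / 2 + C1 * z powr r1"
    and f [measurable]: "f \<in> borel_measurable lebesgue" and v: "weight v"
    and r1: "0 < r1" "r1 < p" and t: "t > 0" and L: "L > 0" and h: "h > 0"
    and e: "e * (r1 / p) + s * (1 - r1 / p) = r1"
    and X: "(\<integral>\<^sup>+x\<in>cub c h. ennreal ((\<bar>f x\<bar> / t) powr p) * epow (v x) e \<partial>lebesgue) = ennreal X" "X \<ge> 0"
    and W: "avg (cub c h) (\<lambda>x. epow (v x) s) = ennreal W" "W > 0"
    and gt: "1 < avg (cub c h) (\<lambda>x. ext_top \<Phi> (ennreal \<bar>f x\<bar> * v x / ennreal (t * L)))"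
  shows "measure lebesgue (cub c h) * L powr r1
    \<le> 2 * C1 * (X powr (r1 / p) * (W * measure lebesgue (cub c h)) powr (1 - r1 / p))"
proof -
  have vm [measurable]: "v \<in> borel_measurable lebesgue" using v unfolding weight_def by auto
  let ?Q = "cub c h"
  define m where "m = measure lebesgue ?Q"
  have m: "m > 0" using h unfolding m_def by simp
  define \<alpha> where "\<alpha> = r1 / p"
  have \<alpha>: "0 < \<alpha>" "\<alpha> < 1" using r1 unfolding \<alpha>_def by auto
  \<comment> \<open>The two Hoelder factors: the relation between \<open>e\<close> and
    \<open>s\<close> makes the exponents of \<open>v\<close> in the product of
    \<open>epow (a x) \<alpha>\<close> and \<open>epow (b x) (1 - \<alpha>)\<close> add up to
    \<open>r1\<close>.\<close>
  define a where "a x = ennreal ((\<bar>f x\<bar> / t) powr p) * epow (v x) e * indicator ?Q x" for x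
  define b where "b x = epow (v x) s * indicator ?Q x" for x
  have am [measurable]: "a \<in> borel_measurable lebesgue" unfolding a_def by measurable
  have bm [measurable]: "b \<in> borel_measurable lebesgue" unfolding b_def by measurable
  have bI: "(\<integral>\<^sup>+x. b x \<partial>lebesgue) = ennreal (W * m)"
    unfolding b_def nn_set_integral_eq_avg[OF h] W using W(2) m by (simp add: emeasure_cub m_def ennreal_mult)
  have hold: "(\<integral>\<^sup>+x. epow (a x) \<alpha> * epow (b x) (1 - \<alpha>) \<partial>lebesgue) \<le> ennreal (X powr \<alpha> * (W * m) powr (1 - \<alpha>))"
    using X W m by (intro nn_integral_Holder[OF am bm \<alpha> _ _ bI]) (auto simp: a_def)
  have AEv: "AE x in lebesgue. 0 < v x \<and> v x < \<infinity>" using v unfolding weight_def by auto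
  define z where "z x = ennreal \<bar>f x\<bar> * v x / ennreal (t * L)" for x
  have zle: "ext_top \<Phi> (z x) \<le> ennreal (1 / 2) + ennreal C1 * epow (z x) r1" for x
  proof (cases "z x")
    case (real y)
    have "ext_top \<Phi> (z x) \<le> ennreal (1 / 2 + C1 * y powr r1)"
      using real \<Phi>[of y] by (auto simp: ext_top_def intro!: ennreal_leI)
    also have "\<dots> = ennreal (1 / 2) + ennreal (C1 * y powr r1)" using C1 by (intro ennreal_plus) auto
    also have "ennreal (C1 * y powr r1) = ennreal C1 * epow (z x) r1"
      using real C1 by (simp add: epow_ennreal ennreal_mult)
    finally show ?thesis .
  next
    case top
    then show ?thesis using C1 by (simp add: ennreal_mult_top)
  qed
  have zp: "AE x in lebesgue. epow (z x) r1 * indicator ?Q x = ennreal (L powr (- r1)) * (epow (a x) \<alpha> * epow (b x) (1 - \<alpha>))"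
    using AEv
  proof eventually_elim
    case (elim x)
    show ?case
    proof (cases "x \<in> ?Q")
      case True
      have "z x = ennreal (1 / (t * L)) * (ennreal \<bar>f x\<bar> * v x)"
        unfolding z_def using t L by (intro ennreal_divide_eq_mult) auto
      also have "\<dots> = ennreal (1 / L * (\<bar>f x\<bar> / t)) * v x"
        using t L by (simp add: mult.assoc[symmetric] ennreal_mult'[symmetric] mult.commute[of t L])
      finally have "epow (z x) r1 = ennreal ((1 / L * (\<bar>f x\<bar> / t)) powr r1) * epow (v x) r1"
        using t L by (simp only:) (rule epow_mult_ennreal, simp)
      also have "(1 / L * (\<bar>f x\<bar> / t)) powr r1 = L powr (- r1) * (\<bar>f x\<bar> / t) powr r1"
        using t L by (simp add: powr_mult powr_minus powr_divide inverse_eq_divide)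
      finally have 1: "epow (z x) r1 = ennreal (L powr (- r1)) * (ennreal ((\<bar>f x\<bar> / t) powr r1) * epow (v x) r1)"
        by (simp add: ennreal_mult mult.assoc)
      have "epow (a x) \<alpha> = ennreal (((\<bar>f x\<bar> / t) powr p) powr \<alpha>) * epow (epow (v x) e) \<alpha>"
        unfolding a_def using True by (simp add: epow_mult_ennreal)
      also have "\<dots> = ennreal ((\<bar>f x\<bar> / t) powr r1) * epow (v x) (e * \<alpha>)"
        using elim r1 by (simp add: powr_powr epow_epow \<alpha>_def)
      finally have 2: "epow (a x) \<alpha> = ennreal ((\<bar>f x\<bar> / t) powr r1) * epow (v x) (e * \<alpha>)" .
      have 3: "epow (b x) (1 - \<alpha>) = epow (v x) (s * (1 - \<alpha>))"
        unfolding b_def using True elim by (simp add: epow_epow)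
      have "epow (v x) (e * \<alpha>) * epow (v x) (s * (1 - \<alpha>)) = epow (v x) r1"
        using elim e unfolding \<alpha>_def by (simp add: epow_add)
      then show ?thesis unfolding 1 2 3 using True by (simp add: mult.assoc)
    next
      case False
      then show ?thesis by (simp add: a_def)
    qed
  qed
  have zm [measurable]: "z \<in> borel_measurable lebesgue" unfolding z_def by measurable
  have "ennreal m < (\<integral>\<^sup>+x\<in>?Q. ext_top \<Phi> (z x) \<partial>lebesgue)"
  proof -
    have "1 < avg ?Q (\<lambda>x. ext_top \<Phi> (z x))" using gt unfolding z_def .
    then have "ennreal m * 1 < ennreal m * avg ?Q (\<lambda>x. ext_top \<Phi> (z x))"
      using m by (intro ennreal_mult_strict_left_mono) auto
    then show ?thesis unfolding nn_set_integral_eq_avg[OF h] by (simp add: emeasure_cub m_def mult.commute)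
  qed
  also have "\<dots> \<le> (\<integral>\<^sup>+x. ennreal (1 / 2) * indicator ?Q x + ennreal C1 * (epow (z x) r1 * indicator ?Q x) \<partial>lebesgue)"
    by (intro nn_integral_mono) (use zle in \<open>auto simp: indicator_def\<close>)
  also have "\<dots> = ennreal (1 / 2) * ennreal m + ennreal C1 * (\<integral>\<^sup>+x. epow (z x) r1 * indicator ?Q x \<partial>lebesgue)"
    by (subst nn_integral_add) (auto simp: nn_integral_cmult emeasure_cub m_def)
  also have "(\<integral>\<^sup>+x. epow (z x) r1 * indicator ?Q x \<partial>lebesgue)
      = (\<integral>\<^sup>+x. ennreal (L powr (- r1)) * (epow (a x) \<alpha> * epow (b x) (1 - \<alpha>)) \<partial>lebesgue)"
    by (rule nn_integral_cong_AE[OF zp])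
  also have "\<dots> = ennreal (L powr (- r1)) * (\<integral>\<^sup>+x. epow (a x) \<alpha> * epow (b x) (1 - \<alpha>) \<partial>lebesgue)"
    by (rule nn_integral_cmult) measurable
  finally have "ennreal m < ennreal (1 / 2) * ennreal m + ennreal C1 * (ennreal (L powr (- r1)) * (\<integral>\<^sup>+x. epow (a x) \<alpha> * epow (b x) (1 - \<alpha>) \<partial>lebesgue))" .
  also have "\<dots> \<le> ennreal (1 / 2) * ennreal m + ennreal C1 * (ennreal (L powr (- r1)) * ennreal (X powr \<alpha> * (W * m) powr (1 - \<alpha>)))"
    by (intro add_left_mono mult_left_mono hold) auto
  also have "\<dots> = ennreal (m / 2 + C1 * (L powr (- r1) * (X powr \<alpha> * (W * m) powr (1 - \<alpha>))))"
  proof -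
    have 1: "ennreal (1 / 2) * ennreal m = ennreal (m / 2)" by (subst ennreal_mult'[symmetric]) simp_all
    have 2: "ennreal C1 * (ennreal (L powr (- r1)) * ennreal (X powr \<alpha> * (W * m) powr (1 - \<alpha>)))
        = ennreal (C1 * (L powr (- r1) * (X powr \<alpha> * (W * m) powr (1 - \<alpha>))))"
      using C1 by (simp add: ennreal_mult'[symmetric])
    show ?thesis unfolding 1 2 using C1 m by (intro ennreal_plus[symmetric]) auto
  qed
  \<comment> \<open>The term \<open>m / 2\<close> is absorbed on the left, which produces the factor
    \<open>2 * C1\<close>.\<close>
  finally have "m < m / 2 + C1 * (L powr (- r1) * (X powr \<alpha> * (W * m) powr (1 - \<alpha>)))"
    by (rule ennreal_less_iff[THEN iffD1, rotated]) (use m in simp)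
  then have "m * L powr r1 \<le> 2 * C1 * (X powr \<alpha> * (W * m) powr (1 - \<alpha>))"
    using L by (simp add: powr_minus field_simps)
  then show ?thesis unfolding m_def \<alpha>_def .
qed

text \<open>As \<open>\<phi>\<close> dominates \<open>z powr s\<close>, the Luxemburg average
  dominates the power average with exponent \<open>s\<close>. The strict bound by \<open>b\<close>
  provides an admissible level \<open>l < b\<close>, whether or not the infimum is attained.\<close>

lemma maximal_ge_powr_average:
  fixes v :: "real^'n \<Rightarrow> ennreal"
  assumes v: "weight v" and s: "s > 0" and \<phi>: "\<And>z. z \<ge> 0 \<Longrightarrow> z powr s \<le> \<phi> z"
    and Q: "cube Q" "x \<in> Q" and b: "maximal \<phi> v x < ennreal b"
  shows "avg Q (\<lambda>y. epow (v y) s) \<le> ennreal (b powr s)"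
proof -
  have vm [measurable]: "v \<in> borel_measurable lebesgue" using v unfolding weight_def by auto
  have "lux_avg \<phi> v Q \<le> maximal \<phi> v x"
    unfolding maximal_def using Q by (intro SUP_upper) auto
  then have "lux_avg \<phi> v Q < ennreal b" using b by simp
  then obtain l where l: "l > 0" "avg Q (\<lambda>y. ext_top \<phi> (v y / ennreal l)) \<le> 1" "ennreal l < ennreal b"
    unfolding lux_avg_def INF_less_iff by auto
  have lb: "l \<le> b" using l by (simp add: ennreal_less_iff)
  have pt: "ennreal (l powr (- s)) * epow (v y) s \<le> ext_top \<phi> (v y / ennreal l)" for y
  proof -
    have "ennreal (l powr (- s)) * epow (v y) s = epow (v y / ennreal l) s"
      using l(1) by (simp add: ennreal_divide_eq_mult epow_mult_ennreal powr_divide powr_minus inverse_eq_divide)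
    also have "\<dots> \<le> ext_top \<phi> (v y / ennreal l)"
      unfolding epow_def ext_top_def using \<phi> by (auto intro!: ennreal_leI)
    finally show ?thesis .
  qed
  obtain c h where ch: "h > 0" "Q = cub c h" using Q(1) cube_iff_cub by blast
  have Qm [measurable]: "Q \<in> sets lebesgue" unfolding ch by simp
  have "ennreal (l powr (- s)) * avg Q (\<lambda>y. epow (v y) s)
      = (\<integral>\<^sup>+y. ennreal (l powr (- s)) * (epow (v y) s * indicator Q y) \<partial>lebesgue) / emeasure lebesgue Q"
    unfolding avg_def by (subst nn_integral_cmult) (auto simp: ennreal_times_divide)
  also have "\<dots> \<le> avg Q (\<lambda>y. ext_top \<phi> (v y / ennreal l))"
    unfolding avg_def using pt
    by (intro divide_right_mono_ennreal nn_integral_mono) (auto simp: indicator_def)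
  also have "\<dots> \<le> 1" by (rule l(2))
  finally have "ennreal (l powr s) * (ennreal (l powr (- s)) * avg Q (\<lambda>y. epow (v y) s)) \<le> ennreal (l powr s) * 1"
    by (rule mult_left_mono) simp
  moreover have "ennreal (l powr s) * ennreal (l powr (- s)) = 1"
    using l(1) by (simp add: ennreal_mult[symmetric] powr_minus)
  ultimately have "avg Q (\<lambda>y. epow (v y) s) \<le> ennreal (l powr s)"
    by (simp add: mult.assoc[symmetric])
  also have "\<dots> \<le> ennreal (b powr s)" using lb l(1) s by (intro ennreal_leI powr_mono2) auto
  finally show ?thesis .
qed

section \<open>The mixed weak type inequality\<close>

text \<open>On a cube \<open>u\<close> is bounded below almost everywhere by a positive constant, so
  the weighted integral controls the unweighted one. This justifies taking \<open>enn2real\<close>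
  of the integral of \<open>g\<close> over a cube.\<close>

lemma A_1_integral_finite:
  fixes u g :: "real^'n \<Rightarrow> ennreal"
  assumes u: "u \<in> A_1" and g [measurable]: "g \<in> borel_measurable lebesgue" and \<theta>: "\<theta> > 0" and h: "h > 0"
    and fin: "(\<integral>\<^sup>+x. g x * epow (u x) \<theta> \<partial>lebesgue) < \<infinity>"
  shows "(\<integral>\<^sup>+x\<in>cub c h. g x \<partial>lebesgue) < \<infinity>"
proof -
  have um [measurable]: "u \<in> borel_measurable lebesgue" and uw: "weight u" and ul: "locally_integrable u"
    using u unfolding A_1_def weight_def by auto
  obtain A where A: "A > 0"
    and uA: "AE x in lebesgue. x \<in> cub c h \<longrightarrow> avg (cub c h) u \<le> ennreal A * u x"
    using A_1_doubling[OF u] h by blast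
  define U where "U = enn2real (avg (cub c h) u)"
  have eU: "avg (cub c h) u = ennreal U" and U0: "U > 0"
    using avg_finite[OF ul h, of c] avg_pos[OF uw h, of c]
    unfolding U_def by (auto simp: enn2real_positive_iff)
  have "ennreal (U powr \<theta>) * (\<integral>\<^sup>+x\<in>cub c h. g x \<partial>lebesgue)
      = (\<integral>\<^sup>+x. ennreal (U powr \<theta>) * (g x * indicator (cub c h) x) \<partial>lebesgue)"
    by (rule nn_integral_cmult[symmetric]) measurable
  also have "\<dots> \<le> (\<integral>\<^sup>+x. ennreal (A powr \<theta>) * (g x * epow (u x) \<theta>) \<partial>lebesgue)"
  proof (rule nn_integral_mono_AE)
    show "AE x in lebesgue. ennreal (U powr \<theta>) * (g x * indicator (cub c h) x)
        \<le> ennreal (A powr \<theta>) * (g x * epow (u x) \<theta>)"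
      using uA
    proof eventually_elim
      case (elim x)
      show ?case
      proof (cases "x \<in> cub c h")
        case True
        then have "ennreal U \<le> ennreal A * u x" using elim eU by simp
        then have "epow (ennreal U) \<theta> \<le> epow (ennreal A * u x) \<theta>" using \<theta> by (intro epow_mono) auto
        then have "ennreal (U powr \<theta>) \<le> ennreal (A powr \<theta>) * epow (u x) \<theta>"
          using U0 A by (simp add: epow_ennreal epow_mult_ennreal)
        then have "g x * ennreal (U powr \<theta>) \<le> g x * (ennreal (A powr \<theta>) * epow (u x) \<theta>)"
          by (rule mult_left_mono) simp
        then show ?thesis using True by (simp add: mult_ac)
      qed simp
    qed
  qed
  also have "\<dots> = ennreal (A powr \<theta>) * (\<integral>\<^sup>+x. g x * epow (u x) \<theta> \<partial>lebesgue)"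
    by (rule nn_integral_cmult) measurable
  also have "\<dots> < \<infinity>" using fin by (simp add: ennreal_mult_less_top)
  finally have "ennreal (U powr \<theta>) * (\<integral>\<^sup>+x\<in>cub c h. g x \<partial>lebesgue) < \<infinity>" .
  moreover have "ennreal (U powr \<theta>) \<noteq> 0" using U0 by simp
  ultimately show ?thesis by (auto simp: ennreal_mult_less_top)
qed

text \<open>Each closed cube lies in the interior of its double, so Lindelof's theorem applies to
  these interiors. It is applied for every integer label separately, which keeps the height of the
  covering cube unchanged.\<close>

lemma countable_subcover_dilated:
  fixes P :: "('n::finite) lcube set"
  assumes P: "\<And>d. d \<in> P \<Longrightarrow> rad d > 0"
  shows "\<exists>F\<subseteq>P. countable F \<and> (\<forall>d\<in>P. \<forall>x\<in>body d. \<exists>e\<in>F. fst e = fst d \<and> x \<in> dil 2 e)"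
proof -
  have "\<exists>F. F \<subseteq> {d\<in>P. fst d = k} \<and> countable F \<and> (\<forall>d\<in>P. fst d = k \<longrightarrow> (\<forall>x\<in>body d. \<exists>e\<in>F. x \<in> dil 2 e))" for k
  proof -
    let ?I = "\<lambda>d. interior (dil 2 d)" and ?P = "{d\<in>P. fst d = k}"
    obtain \<F> where F: "\<F> \<subseteq> ?I ` ?P" "countable \<F>" "\<Union>\<F> = \<Union>(?I ` ?P)"
      using Lindelof[of "?I ` ?P"] by auto
    then obtain F where F': "countable F" "F \<subseteq> ?P" "\<F> = ?I ` F"
      using countable_subset_image[of \<F> ?I ?P] by auto
    have "\<exists>e\<in>F. x \<in> dil 2 e" if d: "d \<in> P" "fst d = k" "x \<in> body d" for d x
    proof -
      have "x \<in> ?I d"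
        using d(3) P[OF d(1)] unfolding dil_def cub_def interior_cbox mem_box_cart
        by (auto intro: less_le_trans le_less_trans) (smt (verit))+
      then have "x \<in> \<Union>(?I ` ?P)" using d(1,2) by blast
      then have "x \<in> \<Union>\<F>" unfolding F(3) .
      then show ?thesis unfolding F'(3) using interior_subset by blast
    qed
    then show ?thesis using F' by blast
  qed
  then have "\<forall>k. \<exists>F. F \<subseteq> {d\<in>P. fst d = k} \<and> countable F \<and>
      (\<forall>d\<in>P. fst d = k \<longrightarrow> (\<forall>x\<in>body d. \<exists>e\<in>F. x \<in> dil 2 e))" by (rule allI)
  from choice[OF this] obtain F where F0: "\<forall>k. F k \<subseteq> {d\<in>P. fst d = k} \<and> countable (F k) \<and>
      (\<forall>d\<in>P. fst d = k \<longrightarrow> (\<forall>x\<in>body d. \<exists>e\<in>F k. x \<in> dil 2 e))" by (rule exE)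
  note F = F0[THEN spec, THEN conjunct1] F0[THEN spec, THEN conjunct2, THEN conjunct1]
    F0[THEN spec, THEN conjunct2, THEN conjunct2]
  have "countable (\<Union>k. F k)" using F(2) by auto
  moreover have "(\<Union>k. F k) \<subseteq> P" using F(1) by auto
  moreover have "\<exists>e\<in>(\<Union>k. F k). fst e = fst d \<and> x \<in> dil 2 e" if d: "d \<in> P" "x \<in> body d" for d x
  proof -
    obtain e where e: "e \<in> F (fst d)" "x \<in> dil 2 e" using F(3)[of "fst d"] d by blast
    then have "fst e = fst d" using F(1)[of "fst d"] by auto
    then show ?thesis using e by blast
  qed
  ultimately show ?thesis by blast
qed

text \<open>Division by \<open>top\<close> gives \<open>0\<close>, which rules out
  \<open>b = top\<close>; a positive number divided by \<open>0\<close> gives \<open>top\<close>, so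
  the case \<open>b = 0\<close> is set apart.\<close>

lemma ennreal_divide_gt:
  assumes "a / b > ennreal t" and t: "t > 0"
  shows "b < \<infinity>" and "b \<noteq> 0 \<Longrightarrow> ennreal t * b < a"
proof -
  show fin: "b < \<infinity>"
  proof (rule ccontr)
    assume "\<not> b < \<infinity>"
    then have "b = top" by (simp add: less_top[symmetric])
    then show False using assms by (simp add: divide_ennreal_def)
  qed
  show "ennreal t * b < a" if "b \<noteq> 0"
  proof -
    have "ennreal t * b < a / b * b"
      using assms(1) that fin by (intro ennreal_mult_strict_right_mono) (auto simp: less_top zero_less_iff_neq_zero)
    also have "a / b * b = a"
      using that fin by (simp add: ennreal_divide_times ennreal_divide_self less_top)
    finally show ?thesis .
  qed
qed

theorem theorem6:
  fixes u v :: "real^'n \<Rightarrow> ennreal"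
    and \<Phi> \<phi> :: "real \<Rightarrow> real"
    and n r \<delta> \<gamma> p q :: real
  assumes n: "n = real CARD('n)"
    and r: "r \<ge> 1" and \<delta>: "\<delta> \<ge> 0"
    and \<Phi>: "\<Phi> = (\<lambda>z. z powr r * (1 + log_plus z) powr \<delta>)"
    and \<gamma>: "0 < \<gamma>" "\<gamma> < n / r"
    and p: "r < p" "p < n / \<gamma>"
    and q: "1 / q = 1 / p - \<gamma> / n"
    and u: "u \<in> A_1"
    and v: "weight v" "(\<lambda>x. epow (v x) (q * (1 / p + recip_conj r))) \<in> A_infty"
    and \<phi>: "\<phi> = (\<lambda>z. z powr (q / p + q * recip_conj r)
                     * (1 + log_plus z) powr (n * \<delta> / (n - r * \<gamma>)))"
  shows "\<exists>C::real. C > 0 \<and>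
    (\<forall>t::real. t > 0 \<longrightarrow> (\<forall>f::real^'n \<Rightarrow> real. f \<in> borel_measurable lebesgue \<longrightarrow>
      epow (wmeasure (\<lambda>x. u x * epow (v x) (q * (1 / p + recip_conj r)))
              {x. frac_maximal \<gamma> \<Phi> (\<lambda>y. ennreal \<bar>f y\<bar> * v y) x / maximal \<phi> v x > ennreal t})
           (1 / q)
      \<le> ennreal C *
        epow (\<integral>\<^sup>+x. ennreal ((\<bar>f x\<bar> / t) powr p) * epow (u x) (p / q)
                     * epow (v x) (1 + p * recip_conj r) \<partial>lebesgue)
             (1 / p)))"
proof -
  define s where "s = q * (1 / p + recip_conj r)"
  define w where "w = (\<lambda>x. epow (v x) s)"
  have wA: "w \<in> A_infty" using v(2) unfolding w_def s_def .
  have n0: "n > 0" unfolding n by simp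
  have p0: "p > 0" "p > 1" using r p by auto
  have "\<gamma> / n < 1 / p" using p(2) \<gamma>(1) n0 p0 by (simp add: field_simps)
  then have q0: "q > 0" using q by (metis diff_gt_0_iff_gt zero_less_divide_1_iff)
  have "1 / q < 1 / p" using q \<gamma>(1) n0 by simp
  then have qp: "q > p" using p0 q0 by (simp add: field_simps)
  have rc: "recip_conj r \<ge> 0" unfolding recip_conj_def using r by simp
  define \<kappa> where "\<kappa> = q / p"
  have \<kappa>: "\<kappa> > 1" unfolding \<kappa>_def using qp p0 by simp
  have s_eq: "s = \<kappa> + q * recip_conj r" unfolding s_def \<kappa>_def by (simp add: distrib_left)
  have s1: "s > 1" unfolding s_eq using \<kappa> rc q0 by (smt (verit) mult_nonneg_nonneg)
  define \<beta> where "\<beta> = 1 / r - 1 / p"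
  have \<beta>: "\<beta> > 0" unfolding \<beta>_def using p r by (simp add: field_simps)
  have r1inv: "1 / p < 1 / p + \<beta> / s" "1 / p + \<beta> / s < 1 / r"
  proof -
    show "1 / p < 1 / p + \<beta> / s" using \<beta> s1 by simp
    have "\<beta> / s < \<beta>" using \<beta> s1 by (simp add: divide_less_eq)
    then show "1 / p + \<beta> / s < 1 / r" unfolding \<beta>_def by simp
  qed
  \<comment> \<open>This exponent lies strictly between \<open>r\<close> and \<open>p\<close>, since
    \<open>s > 1\<close>. It is the value for which Hoelder's inequality, with \<open>v\<close> to
    the powers \<open>e\<close> and \<open>s\<close>, returns exactly the power \<open>r1\<close> of
    \<open>v\<close>.\<close>
  define r1 where "r1 = 1 / (1 / p + \<beta> / s)"
  have r1i: "1 / r1 = 1 / p + \<beta> / s" unfolding r1_def by simp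
  have r10: "r1 > 0" unfolding r1_def using r1inv p0 by (simp add: add_pos_pos \<beta> s1 divide_pos_pos)
  have r1p: "r1 < p" using r1inv(1) r10 p0 unfolding r1i[symmetric] by (simp add: field_simps)
  have r1r: "r < r1" using r1inv(2) r10 r unfolding r1i[symmetric] by (simp add: field_simps)
  define e where "e = 1 + p * recip_conj r"
  have e_eq: "e * (r1 / p) + s * (1 - r1 / p) = r1"
  proof -
    have "1 - r1 / p = r1 * (1 / r1 - 1 / p)" using r10 by (simp add: field_simps)
    also have "\<dots> = r1 * (\<beta> / s)" unfolding r1i by simp
    finally have "s * (1 - r1 / p) = r1 * \<beta>" using s1 by simp
    moreover have "e * (r1 / p) = r1 * (1 / p + recip_conj r)" unfolding e_def using p0 by (simp add: field_simps)
    moreover have "1 / p + recip_conj r + \<beta> = 1" unfolding \<beta>_def recip_conj_def by simp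
    ultimately show ?thesis by (metis distrib_left mult.right_neutral)
  qed
  \<comment> \<open>The exponent of the average of \<open>w\<close> in
    \<open>level_arith\<close>.\<close>
  define \<rho> where "\<rho> = q / r1 - q / p"
  have \<rho>_eq: "\<rho> = q * (\<beta> / s)"
  proof -
    have "\<rho> = q * (1 / r1 - 1 / p)" unfolding \<rho>_def by (simp add: right_diff_distrib)
    then show ?thesis unfolding r1i by simp
  qed
  have \<rho>: "\<rho> > 0" unfolding \<rho>_eq using q0 \<beta> s1 by simp
  \<comment> \<open>Thus \<open>height d powr (q / s)\<close> splits into one factor
    \<open>height d\<close>, which enters the sum over cubes, and
    \<open>height d powr \<rho>\<close>, which joins the average of \<open>w\<close> in the
    ratio.\<close>
  have qs: "q / s = 1 + \<rho>"
  proof -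
    have "s = q * (1 - \<beta>)" unfolding s_def \<beta>_def recip_conj_def by simp
    then have "q = s + q * \<beta>" by (simp add: right_diff_distrib)
    then have "q / s = (s + q * \<beta>) / s" by simp
    then show ?thesis unfolding \<rho>_eq using s1 by (simp add: add_divide_distrib)
  qed
  obtain C1 where C1: "C1 > 0" and \<Phi>le: "\<And>z. z \<ge> 0 \<Longrightarrow> \<Phi> z \<le> 1 / 2 + C1 * z powr r1"
    using log_bump_le_powr[OF r \<delta> r1r] unfolding \<Phi> by blast
  \<comment> \<open>Because \<open>r * \<gamma> < n\<close>, the exponent of the logarithmic factor
    is nonnegative and that factor is at least \<open>1\<close>.\<close>
  have \<phi>ge: "z powr s \<le> \<phi> z" if "z \<ge> 0" for z
  proof -
    have "n - r * \<gamma> > 0" using \<gamma> r by (simp add: field_simps)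
    then have "n * \<delta> / (n - r * \<gamma>) \<ge> 0" using n0 \<delta> by simp
    then have "(1 + log_plus z) powr (n * \<delta> / (n - r * \<gamma>)) \<ge> 1"
      by (intro ge_one_powr_ge_zero) (auto simp: log_plus_def)
    then have "z powr s * 1 \<le> z powr s * (1 + log_plus z) powr (n * \<delta> / (n - r * \<gamma>))"
      by (rule mult_left_mono) simp
    then show ?thesis unfolding \<phi> s_eq \<kappa>_def by simp
  qed
  \<comment> \<open>Here \<open>2 powr (- q)\<close> stems from \<open>(2 * b) powr s\<close>,
    \<open>2 powr (- 1 - \<rho>)\<close> from rounding to a power of two, and the denominator from
    \<open>level_arith\<close>.\<close>
  define T where "T = 2 powr (- q - 1 - \<rho>) / (2 * C1) powr (q / r1)"
  have T: "T > 0" unfolding T_def using C1 by simp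
  have um [measurable]: "u \<in> borel_measurable lebesgue" using u unfolding A_1_def weight_def by auto
  have vm [measurable]: "v \<in> borel_measurable lebesgue" using v unfolding weight_def by auto
  have ww: "weight w" and wl: "locally_integrable w" using wA unfolding A_infty_def by auto
  have wm [measurable]: "w \<in> borel_measurable lebesgue" using ww unfolding weight_def by auto
  obtain C0 where C0: "C0 > 0" and bound: "\<And>F g H. countable F \<Longrightarrow> g \<in> borel_measurable lebesgue \<Longrightarrow> H \<ge> 0 \<Longrightarrow>
    (\<integral>\<^sup>+x. g x * epow (u x) (1 / \<kappa>) \<partial>lebesgue) \<le> ennreal H \<Longrightarrow>
    (\<forall>d\<in>F. rad d > 0 \<and> avg (body d) w \<le> ennreal (height d) \<and>
        T * (height d * vol d) \<le> enn2real (\<integral>\<^sup>+x\<in>body d. g x \<partial>lebesgue) powr \<kappa>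
           * (enn2real (avg (body d) w) / height d) powr \<rho>) \<Longrightarrow>
    (\<integral>\<^sup>+x\<in>(\<Union>d\<in>F. dil 2 d \<inter> {x. w x \<le> ennreal (height d)}). u x * w x \<partial>lebesgue)
      \<le> ennreal (C0 * H powr \<kappa>)"
    using countable_family_bound[OF u wA \<kappa> \<rho> T] by blast
  have main: "epow (wmeasure (\<lambda>x. u x * w x)
              {x. frac_maximal \<gamma> \<Phi> (\<lambda>y. ennreal \<bar>f y\<bar> * v y) x / maximal \<phi> v x > ennreal t}) (1 / q)
      \<le> ennreal (C0 powr (1 / q)) *
        epow (\<integral>\<^sup>+x. ennreal ((\<bar>f x\<bar> / t) powr p) * epow (u x) (p / q) * epow (v x) e \<partial>lebesgue) (1 / p)"
      (is "epow (wmeasure _ ?E) _ \<le> _ * epow ?I _")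
    if t: "t > 0" and f [measurable]: "f \<in> borel_measurable lebesgue" for t and f :: "real^'n \<Rightarrow> real"
  proof (cases "?I = top")
    case True
    then show ?thesis using C0 by (simp add: ennreal_mult_top)
  next
    case False
    define H where "H = enn2real ?I"
    have H: "H \<ge> 0" "?I = ennreal H" using False unfolding H_def by (auto simp: less_top)
    define g where "g x = ennreal ((\<bar>f x\<bar> / t) powr p) * epow (v x) e" for x
    have gm [measurable]: "g \<in> borel_measurable lebesgue" unfolding g_def by measurable
    have gH: "(\<integral>\<^sup>+x. g x * epow (u x) (1 / \<kappa>) \<partial>lebesgue) = ennreal H"
      unfolding H(2)[symmetric] g_def \<kappa>_def by (simp add: mult_ac)
    define P where "P = {d :: 'n lcube. rad d > 0 \<and> avg (body d) w \<le> ennreal (height d) \<and>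
        T * (height d * vol d) \<le> enn2real (\<integral>\<^sup>+x\<in>body d. g x \<partial>lebesgue) powr \<kappa>
           * (enn2real (avg (body d) w) / height d) powr \<rho>}"
    \<comment> \<open>The family \<open>P\<close> may be uncountable; the bound is applied to a
      countable subfamily whose doubled cubes still cover.\<close>
    obtain F where F: "F \<subseteq> P" "countable F"
        "\<And>d x. d \<in> P \<Longrightarrow> x \<in> body d \<Longrightarrow> \<exists>e\<in>F. fst e = fst d \<and> x \<in> dil 2 e"
      using countable_subcover_dilated[of P] unfolding P_def by blast
    have select: "\<exists>d\<in>P. x \<in> body d \<and> (\<forall>c h. h > 0 \<longrightarrow> x \<in> cub c h \<longrightarrow> avg (cub c h) w \<le> ennreal (height d))"
      if x: "x \<in> ?E" for x
    proof -
      define M where "M = maximal \<phi> v x"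
      have gt: "frac_maximal \<gamma> \<Phi> (\<lambda>y. ennreal \<bar>f y\<bar> * v y) x / M > ennreal t" using x unfolding M_def by simp
      define b where "b = enn2real M"
      have Mb: "M = ennreal b" using ennreal_divide_gt(1)[OF gt t] unfolding b_def by simp
      have b_nonneg: "b \<ge> 0" unfolding b_def by simp
      have avgle: "avg Q w \<le> ennreal (b' powr s)" if "cube Q" "x \<in> Q" "b < b'" for Q b'
        unfolding w_def
      proof (rule maximal_ge_powr_average[OF v(1) _ \<phi>ge that(1,2)])
        show "maximal \<phi> v x < ennreal b'"
          using that(3) b_nonneg unfolding Mb[unfolded M_def] by (simp add: ennreal_less_iff)
      qed (use s1 in auto)
      \<comment> \<open>If the maximal function vanished at \<open>x\<close>, the averages of
        \<open>w\<close> around \<open>x\<close> would lie below every positive number, although a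
        weight has positive averages.\<close>
      have b0: "b > 0"
      proof (rule ccontr)
        assume "\<not> b > 0"
        then have bz: "b = 0" unfolding b_def by (simp add: less_le)
        have xc: "x \<in> cub x 1" by (simp add: mem_cub)
        define W where "W = enn2real (avg (cub x 1) w)"
        have W: "avg (cub x 1) w = ennreal W" "W > 0"
          using avg_finite[OF wl, of 1 x] avg_pos[OF ww, of 1 x] unfolding W_def by (auto simp: enn2real_positive_iff)
        have "ennreal W \<le> ennreal (((W / 2) powr (1 / s)) powr s)"
          unfolding W(1)[symmetric] by (rule avgle) (use xc W(2) bz in auto)
        then show False using W(2) s1 by (simp add: powr_powr)
      qed
      have "ennreal t * M < frac_maximal \<gamma> \<Phi> (\<lambda>y. ennreal \<bar>f y\<bar> * v y) x"
        using ennreal_divide_gt(2)[OF gt t] b0 Mb by simp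
      then obtain Q where Q: "cube Q" "x \<in> Q"
          "ennreal t * M < ennreal (measure lebesgue Q powr (\<gamma> / n)) * lux_avg \<Phi> (\<lambda>y. ennreal \<bar>f y\<bar> * v y) Q"
        unfolding frac_maximal_def less_SUP_iff n by auto
      obtain c h where h: "h > 0" and Qc: "Q = cub c h" using Q(1) cube_iff_cub by blast
      define m where "m = measure lebesgue Q"
      have m: "m > 0" unfolding m_def Qc using h by simp
      \<comment> \<open>Normalised so that the volume factor times \<open>t * L\<close> is
        \<open>t * b\<close>. Hence the Luxemburg average exceeds \<open>t * L\<close>, and the
        modular at that level exceeds \<open>1\<close>.\<close>
      define L where "L = b * m powr (- (\<gamma> / n))"
      have L: "L > 0" unfolding L_def using b0 m by simp
      have "\<not> lux_avg \<Phi> (\<lambda>y. ennreal \<bar>f y\<bar> * v y) Q \<le> ennreal (t * L)"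
      proof
        assume "lux_avg \<Phi> (\<lambda>y. ennreal \<bar>f y\<bar> * v y) Q \<le> ennreal (t * L)"
        then have "ennreal (m powr (\<gamma> / n)) * lux_avg \<Phi> (\<lambda>y. ennreal \<bar>f y\<bar> * v y) Q
            \<le> ennreal (m powr (\<gamma> / n)) * ennreal (t * L)" by (rule mult_left_mono) simp
        also have "\<dots> = ennreal (m powr (\<gamma> / n) * (t * L))" by (simp add: ennreal_mult')
        also have "m powr (\<gamma> / n) * (t * L) = t * b" unfolding L_def using m by (simp add: powr_minus field_simps)
        also have "ennreal (t * b) = ennreal t * M" unfolding Mb using t by (simp add: ennreal_mult')
        finally show False using Q(3) unfolding m_def by simp
      qed
      then have "\<not> avg Q (\<lambda>y. ext_top \<Phi> (ennreal \<bar>f y\<bar> * v y / ennreal (t * L))) \<le> 1"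
        unfolding lux_avg_def using t L by (auto intro: INF_lower)
      then have modular: "1 < avg (cub c h) (\<lambda>y. ext_top \<Phi> (ennreal \<bar>f y\<bar> * v y / ennreal (t * L)))"
        unfolding Qc by simp
      define W where "W = enn2real (avg Q w)"
      have W: "avg Q w = ennreal W" "W > 0"
        using avg_finite[OF wl h, of c] avg_pos[OF ww h, of c] unfolding W_def Qc by (auto simp: enn2real_positive_iff)
      define X where "X = enn2real (\<integral>\<^sup>+x\<in>Q. g x \<partial>lebesgue)"
      have X: "(\<integral>\<^sup>+x\<in>Q. g x \<partial>lebesgue) = ennreal X" "X \<ge> 0"
        using A_1_integral_finite[OF u gm _ h, of "1 / \<kappa>" c] gH \<kappa> unfolding X_def Qc by auto
      have "m * L powr r1 \<le> 2 * C1 * (X powr (r1 / p) * (W * m) powr (1 - r1 / p))"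
        unfolding m_def Qc
        by (rule modular_gt_imp_powr_bound[OF C1 \<Phi>le f v(1) r10 r1p t L h e_eq _ X(2) _ W(2) modular])
          (use X(1) W(1) in \<open>simp_all add: Qc g_def w_def\<close>)
      then have ar: "b powr q * m \<le> (2 * C1) powr (q / r1) * (X powr \<kappa> * W powr \<rho>)"
        unfolding \<kappa>_def \<rho>_def L_def using m b0 X(2) W(2) C1 r10 p0 q0 q by (intro level_arith) auto
      \<comment> \<open>Doubling \<open>b\<close> gives the strict inequality demanded by
        \<open>avgle\<close>.\<close>
      define z where "z = (2 * b) powr s"
      define k where "k = \<lceil>log 2 z\<rceil>"
      define d where "d = (k, c, h)"
      have dQ: "body d = Q" unfolding d_def body_eq Qc rad_def by simp
      have radd: "rad d = h" unfolding d_def rad_def by simp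
      have z0: "z > 0" unfolding z_def using b0 by simp
      have hd: "height d / 2 \<le> z" "z \<le> height d"
        unfolding d_def height_def k_def fst_conv using dyadic_bracket[OF z0] by auto
      have small: "avg Q' w \<le> ennreal (height d)" if "cube Q'" "x \<in> Q'" for Q'
      proof -
        have "avg Q' w \<le> ennreal z" unfolding z_def using avgle[OF that, of "2 * b"] b0 by simp
        also have "\<dots> \<le> ennreal (height d)" using hd(2) by (rule ennreal_leI)
        finally show ?thesis .
      qed
      have "T * (height d * vol d) \<le> X powr \<kappa> * (W / height d) powr \<rho>"
      proof -
        have "(height d / 2) powr (q / s) \<le> z powr (q / s)" using hd q0 s1 by (intro powr_mono2) auto
        also have "z powr (q / s) = 2 powr q * b powr q"
          unfolding z_def using s1 b0 by (simp add: powr_powr powr_mult)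
        finally have "height d powr (1 + \<rho>) / 2 powr (1 + \<rho>) \<le> 2 powr q * b powr q"
          unfolding qs by (simp add: powr_divide)
        then have "2 powr (- q - 1 - \<rho>) * height d powr (1 + \<rho>) \<le> b powr q"
          by (simp add: powr_diff powr_add powr_minus field_simps)
        then have "2 powr (- q - 1 - \<rho>) * height d powr (1 + \<rho>) * m \<le> b powr q * m"
          using m by (intro mult_right_mono) auto
        also note ar
        finally have "2 powr (- q - 1 - \<rho>) * height d powr (1 + \<rho>) * m
            \<le> (2 * C1) powr (q / r1) * (X powr \<kappa> * W powr \<rho>)" .
        then have le: "2 powr (- q - 1 - \<rho>) * (height d * height d powr \<rho>) * m
            \<le> (2 * C1) powr (q / r1) * (X powr \<kappa> * W powr \<rho>)"
          using height_pos[of d] by (simp add: powr_add)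
        have divide_both: "a / D * (y * m) \<le> x * (b / c)" if "a * (y * c) * m \<le> D * (x * b)" "D > 0" "c > 0"
          for a D x y b c :: real
          using that by (simp add: field_simps)
        have "(W / height d) powr \<rho> = W powr \<rho> / height d powr \<rho>"
          using W(2) height_pos[of d] by (simp add: powr_divide)
        then show ?thesis
          unfolding T_def dQ m_def[symmetric] using divide_both[OF le] C1 height_pos[of d] by simp
      qed
      then have "d \<in> P" unfolding P_def using small[OF Q(1,2)] h
        by (simp add: dQ radd X_def W_def)
      moreover have "x \<in> body d" unfolding dQ by (rule Q(2))
      ultimately show ?thesis using small[OF cube_cub] by blast
    qed
    \<comment> \<open>Heights take only countably many values, so a single null set suits all
      cubes.\<close>
    have "AE x in lebesgue. \<forall>k::int. (\<forall>c h. h > 0 \<longrightarrow> x \<in> cub c h \<longrightarrow> avg (cub c h) w \<le> ennreal (2 powr real_of_int k))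
        \<longrightarrow> w x \<le> ennreal (2 powr real_of_int k)"
      unfolding AE_all_countable by (intro allI AE_le_of_averages_le[OF wm]) simp
    then have cover: "AE x in lebesgue. x \<in> ?E \<longrightarrow> x \<in> (\<Union>d\<in>F. dil 2 d \<inter> {x. w x \<le> ennreal (height d)})"
    proof eventually_elim
      case (elim x)
      show ?case
      proof
        assume "x \<in> ?E"
        then obtain d where d: "d \<in> P" "x \<in> body d"
            "\<forall>c h. h > 0 \<longrightarrow> x \<in> cub c h \<longrightarrow> avg (cub c h) w \<le> ennreal (height d)"
          using select by blast
        have wx: "w x \<le> ennreal (height d)" using elim d(3) unfolding height_def by blast
        obtain d' where "d' \<in> F" "fst d' = fst d" "x \<in> dil 2 d'" using F(3)[OF d(1,2)] by blast
        then show "x \<in> (\<Union>d\<in>F. dil 2 d \<inter> {x. w x \<le> ennreal (height d)})"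
          using wx unfolding height_def by auto
      qed
    qed
    have "wmeasure (\<lambda>x. u x * w x) ?E
        \<le> (\<integral>\<^sup>+x\<in>(\<Union>d\<in>F. dil 2 d \<inter> {x. w x \<le> ennreal (height d)}). u x * w x \<partial>lebesgue)"
      unfolding wmeasure_def
    \<comment> \<open>Monotonicity of \<open>nn_integral\<close> holds for arbitrary integrands, so
      the measurability of the level set need not be discussed.\<close>
    proof (rule nn_integral_mono_AE)
      show "AE x in lebesgue. u x * w x * indicator ?E x
          \<le> u x * w x * indicator (\<Union>d\<in>F. dil 2 d \<inter> {x. w x \<le> ennreal (height d)}) x"
        using cover
      proof eventually_elim
        case (elim x)
        show ?case
        proof (cases "x \<in> ?E")
          case True
          have "x \<in> (\<Union>d\<in>F. dil 2 d \<inter> {x. w x \<le> ennreal (height d)})" using elim True by (rule mp)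
          then show ?thesis by (simp only: indicator_simps True)
        next
          case False
          then show ?thesis by (simp only: indicator_simps mult_zero_right zero_le not_False_eq_True)
        qed
      qed
    qed
    also have "\<dots> \<le> ennreal (C0 * H powr \<kappa>)"
      using F(1) unfolding P_def by (intro bound[OF F(2) gm H(1)]) (auto simp: gH)
    finally have "epow (wmeasure (\<lambda>x. u x * w x) ?E) (1 / q) \<le> epow (ennreal (C0 * H powr \<kappa>)) (1 / q)"
      using q0 by (intro epow_mono) auto
    also have "\<dots> = ennreal ((C0 * H powr \<kappa>) powr (1 / q))" using C0 by (simp add: epow_ennreal)
    also have "(C0 * H powr \<kappa>) powr (1 / q) = C0 powr (1 / q) * H powr (1 / p)"
      using C0 q0 unfolding \<kappa>_def by (simp add: powr_mult powr_powr)
    also have "ennreal (C0 powr (1 / q) * H powr (1 / p)) = ennreal (C0 powr (1 / q)) * epow ?I (1 / p)"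
      unfolding H(2) using H(1) by (simp add: epow_ennreal ennreal_mult)
    finally show ?thesis .
  qed
  show ?thesis
  proof (intro exI[of _ "C0 powr (1 / q)"] conjI allI impI)
    show "C0 powr (1 / q) > 0" using C0 by simp
  qed (rule main[unfolded w_def s_def e_def])
qed

end
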